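(* Let $n\in\{2,3\}$ and $Y:=(0,1)^n$. Let $A\in L^{\infty}(Y;\mathbb{R}^{n\times n}_{\mathrm{sym}})$ be uniformly elliptic, i.e., there exist constants $\lambda,\Lambda>0$ such that $\lambda I_n\leq A\leq \Lambda I_n$ a.e. in $Y$, let $b\in L^{\infty}(Y;\mathbb{R}^n)$, and let $f\in L^2(Y)$. Let $F\in H^1(Y;\mathbb{R}^n)$ be such that $f=-\nabla\cdot F$ a.e. in $Y$. Set $\hat{\delta}_0:=(1+\pi^2)^{-1}$ if $\|b\|_{L^\infty(Y)}\neq 0$ and $\hat{\delta}_0:=0$ otherwise. Suppose that there exists $\delta\in(\hat{\delta}_0,1]$ such that $$\frac{|A|^2+|b|^2}{(\mathrm{tr}(A))^2}\leq \frac{1}{n-1+\delta}\quad\text{a.e. in }Y.$$ Let $\gamma:=\frac{\mathrm{tr}(A)}{|A|^2+|b|^2}$, and let $\tilde{L}w:=-A:Dw-b\cdot w$ for $w\in H^1_t(Y;\mathbb{R}^n)$. Then the unique very weak solution $u\in L^2(Y)$ to $$-D^2:(Au)+\nabla\cdot(bu)=f\ \text{ in }Y,\qquad u=0\ \text{ on }\partial Y$$ is of the form $$u=\gamma\tilde u=\frac{\mathrm{tr}(A)}{|A|^2+|b|^2}(-\nabla\cdot\rho),$$ where $\tilde u\in L^2(Y)$ is the unique very weak solution to the renormalized problem $-D^2:(\gamma A\tilde u)+\nabla\cdot(\gamma b\tilde u)=f$ in $Y$, $\tilde u=0$ on $\partial Y$, and $\rho\in H^1_t(Y;\mathbb{R}^n)$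 is the unique solution to $$(-\nabla\cdot\rho,\gamma\tilde{L}w)_{L^2(Y)}+(\mathrm{rot}(\rho),\mathrm{rot}(w))_{L^2(Y)}=(F,w)_{L^2(Y)}\quad\forall w\in H^1_t(Y;\mathbb{R}^n).$$
   Context: $\mathbb{R}^{n\times n}_{\mathrm{sym}}$ denotes the symmetric real $n\times n$ matrices, $I_n$ the identity matrix, and matrix inequalities are in the sense of quadratic forms. For matrices $M,N$, $M:N:=\sum_{i,j}M_{ij}N_{ij}$ and $|M|:=\sqrt{M:M}$; $|b|$ is the Euclidean norm. $D^2v$ is the Hessian of $v$, $Dw$ the Jacobian of a vector field $w$. All functions are real-valued. $H^1_t(Y;\mathbb{R}^n)$ is the subset of $H^1(Y;\mathbb{R}^n)$ consisting of vector fields with vanishing tangential trace on $\partial Y$ (that is, on each face of the cube with normal direction $e_j$, the traces of all components $w_i$ with $i\neq j$ vanish). Convention: $\mathrm{rot}(w):=\partial_2w_1-\partial_1w_2$ when $n=2$, and $\mathrm{rot}(w):=\nabla\times w$ when $n=3$. Very weak solutions: with $L\varphi:=-A:D^2\varphi-b\cdot\nabla\varphi$, $u\in L^2(Y)$ is a very weak solution to $-D^2:(Au)+\nabla\cdot(bu)=f$ in $Y$, $u=0$ on $\partial Y$, if $(u,L\varphi)_{L^2(Y)}=(f,\varphi)_{L^2(Y)}$ for all $\varphi\in H^2(Y)\cap H^1_0(Y)$. Likewise, $\tilde u\in L^2(Y)$ is a very weak solution to the renormalized problem if $(\tilde u,\gamma L\varphi)_{L^2(Y)}=(f,\varphi)_{L^2(Y)}$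 for all $\varphi\in H^2(Y)\cap H^1_0(Y)$. *)

theory Defs
  imports "HOL-Analysis.Analysis" "HOL-Probability.Essential_Supremum"
begin

text \<open>
  Elements of function spaces over the cube are represented by functions on the whole of
  \<open>real^'n\<close> of which only the values in \<open>cube\<close>, up to Lebesgue null sets, matter.
  Matrices are elements of \<open>real^'n^'n\<close>, whose library inner product and norm are
  \<open>M : N\<close> and the Frobenius norm:
\<close>

lemma matrix_inner: "(M :: real^'n^'n) \<bullet> N = (\<Sum>i\<in>UNIV. \<Sum>j\<in>UNIV. M $ i $ j * N $ i $ j)"
  by (simp add: inner_vec_def)

lemma matrix_norm: "norm (M :: real^'n^'n) = sqrt (M \<bullet> M)"
  by (rule norm_eq_sqrt_inner)

definition cube :: "(real^'n) set" where
  "cube = {x. \<forall>i. 0 < x $ i \<and> x $ i < 1}"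


section \<open>Lebesgue spaces\<close>

definition L2 :: "'a measure \<Rightarrow> ('a \<Rightarrow> 'b::euclidean_space) set" where
  "L2 M = {v \<in> borel_measurable M. integrable M (\<lambda>x. (norm (v x))\<^sup>2)}"

abbreviation L2_cube :: "(real^'n \<Rightarrow> 'b::euclidean_space) set" where
  "L2_cube \<equiv> L2 (lebesgue_on cube)"

definition L2_inner :: "(real^'n \<Rightarrow> 'b::euclidean_space) \<Rightarrow> (real^'n \<Rightarrow> 'b) \<Rightarrow> real" where
  "L2_inner v w = (LINT x|lebesgue_on cube. v x \<bullet> w x)"

definition Linf_norm :: "(real^'n \<Rightarrow> 'b::euclidean_space) \<Rightarrow> ereal" where
  "Linf_norm v = esssup (lebesgue_on cube) (\<lambda>x. ereal (norm (v x)))"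

definition Linf :: "(real^'n \<Rightarrow> 'b::euclidean_space) set" where
  "Linf = {v \<in> borel_measurable (lebesgue_on cube). Linf_norm v < \<infinity>}"


section \<open>Smooth functions and weak derivatives\<close>

definition partial_deriv :: "'n \<Rightarrow> (real^'n \<Rightarrow> real) \<Rightarrow> real^'n \<Rightarrow> real" where
  "partial_deriv i v x = frechet_derivative v (at x) (axis i 1)"

primrec Ck :: "nat \<Rightarrow> (real^'n \<Rightarrow> real) \<Rightarrow> bool" where
  "Ck 0 v \<longleftrightarrow> continuous_on UNIV v"
| "Ck (Suc k) v \<longleftrightarrow> v differentiable_on UNIV \<and> (\<forall>i. Ck k (partial_deriv i v))"

definition smooth :: "(real^'n \<Rightarrow> real) \<Rightarrow> bool" where
  "smooth v \<longleftrightarrow> (\<forall>k. Ck k v)"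

definition test_functions :: "(real^'n \<Rightarrow> real) set" where
  "test_functions = {\<phi>. smooth \<phi> \<and> compact (closure {x. \<phi> x \<noteq> 0}) \<and> closure {x. \<phi> x \<noteq> 0} \<subseteq> cube}"

definition has_weak_partial :: "'n \<Rightarrow> (real^'n \<Rightarrow> real) \<Rightarrow> (real^'n \<Rightarrow> real) \<Rightarrow> bool" where
  "has_weak_partial i v g \<longleftrightarrow>
     (\<forall>\<phi>\<in>test_functions. L2_inner v (partial_deriv i \<phi>) = - L2_inner g \<phi>)"

definition H1 :: "(real^'n \<Rightarrow> real) set" where
  "H1 = {v \<in> L2_cube. \<forall>i. \<exists>g\<in>L2_cube. has_weak_partial i v g}"

text \<open>The weak derivative is only determined almost everywhere; \<open>wderiv\<close> picks a representative.\<close>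

definition wderiv :: "'n \<Rightarrow> (real^'n \<Rightarrow> real) \<Rightarrow> real^'n \<Rightarrow> real" where
  "wderiv i v = (SOME g. g \<in> L2_cube \<and> has_weak_partial i v g)"

definition wgrad :: "(real^'n \<Rightarrow> real) \<Rightarrow> real^'n \<Rightarrow> real^'n" where
  "wgrad v x = (\<chi> i. wderiv i v x)"

definition wjac :: "(real^'n \<Rightarrow> real^'n) \<Rightarrow> real^'n \<Rightarrow> real^'n^'n" where
  "wjac w x = (\<chi> i j. wderiv j (\<lambda>y. w y $ i) x)"

definition whess :: "(real^'n \<Rightarrow> real) \<Rightarrow> real^'n \<Rightarrow> real^'n^'n" where
  "whess v = wjac (wgrad v)"

definition wdiv :: "(real^'n \<Rightarrow> real^'n) \<Rightarrow> real^'n \<Rightarrow> real" where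
  "wdiv w x = (\<Sum>i\<in>UNIV. wderiv i (\<lambda>y. w y $ i) x)"

definition rot2 :: "(real^2 \<Rightarrow> real^2) \<Rightarrow> real^2 \<Rightarrow> real" where
  "rot2 w x = wderiv 2 (\<lambda>y. w y $ 1) x - wderiv 1 (\<lambda>y. w y $ 2) x"

definition rot3 :: "(real^3 \<Rightarrow> real^3) \<Rightarrow> real^3 \<Rightarrow> real^3" where
  "rot3 w x = vector
     [wderiv 2 (\<lambda>y. w y $ 3) x - wderiv 3 (\<lambda>y. w y $ 2) x,
      wderiv 3 (\<lambda>y. w y $ 1) x - wderiv 1 (\<lambda>y. w y $ 3) x,
      wderiv 1 (\<lambda>y. w y $ 2) x - wderiv 2 (\<lambda>y. w y $ 1) x]"


section \<open>Sobolev spaces\<close>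

definition H1_norm :: "(real^'n \<Rightarrow> real) \<Rightarrow> real" where
  "H1_norm v = sqrt (L2_inner v v + (\<Sum>i\<in>UNIV. L2_inner (wderiv i v) (wderiv i v)))"

definition H10 :: "(real^'n \<Rightarrow> real) set" where
  "H10 = {v \<in> H1. \<exists>\<phi>. (\<forall>k. \<phi> k \<in> test_functions) \<and>
                      (\<lambda>k. H1_norm (\<lambda>x. \<phi> k x - v x)) \<longlonglongrightarrow> 0}"

definition H2 :: "(real^'n \<Rightarrow> real) set" where
  "H2 = {v \<in> H1. \<forall>i. wderiv i v \<in> H1}"

definition H1_vec :: "(real^'n \<Rightarrow> real^'n) set" where
  "H1_vec = {w. \<forall>i. (\<lambda>x. w x $ i) \<in> H1}"

text \<open>
  The surface measure on the face of the cube in the hyperplane \<open>x $ j = c\<close> is the image of the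
  Lebesgue measure on the cube under the orthogonal projection onto this hyperplane, because the
  cube has edge length 1. The trace operator is the continuous extension, with respect to the
  \<open>H1\<close> norm, of the restriction of smooth functions to the face.
\<close>

definition face_measure :: "'n \<Rightarrow> real \<Rightarrow> (real^'n) measure" where
  "face_measure j c = distr (lebesgue_on cube) borel (\<lambda>x. \<chi> i. if i = j then c else x $ i)"

definition has_face_trace :: "'n \<Rightarrow> real \<Rightarrow> (real^'n \<Rightarrow> real) \<Rightarrow> (real^'n \<Rightarrow> real) \<Rightarrow> bool" where
  "has_face_trace j c v g \<longleftrightarrow> v \<in> H1 \<and> g \<in> L2 (face_measure j c) \<and>
     (\<exists>\<phi>. (\<forall>k. smooth (\<phi> k)) \<and>
          (\<lambda>k. H1_norm (\<lambda>x. \<phi> k x - v x)) \<longlonglongrightarrow> 0 \<and>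
          (\<lambda>k. LINT x|face_measure j c. (\<phi> k x - g x)\<^sup>2) \<longlonglongrightarrow> 0)"

definition H1_t :: "(real^'n \<Rightarrow> real^'n) set" where
  "H1_t = {w \<in> H1_vec. \<forall>j. \<forall>c\<in>{0, 1}. \<forall>i. i \<noteq> j \<longrightarrow> has_face_trace j c (\<lambda>x. w x $ i) (\<lambda>_. 0)}"


section \<open>The boundary value problems\<close>

definition uniformly_elliptic :: "(real^'n \<Rightarrow> real^'n^'n) \<Rightarrow> bool" where
  "uniformly_elliptic A \<longleftrightarrow> (\<exists>lo>0. \<exists>up>0. AE x in lebesgue_on cube.
     \<forall>\<xi>. lo * (\<xi> \<bullet> \<xi>) \<le> \<xi> \<bullet> (A x *v \<xi>) \<and> \<xi> \<bullet> (A x *v \<xi>) \<le> up * (\<xi> \<bullet> \<xi>))"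

definition renorm :: "(real^'n \<Rightarrow> real^'n^'n) \<Rightarrow> (real^'n \<Rightarrow> real^'n) \<Rightarrow> real^'n \<Rightarrow> real" where
  "renorm A b x = trace (A x) / ((norm (A x))\<^sup>2 + (norm (b x))\<^sup>2)"

definition L_op :: "(real^'n \<Rightarrow> real^'n^'n) \<Rightarrow> (real^'n \<Rightarrow> real^'n) \<Rightarrow> (real^'n \<Rightarrow> real) \<Rightarrow> real^'n \<Rightarrow> real"
  where "L_op A b \<phi> x = - (A x \<bullet> whess \<phi> x) - b x \<bullet> wgrad \<phi> x"

definition L_tilde :: "(real^'n \<Rightarrow> real^'n^'n) \<Rightarrow> (real^'n \<Rightarrow> real^'n) \<Rightarrow> (real^'n \<Rightarrow> real^'n) \<Rightarrow> real^'n \<Rightarrow> real"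
  where "L_tilde A b w x = - (A x \<bullet> wjac w x) - b x \<bullet> w x"

definition very_weak_solution ::
  "(real^'n \<Rightarrow> real^'n^'n) \<Rightarrow> (real^'n \<Rightarrow> real^'n) \<Rightarrow> (real^'n \<Rightarrow> real) \<Rightarrow> (real^'n \<Rightarrow> real) \<Rightarrow> bool" where
  "very_weak_solution A b f u \<longleftrightarrow> u \<in> L2_cube \<and>
     (\<forall>\<phi>\<in>H2 \<inter> H10. L2_inner u (L_op A b \<phi>) = L2_inner f \<phi>)"

definition renorm_very_weak_solution ::
  "(real^'n \<Rightarrow> real^'n^'n) \<Rightarrow> (real^'n \<Rightarrow> real^'n) \<Rightarrow> (real^'n \<Rightarrow> real) \<Rightarrow> (real^'n \<Rightarrow> real) \<Rightarrow> bool" where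
  "renorm_very_weak_solution A b f u \<longleftrightarrow> u \<in> L2_cube \<and>
     (\<forall>\<phi>\<in>H2 \<inter> H10. L2_inner u (\<lambda>x. renorm A b x * L_op A b \<phi> x) = L2_inner f \<phi>)"

text \<open>The argument \<open>rot\<close> is to be \<open>rot2\<close> or \<open>rot3\<close>.\<close>

definition rho_solution ::
  "((real^'n \<Rightarrow> real^'n) \<Rightarrow> real^'n \<Rightarrow> 'r::euclidean_space) \<Rightarrow>
   (real^'n \<Rightarrow> real^'n^'n) \<Rightarrow> (real^'n \<Rightarrow> real^'n) \<Rightarrow> (real^'n \<Rightarrow> real^'n) \<Rightarrow> (real^'n \<Rightarrow> real^'n) \<Rightarrow> bool" where
  "rho_solution rot A b F \<rho> \<longleftrightarrow> \<rho> \<in> H1_t \<and>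
     (\<forall>w\<in>H1_t. L2_inner (\<lambda>x. - wdiv \<rho> x) (\<lambda>x. renorm A b x * L_tilde A b w x)
                + L2_inner (rot \<rho>) (rot w) = L2_inner F w)"

definition unique_AE :: "((real^'n \<Rightarrow> 'b) \<Rightarrow> bool) \<Rightarrow> (real^'n \<Rightarrow> 'b) \<Rightarrow> bool" where
  "unique_AE P v \<longleftrightarrow> P v \<and> (\<forall>v'. P v' \<longrightarrow> (AE x in lebesgue_on cube. v' x = v x))"

definition delta0 :: "(real^'n \<Rightarrow> real^'n) \<Rightarrow> real" where
  "delta0 b = (if Linf_norm b \<noteq> 0 then inverse (1 + pi\<^sup>2) else 0)"

end

theory Submission
  imports Defs
begin

text \<open>
  On the cube the fields in \<open>H1_t\<close> are limits of products of sines and cosines, which yields the identity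
  \<open>|div w|\<^sup>2 + |rot w|\<^sup>2 = |Dw|\<^sup>2\<close> and the inequality \<open>pi |w| \<le> |Dw|\<close> in \<open>L\<^sup>2\<close>. The Cordes condition says that
  \<open>|I - \<gamma> A|\<^sup>2 + |\<gamma> b|\<^sup>2 \<le> 1 - \<delta>\<close>, so \<open>T w = div w - \<gamma> (A : Dw + b \<cdot> w)\<close> satisfies \<open>|T w| \<le> q |Dw|\<close> with
  \<open>q < 1\<close>; the value of \<open>\<delta>\<^sub>0\<close> is exactly what makes \<open>(1 - \<delta>) (1 + pi\<^sup>-\<^sup>2) < 1\<close>. The equation for \<open>\<rho>\<close> becomes
  \<open>(D\<rho>, Dw) = (F, w) + (div \<rho>, T w)\<close>, a contraction after the Riesz representation. Gradients of functions in
  \<open>H2 \<inter> H10\<close> are admissible \<open>w\<close> with \<open>rot w = 0\<close>, so \<open>- div \<rho>\<close> solves the renormalized problem. Uniqueness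
  there follows by testing with inverse Laplacians of sine sums.
\<close>

section \<open>Smooth functions\<close>

text \<open>Boundary conditions are encoded by product systems: \<open>trig T k\<close> has cosines
  in the directions in \<open>T\<close> and sines in the others. Component \<open>i\<close> of a
  tangentially vanishing field belongs to \<open>T = {i}\<close>, a function in \<open>H10\<close>
  to \<open>T = {}\<close>. Differentiation in direction \<open>j\<close> toggles the membership of
  \<open>j\<close> in \<open>T\<close>, so a weak derivative has the termwise differentiated
  expansion once Green's formula holds against the toggled system. Two obstacles shape the proof. A
  vanishing trace is witnessed by smooth approximations that may differ from face to face, so no
  given sequence respects all conditions at once; the partial Fourier sums do, and they stand in for
  the field in the decisive identity. And \<open>H10\<close> is the closure of the compactly
  supported functions, so even sine products have to be placed in it by explicit cutoffs.
  Orthogonality comes from integration by parts alone; no trigonometric integral is computed.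
  Finally, \<gamma> is bounded above and away from zero, so multiplication and division by it
  translate the two very weak problems into each other, and uniqueness passes from one to the
  other.\<close>

lemma partial_deriv_eq:
  assumes "(v has_derivative D) (at x)"
  shows "partial_deriv i v x = D (axis i 1)"
  using frechet_derivative_at[OF assms] by (simp add: partial_deriv_def)

lemma Ck_differentiable: "Ck (Suc k) v \<Longrightarrow> v differentiable (at x)"
  by (simp add: differentiable_on_eq_differentiable_at)

lemma Ck_SucD: "Ck (Suc k) v \<Longrightarrow> Ck k v"
proof (induction k arbitrary: v)
  case 0
  then show ?case by (simp add: differentiable_imp_continuous_on)
next
  case (Suc k)
  from Suc.prems have d: "v differentiable_on UNIV" and p: "\<forall>i. Ck (Suc k) (partial_deriv i v)"
    using Ck.simps(2) by blast+
  have "\<forall>i. Ck k (partial_deriv i v)"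
    using p Suc.IH by blast
  with d show ?case by simp
qed

lemma partial_deriv_add:
  assumes "u differentiable (at x)" "v differentiable (at x)"
  shows "partial_deriv i (\<lambda>x. u x + v x) x = partial_deriv i u x + partial_deriv i v x"
proof -
  have "((\<lambda>x. u x + v x) has_derivative
      (\<lambda>h. frechet_derivative u (at x) h + frechet_derivative v (at x) h)) (at x)"
    using assms by (intro has_derivative_add) (simp_all flip: frechet_derivative_works)
  from partial_deriv_eq[OF this] show ?thesis by (simp add: partial_deriv_def)
qed

lemma partial_deriv_mult:
  assumes "u differentiable (at x)" "v differentiable (at x)"
  shows "partial_deriv i (\<lambda>x. u x * v x) x = partial_deriv i u x * v x + u x * partial_deriv i v x"
proof -
  have "((\<lambda>x. u x * v x) has_derivative
      (\<lambda>h. u x * frechet_derivative v (at x) h + frechet_derivative u (at x) h * v x)) (at x)"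
    using assms by (intro has_derivative_mult) (simp_all flip: frechet_derivative_works)
  from partial_deriv_eq[OF this] show ?thesis by (simp add: partial_deriv_def)
qed

lemma partial_deriv_const [simp]: "partial_deriv i (\<lambda>x. c) = (\<lambda>x. 0)"
  by (rule ext, rule partial_deriv_eq) simp

lemma Ck_const: "Ck k (\<lambda>x. c)"
  by (induction k arbitrary: c) auto

lemma Ck_add: "Ck k u \<Longrightarrow> Ck k v \<Longrightarrow> Ck k (\<lambda>x. u x + v x)"
proof (induction k arbitrary: u v)
  case 0
  then show ?case by (auto intro: continuous_on_add)
next
  case (Suc k)
  have "partial_deriv i (\<lambda>x. u x + v x) = (\<lambda>x. partial_deriv i u x + partial_deriv i v x)" for i
    using Suc.prems by (intro ext partial_deriv_add) (auto intro: Ck_differentiable)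
  with Suc show ?case by (auto intro!: differentiable_on_add)
qed

lemma Ck_mult: "Ck k u \<Longrightarrow> Ck k v \<Longrightarrow> Ck k (\<lambda>x. u x * v x)"
proof (induction k arbitrary: u v)
  case 0
  then show ?case by (auto intro: continuous_on_mult)
next
  case (Suc k)
  have eq: "partial_deriv i (\<lambda>x. u x * v x) = (\<lambda>x. partial_deriv i u x * v x + u x * partial_deriv i v x)" for i
    using Suc.prems by (intro ext partial_deriv_mult) (auto intro: Ck_differentiable)
  have "Ck k u" "Ck k v"
    using Suc.prems by (blast intro: Ck_SucD)+
  with Suc show ?case by (auto simp: eq intro!: differentiable_on_mult Ck_add)
qed

lemma smooth_differentiable: "smooth v \<Longrightarrow> v differentiable (at x)"
  using Ck_differentiable smooth_def by blast

lemma smooth_partial_deriv: "smooth v \<Longrightarrow> smooth (partial_deriv i v)"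
  unfolding smooth_def by (metis Ck.simps(2))

lemma smooth_continuous: "smooth v \<Longrightarrow> continuous_on UNIV v"
  unfolding smooth_def by (metis Ck.simps(1))

lemma smooth_const [simp]: "smooth (\<lambda>x. c)"
  by (simp add: smooth_def Ck_const)

lemma smooth_add: "smooth u \<Longrightarrow> smooth v \<Longrightarrow> smooth (\<lambda>x. u x + v x)"
  by (simp add: smooth_def Ck_add)

lemma smooth_mult: "smooth u \<Longrightarrow> smooth v \<Longrightarrow> smooth (\<lambda>x. u x * v x)"
  by (simp add: smooth_def Ck_mult)

lemma smooth_diff: "smooth u \<Longrightarrow> smooth v \<Longrightarrow> smooth (\<lambda>x. u x - v x)"
  using smooth_add[of u "\<lambda>x. (-1) * v x"] smooth_mult[of "\<lambda>x. -1" v] by simp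

lemma smooth_sum: "(\<And>a. a \<in> S \<Longrightarrow> smooth (f a)) \<Longrightarrow> smooth (\<lambda>x. \<Sum>a\<in>S. f a x)"
  by (induction S rule: infinite_finite_induct) (auto intro: smooth_add)

lemma smooth_prod: "(\<And>a. a \<in> S \<Longrightarrow> smooth (f a)) \<Longrightarrow> smooth (\<lambda>x. \<Prod>a\<in>S. f a x)"
  by (induction S rule: infinite_finite_induct) (auto intro: smooth_mult)

lemma partial_deriv_cmult:
  assumes "smooth v"
  shows "partial_deriv i (\<lambda>x. c * v x) x = c * partial_deriv i v x"
  using partial_deriv_mult[of "\<lambda>x. c" x v i] smooth_differentiable[OF assms, of x] by simp

lemma partial_deriv_diff:
  assumes "smooth u" "smooth v"
  shows "partial_deriv i (\<lambda>x. u x - v x) x = partial_deriv i u x - partial_deriv i v x"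
  using partial_deriv_add[of u x "\<lambda>x. (-1) * v x" i] partial_deriv_cmult[OF assms(2), of i "-1" x]
    smooth_differentiable[OF assms(1), of x]
    smooth_differentiable[OF smooth_mult[OF smooth_const assms(2)], of "-1" x] by simp

lemma partial_deriv_sum:
  assumes "\<And>a. a \<in> S \<Longrightarrow> smooth (f a)"
  shows "partial_deriv i (\<lambda>x. \<Sum>a\<in>S. f a x) x = (\<Sum>a\<in>S. partial_deriv i (f a) x)"
  using assms
proof (induction S rule: infinite_finite_induct)
  case (insert a S)
  have "partial_deriv i (\<lambda>x. f a x + (\<Sum>a\<in>S. f a x)) x
      = partial_deriv i (f a) x + partial_deriv i (\<lambda>x. \<Sum>a\<in>S. f a x) x"
    using insert by (intro partial_deriv_add smooth_differentiable smooth_sum) auto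
  then show ?case using insert by simp
qed auto

lemma partial_deriv_prod:
  assumes "finite S" "\<And>a. a \<in> S \<Longrightarrow> smooth (f a)"
  shows "partial_deriv i (\<lambda>x. \<Prod>a\<in>S. f a x) x
    = (\<Sum>a\<in>S. partial_deriv i (f a) x * (\<Prod>b\<in>S - {a}. f b x))"
  using assms
proof (induction S rule: finite_induct)
  case (insert a S)
  have "partial_deriv i (\<lambda>x. f a x * (\<Prod>a\<in>S. f a x)) x
      = partial_deriv i (f a) x * (\<Prod>a\<in>S. f a x) + f a x * partial_deriv i (\<lambda>x. \<Prod>a\<in>S. f a x) x"
    using insert by (intro partial_deriv_mult smooth_differentiable smooth_prod) auto
  moreover have "insert a S - {b} = insert a (S - {b})" if "b \<in> S" for b
    using that insert by auto
  moreover have "insert a S - {a} = S"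
    using insert by auto
  ultimately show ?case
    using insert by (auto simp: sum_distrib_left algebra_simps intro!: sum.cong)
qed auto

text \<open>The witness \<open>d\<close> lists all iterated derivatives, so a concrete function is
  shown to be smooth by a closed formula for its derivative of order \<open>m\<close>.\<close>

definition smooth1 :: "(real \<Rightarrow> real) \<Rightarrow> bool" where
  "smooth1 f \<longleftrightarrow> (\<exists>d. d 0 = f \<and> (\<forall>m t. (d m has_real_derivative d (Suc m) t) (at t)))"

lemma smooth1E:
  assumes "smooth1 f"
  obtains f' where "smooth1 f'" "\<And>t. (f has_real_derivative f' t) (at t)"
proof -
  from assms obtain d where d: "d 0 = f" "\<And>m t. (d m has_real_derivative d (Suc m) t) (at t)"
    unfolding smooth1_def by blast
  have "smooth1 (d 1)"
    unfolding smooth1_def by (rule exI[of _ "\<lambda>m. d (Suc m)"]) (simp add: d)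
  moreover have "(f has_real_derivative d 1 t) (at t)" for t
    using d(2)[of 0 t] d(1) by simp
  ultimately show ?thesis using that by blast
qed

lemma has_derivative_coord:
  fixes x :: "real^'n"
  assumes "(f has_real_derivative c) (at (x $ i))"
  shows "((\<lambda>x. f (x $ i)) has_derivative (\<lambda>h. c * h $ i)) (at x)"
proof -
  have "((\<lambda>x. x $ i) has_derivative (\<lambda>h. h $ i)) (at x)"
    by (rule bounded_linear.has_derivative[OF bounded_linear_vec_nth]) simp
  from has_derivative_compose[OF this assms[unfolded has_field_derivative_def]]
  show ?thesis .
qed

lemma partial_deriv_coord:
  fixes x :: "real^'n"
  assumes "(f has_real_derivative c) (at (x $ i))"
  shows "partial_deriv j (\<lambda>x. f (x $ i)) x = (if j = i then c else 0)"
  using partial_deriv_eq[OF has_derivative_coord[OF assms], of j] by (simp add: axis_def)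

lemma partial_deriv_compose1:
  assumes "\<And>t. (f has_real_derivative f' t) (at t)" "q differentiable (at x)"
  shows "partial_deriv j (\<lambda>x. f (q x)) x = f' (q x) * partial_deriv j q x"
proof -
  have q: "(q has_derivative frechet_derivative q (at x)) (at x)"
    using assms(2) frechet_derivative_works by blast
  have f: "(f has_derivative (*) (f' (q x))) (at (q x))"
    using assms(1) by (simp add: has_field_derivative_def)
  have "((\<lambda>x. f (q x)) has_derivative (\<lambda>h. f' (q x) * frechet_derivative q (at x) h)) (at x)"
    using has_derivative_compose[OF q f] .
  from partial_deriv_eq[OF this] show ?thesis by (simp add: partial_deriv_def)
qed

text \<open>The induction generalises the outer function, because the chain rule replaces it by its
  derivative.\<close>

lemma smooth_compose1:
  assumes "smooth1 f" "smooth q"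
  shows "smooth (\<lambda>x. f (q x))"
proof -
  have "Ck k (\<lambda>x. f (q x))" for k
    using assms
  proof (induction k arbitrary: f)
    case 0
    obtain f' where f': "smooth1 f'" "\<And>t. (f has_real_derivative f' t) (at t)"
      using smooth1E[OF 0(1)] by blast
    have "continuous_on UNIV f"
      using f'(2) by (meson DERIV_isCont continuous_at_imp_continuous_on)
    then have "continuous_on UNIV (\<lambda>x. f (q x))"
      by (rule continuous_on_compose2) (use smooth_continuous[OF 0(2)] in auto)
    then show ?case by simp
  next
    case (Suc k)
    obtain f' where f': "smooth1 f'" "\<And>t. (f has_real_derivative f' t) (at t)"
      using smooth1E[OF Suc.prems(1)] by blast
    have q: "q differentiable (at x)" for x
      by (rule smooth_differentiable[OF Suc.prems(2)])
    have "partial_deriv j (\<lambda>x. f (q x)) = (\<lambda>x. f' (q x) * partial_deriv j q x)" for j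
      by (rule ext) (rule partial_deriv_compose1[OF f'(2) q])
    moreover have "f differentiable (at t)" for t
      using f'(2) real_differentiable_def by blast
    then have "(\<lambda>x. f (q x)) differentiable_on UNIV"
      using differentiable_compose[OF _ q, of f] by (simp add: differentiable_on_eq_differentiable_at)
    moreover have "Ck k (\<lambda>x. f' (q x) * partial_deriv j q x)" for j
      using Suc.IH[OF f'(1) Suc.prems(2)] smooth_partial_deriv[OF Suc.prems(2)]
      by (intro Ck_mult) (simp_all add: smooth_def)
    ultimately show ?case by simp
  qed
  then show ?thesis by (simp add: smooth_def)
qed

lemma smooth_nth: "smooth (\<lambda>x :: real^'n. x $ i)"
proof -
  have p: "partial_deriv j (\<lambda>x :: real^'n. x $ i) = (\<lambda>x. if j = i then 1 else 0)" for j
    by (rule ext) (simp add: partial_deriv_coord[OF DERIV_ident])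
  have "(\<lambda>x :: real^'n. x $ i) differentiable_on UNIV"
    using has_derivative_coord[of "\<lambda>t. t" 1] unfolding differentiable_on_def differentiable_def by fastforce
  then have "Ck k (\<lambda>x :: real^'n. x $ i)" for k
    by (cases k) (auto simp: p Ck_const intro: continuous_intros)
  then show ?thesis by (simp add: smooth_def)
qed

lemma smooth1_sin_cos: "smooth1 (\<lambda>t. sin (a * t))" "smooth1 (\<lambda>t. cos (a * t))"
proof -
  \<comment> \<open>Each differentiation advances the phase by a quarter period;
    \<open>c = 0\<close> gives the sine and \<open>c = pi / 2\<close> the cosine.\<close>
  have *: "((\<lambda>t. a ^ m * sin (a * t + c + real m * (pi / 2))) has_real_derivative
      a ^ Suc m * sin (a * t + c + real (Suc m) * (pi / 2))) (at t)" for m t c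
  proof -
    have "sin (a * t + c + real (Suc m) * (pi / 2)) = cos (a * t + c + real m * (pi / 2))"
      using sin_add[of "a * t + c + real m * (pi / 2)" "pi / 2"] by (simp add: algebra_simps add_divide_distrib)
    then show ?thesis
      by (auto intro!: derivative_eq_intros)
  qed
  show "smooth1 (\<lambda>t. sin (a * t))"
    unfolding smooth1_def
    by (rule exI[of _ "\<lambda>m t. a ^ m * sin (a * t + 0 + real m * (pi / 2))"]) (use *[of _ 0] in auto)
  have "sin (a * t + pi / 2 + real 0 * (pi / 2)) = cos (a * t)" for t
    using sin_add[of "a * t" "pi / 2"] by simp
  then show "smooth1 (\<lambda>t. cos (a * t))"
    unfolding smooth1_def
    by (intro exI[of _ "\<lambda>m t. a ^ m * sin (a * t + pi / 2 + real m * (pi / 2))"]) (use * in auto)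
qed

section \<open>A smooth transition function on the line\<close>

definition bump :: "real \<Rightarrow> real" where
  "bump s = (if s > 0 then exp (- 1 / s) else 0)"

text \<open>The exponent \<open>k\<close> is arbitrary so that the induction over the coefficients
  can absorb the factor \<open>y\<close> coming from \<open>pCons\<close>.\<close>

lemma poly_exp_tendsto_0:
  fixes p :: "real poly"
  shows "((\<lambda>y. y ^ k * poly p y / exp y) \<longlongrightarrow> 0) at_top"
proof (induction p arbitrary: k)
  case (pCons a p)
  have "((\<lambda>y. a * (y ^ k / exp y) + y ^ Suc k * poly p y / exp y) \<longlongrightarrow> a * 0 + 0) at_top"
    by (intro tendsto_intros tendsto_power_div_exp_0 pCons.IH)
  then show ?case
    by (simp add: algebra_simps add_divide_distrib)
qed simp

text \<open>The polynomials arise from differentiating \<open>p (1/s) exp (-1/s)\<close>.\<close>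

lemma has_real_derivative_poly_bump:
  fixes p :: "real poly"
  shows "((\<lambda>s. poly p (1 / s) * bump s) has_real_derivative
     poly ([:0, 0, 1:] * (p - pderiv p)) (1 / s) * bump s) (at s)"
proof -
  consider "s < 0" | "s = 0" | "s > 0" by linarith
  then show ?thesis
  proof cases
    case 1
    have "((\<lambda>s. 0) has_real_derivative poly ([:0, 0, 1:] * (p - pderiv p)) (1 / s) * bump s) (at s)"
      using 1 by (simp add: bump_def)
    then show ?thesis
      by (rule DERIV_cong_ev[OF refl _ refl, THEN iffD1, rotated])
        (use 1 in \<open>auto simp: bump_def intro!: eventually_mono[OF order_tendstoD(2)[OF tendsto_ident_at, of s 0 UNIV]] eventually_nhds_in_open simp: eventually_nhds intro!: exI[of _ "{..<0}"]\<close>)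
  next
    case 2
    \<comment> \<open>As \<open>bump 0 = 0\<close>, the function and the claimed derivative both
      vanish at the origin, whatever \<open>1 / 0\<close> is, and the difference quotient is the
      function divided by \<open>h\<close>. On the right it equals y p(y) / exp y with y =
      1/h.\<close>
    have lim: "((\<lambda>h. poly p (1 / h) * bump h / h) \<longlongrightarrow> 0) (at 0)"
    proof (rule filterlim_split_at)
      have "eventually (\<lambda>h. 0 = poly p (1 / h) * bump h / h) (at_left (0::real))"
        by (auto simp: bump_def eventually_at_left_field intro!: exI[of _ "-1"])
      then show "((\<lambda>h. poly p (1 / h) * bump h / h) \<longlongrightarrow> 0) (at_left 0)"
        by (rule Lim_transform_eventually[OF tendsto_const])
    next
      have "((\<lambda>h. inverse h ^ 1 * poly p (inverse h) / exp (inverse h)) \<longlongrightarrow> 0) (at_right 0)"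
        by (rule filterlim_compose[OF poly_exp_tendsto_0 filterlim_inverse_at_top_right])
      moreover have "eventually (\<lambda>h. inverse h ^ 1 * poly p (inverse h) / exp (inverse h)
          = poly p (1 / h) * bump h / h) (at_right (0::real))"
        by (auto simp: bump_def eventually_at_right_field exp_minus inverse_eq_divide intro!: exI[of _ "1"])
      ultimately show "((\<lambda>h. poly p (1 / h) * bump h / h) \<longlongrightarrow> 0) (at_right 0)"
        by (rule Lim_transform_eventually)
    qed
    show ?thesis
      using lim 2 by (simp add: DERIV_def bump_def[of 0])
  next
    case 3
    have "((\<lambda>s. poly p (1 / s) * exp (- 1 / s)) has_real_derivative
       poly (pderiv p) (1 / s) * (- 1 / s\<^sup>2) * exp (- 1 / s) + poly p (1 / s) * (exp (- 1 / s) * (1 / s\<^sup>2))) (at s)"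
      using 3 by (auto intro!: derivative_eq_intros DERIV_chain2[OF poly_DERIV] simp: power2_eq_square)
    then have "((\<lambda>s. poly p (1 / s) * exp (- 1 / s)) has_real_derivative
       poly ([:0, 0, 1:] * (p - pderiv p)) (1 / s) * bump s) (at s)"
      using 3 by (simp add: bump_def algebra_simps power2_eq_square)
    then show ?thesis
      by (rule DERIV_cong_ev[OF refl _ refl, THEN iffD1, rotated])
        (use 3 in \<open>auto simp: bump_def eventually_nhds intro!: exI[of _ "{0<..}"]\<close>)
  qed
qed

lemma smooth1_bump: "smooth1 bump"
proof -
  define P where "P m = ((\<lambda>p. [:0, 0, 1:] * (p - pderiv p)) ^^ m) (1 :: real poly)" for m
  show ?thesis
    unfolding smooth1_def
    by (rule exI[of _ "\<lambda>m s. poly (P m) (1 / s) * bump s"])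
      (use has_real_derivative_poly_bump in \<open>auto simp: P_def\<close>)
qed

lemma bump_deriv: "(bump has_real_derivative bump s / s\<^sup>2) (at s)"
  using has_real_derivative_poly_bump[of 1 s] by (simp add: power2_eq_square)

section \<open>Integration on the cube\<close>

lemma cube_eq_box: "(cube :: (real^'n) set) = box 0 1"
  by (auto simp: cube_def mem_box_cart)

lemma cube_borel [measurable]: "(cube :: (real^'n) set) \<in> sets borel"
  by (simp add: cube_eq_box)

lemma cube_lebesgue [measurable]: "(cube :: (real^'n) set) \<in> sets lebesgue"
  using cube_borel by (metis sets_completionI_sets sets_lborel)

lemma cube_subset_cbox: "(cube :: (real^'n) set) \<subseteq> cbox 0 1"
  by (simp add: cube_eq_box box_subset_cbox)

lemma finite_measure_cube: "finite_measure (lebesgue_on (cube :: (real^'n) set))"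
  by (rule finite_measure_lebesgue_on) (simp add: cube_eq_box)

lemma borel_measurable_cubeI:
  "f \<in> borel_measurable borel \<Longrightarrow> f \<in> borel_measurable (lebesgue_on (cube :: (real^'n) set))"
  by (simp add: measurable_completion measurable_restrict_space1)

lemma continuous_measurable_cube:
  fixes f :: "real^'n \<Rightarrow> 'b::euclidean_space"
  shows "continuous_on UNIV f \<Longrightarrow> f \<in> borel_measurable (lebesgue_on cube)"
  by (simp add: borel_measurable_cubeI borel_measurable_continuous_onI)

lemma continuous_bounded_cbox:
  fixes f :: "real^'n \<Rightarrow> 'b::euclidean_space"
  assumes "continuous_on UNIV f"
  obtains B where "0 < B" "\<And>x. x \<in> cbox 0 1 \<Longrightarrow> norm (f x) \<le> B"
proof -
  have "compact (f ` cbox 0 1)"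
    using assms by (intro compact_continuous_image continuous_on_subset[OF assms]) auto
  then obtain B where "0 < B" "\<forall>y\<in>f ` cbox 0 1. norm y \<le> B"
    using bounded_pos compact_imp_bounded by metis
  with that show ?thesis by auto
qed

lemma integrable_cube_bounded:
  fixes f :: "real^'n \<Rightarrow> 'b::euclidean_space"
  assumes "f \<in> borel_measurable (lebesgue_on cube)" "\<And>x. x \<in> cube \<Longrightarrow> norm (f x) \<le> B"
  shows "integrable (lebesgue_on cube) f"
  by (rule finite_measure.integrable_const_bound[OF finite_measure_cube, of _ B])
    (use assms in \<open>auto simp: AE_restrict_space_iff\<close>)

lemma integrable_cube_continuous:
  fixes f :: "real^'n \<Rightarrow> 'b::euclidean_space"
  assumes "continuous_on UNIV f"
  shows "integrable (lebesgue_on cube) f"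
proof -
  obtain B where "\<And>x. x \<in> cbox 0 1 \<Longrightarrow> norm (f x) \<le> B"
    using continuous_bounded_cbox[OF assms] by blast
  with cube_subset_cbox show ?thesis
    by (intro integrable_cube_bounded[OF continuous_measurable_cube[OF assms], of B]) blast
qed

lemma integral_cube_lborel:
  fixes f :: "real^'n \<Rightarrow> real"
  assumes "f \<in> borel_measurable borel"
  shows "(LINT x|lebesgue_on cube. f x) = (LINT x|lborel. indicator cube x * f x)"
proof -
  have "(LINT x|lebesgue_on cube. f x) = (LINT x|lebesgue. indicator cube x *\<^sub>R f x)"
    by (rule integral_restrict_space) simp
  also have "\<dots> = (LINT x|lborel. indicator cube x *\<^sub>R f x)"
    by (rule integral_completion) (use assms in measurable)
  finally show ?thesis by simp
qed

text \<open>The map whose image measure is \<open>face_measure j c\<close>. With \<open>c\<close>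
  varying, it also parametrises the line through \<open>x\<close> in direction
  \<open>j\<close>.\<close>

definition face_proj :: "'n \<Rightarrow> real \<Rightarrow> real^'n \<Rightarrow> real^'n" where
  "face_proj j c x = (\<chi> i. if i = j then c else x $ i)"

lemma face_proj_nth: "face_proj j c x $ i = (if i = j then c else x $ i)"
  by (simp add: face_proj_def)

lemma face_proj_face_proj [simp]: "face_proj j c (face_proj j d x) = face_proj j c x"
  by (simp add: face_proj_def vec_eq_iff)

lemma face_proj_eq: "face_proj j c x = x + (c - x $ j) *\<^sub>R axis j 1"
  by (simp add: face_proj_def vec_eq_iff axis_def)

lemma continuous_face_proj:
  assumes "continuous_on S f" "continuous_on S g"
  shows "continuous_on S (\<lambda>z. face_proj j (f z) (g z))"
  unfolding face_proj_eq by (intro continuous_intros assms)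

lemma face_proj_cbox: "x \<in> cbox 0 1 \<Longrightarrow> c \<in> {0..1} \<Longrightarrow> face_proj j c x \<in> cbox 0 1"
  by (auto simp: mem_box_cart face_proj_nth)

lemma integral_face_measure:
  fixes g :: "real^'n \<Rightarrow> real"
  assumes "continuous_on UNIV g"
  shows "(LINT x|face_measure j c. g x) = (LINT x|lebesgue_on cube. g (face_proj j c x))"
proof -
  have "(\<lambda>x. face_proj j c x) \<in> borel_measurable (lebesgue_on cube)"
    by (intro continuous_measurable_cube continuous_face_proj continuous_intros)
  then show ?thesis
    unfolding face_measure_def face_proj_def[symmetric]
    by (rule integral_distr) (use assms in \<open>simp add: borel_measurable_continuous_onI\<close>)
qed

lemma sum_Basis_nth:
  fixes f :: "real^'n \<Rightarrow> real"
  shows "(\<Sum>b\<in>Basis. f b *\<^sub>R b) $ i = f (axis i 1)"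
proof -
  have "(\<Sum>b\<in>Basis. f b *\<^sub>R b) $ i = (\<Sum>b\<in>Basis. f b *\<^sub>R b) \<bullet> axis i 1"
    by (simp add: inner_axis)
  also have "\<dots> = f (axis i 1)"
    by (rule inner_sum_left_Basis) (simp add: axis_in_Basis_iff)
  finally show ?thesis .
qed

text \<open>Fubini's theorem after splitting off the factor of the basis vector in direction
  \<open>j\<close> from the product measure behind \<open>lborel\<close>. The family
  \<open>x\<close> carries no information at that vector, but \<open>face_proj\<close> overwrites
  this coordinate.\<close>

lemma integral_lborel_slice:
  fixes Q :: "real^'n \<Rightarrow> real"
  assumes "integrable lborel Q"
  shows "integral\<^sup>L lborel Q = (\<integral>x. (\<integral>t. Q (face_proj j t (\<Sum>b\<in>Basis. x b *\<^sub>R b)) \<partial>lborel)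
           \<partial>(\<Pi>\<^sub>M b\<in>Basis - {axis j 1}. lborel))"
proof -
  interpret product_sigma_finite "\<lambda>b :: real^'n. lborel :: real measure" ..
  define e where "e = (axis j 1 :: real^'n)"
  define S where "S f = (\<Sum>b\<in>Basis. f b *\<^sub>R b)" for f :: "real^'n \<Rightarrow> real"
  have e: "insert e (Basis - {e}) = Basis"
    by (auto simp: e_def axis_in_Basis_iff)
  have S: "S \<in> borel_measurable (\<Pi>\<^sub>M b\<in>Basis. lborel)"
    unfolding S_def by measurable
  have Q: "Q \<in> borel_measurable borel"
    using assms by simp
  have lb: "(lborel :: (real^'n) measure) = distr (\<Pi>\<^sub>M b\<in>Basis. lborel) borel S"
    unfolding S_def by (rule lborel_eq)
  have int: "integrable (\<Pi>\<^sub>M b\<in>insert e (Basis - {e}). lborel) (\<lambda>f. Q (S f))"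
    using assms unfolding e by (subst (asm) lb, subst (asm) integrable_distr_eq) (use S Q in simp_all)
  have upd: "S (x(e := t)) = face_proj j t (S x)" for x t
    unfolding S_def vec_eq_iff face_proj_nth sum_Basis_nth by (simp add: e_def axis_eq_axis)
  have "integral\<^sup>L lborel Q = (\<integral>f. Q (S f) \<partial>(\<Pi>\<^sub>M b\<in>insert e (Basis - {e}). lborel))"
    unfolding e by (subst lb, subst integral_distr) (use S Q in simp_all)
  also have "\<dots> = (\<integral>x. (\<integral>t. Q (S (x(e := t))) \<partial>lborel) \<partial>(\<Pi>\<^sub>M b\<in>Basis - {e}. lborel))"
    by (rule product_integral_insert[OF _ _ int]) simp_all
  finally show ?thesis
    unfolding upd by (simp add: e_def S_def)
qed

text \<open>Averaging over segments in direction \<open>j\<close> leaves the integral over the cube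
  unchanged. Keeping the outer integral on the full cube, rather than on a cube of lower dimension,
  matches \<open>face_measure\<close>, which is also an image of the measure of the full
  cube.\<close>

lemma integral_cube_slice:
  fixes h :: "real^'n \<Rightarrow> real"
  assumes h: "continuous_on UNIV h"
  shows "(LINT x|lebesgue_on cube. h x)
    = (LINT x|lebesgue_on cube. (LINT t|lborel. indicator {0..1} t *\<^sub>R h (face_proj j t x)))"
proof -
  define H where "H x = (LINT t|lborel. indicator {0..1} t *\<^sub>R h (face_proj j t x))" for x
  have [measurable]: "h \<in> borel_measurable borel"
    by (rule borel_measurable_continuous_onI[OF h])
  have [measurable]: "(\<lambda>(x, t). face_proj j t x) \<in> borel \<Otimes>\<^sub>M borel \<rightarrow>\<^sub>M borel"
    unfolding borel_prod case_prod_beta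
    by (intro borel_measurable_continuous_onI continuous_face_proj continuous_intros)
  have [measurable]: "H \<in> borel_measurable borel"
    unfolding H_def by measurable
  obtain B where B: "0 < B" "\<And>x. x \<in> cbox 0 1 \<Longrightarrow> norm (h x) \<le> B"
    using continuous_bounded_cbox[OF h] by blast
  have HB: "norm (H x) \<le> B" if x: "x \<in> cube" for x
  proof -
    have x: "x \<in> cbox 0 1" using x cube_subset_cbox by blast
    have "norm (H x) \<le> (LINT t|lborel. norm (indicator {0..1} t *\<^sub>R h (face_proj j t x)))"
      unfolding H_def by (rule integral_norm_bound)
    also have "\<dots> \<le> (LINT t|lborel. indicator {0..1::real} t * B)"
    proof (rule integral_mono')
      show "integrable lborel (\<lambda>t. indicator {0..1::real} t * B)"
        by (intro integrable_mult_left integrable_real_indicator) auto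
      fix t :: real
      show "norm (indicator {0..1} t *\<^sub>R h (face_proj j t x)) \<le> indicator {0..1} t * B"
        using B(2)[OF face_proj_cbox[OF x, of t j]] by (auto simp: indicator_def)
      show "0 \<le> indicator {0..1} t * B" using B(1) by simp
    qed
    also have "\<dots> = B" by simp
    finally show ?thesis .
  qed
  have inth: "integrable lborel (\<lambda>x. indicator cube x * h x)"
    using integrable_cube_continuous[OF h]
    by (simp add: integrable_restrict_space integrable_completion)
  have intH: "integrable lborel (\<lambda>x. indicator cube x * H x)"
    using integrable_cube_bounded[of H B, OF borel_measurable_cubeI HB]
    by (simp add: integrable_restrict_space integrable_completion)
  have fib: "(LINT t|lborel. indicator cube (face_proj j t x) * h (face_proj j t x))
      = (LINT t|lborel. indicator cube (face_proj j t x) * H (face_proj j t x))" for x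
  proof -
    \<comment> \<open>On a line in direction \<open>j\<close> the indicator of the cube factors into
      that of the open unit interval and a constant \<open>K\<close>, which records the conditions
      on the other coordinates. \<open>H\<close> is constant on such a line.\<close>
    define K where "K = (indicator {x :: real^'n. \<forall>i. i \<noteq> j \<longrightarrow> 0 < x $ i \<and> x $ i < 1} x :: real)"
    have K: "indicator cube (face_proj j t x) = indicator {0<..<1} t * K" for t
      by (auto simp: K_def indicator_def cube_def face_proj_nth)
    have "(LINT t|lborel. indicator cube (face_proj j t x) * h (face_proj j t x))
       = (LINT t|lborel. K * (indicator {0..1} t *\<^sub>R h (face_proj j t x)))"
    proof (rule integral_cong_AE)
      have "AE t in lborel. t \<noteq> (0::real) \<and> t \<noteq> 1"
        using AE_lborel_singleton[of "0::real"] AE_lborel_singleton[of "1::real"] by eventually_elim auto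
      then show "AE t in lborel. indicator cube (face_proj j t x) * h (face_proj j t x)
          = K * (indicator {0..1} t *\<^sub>R h (face_proj j t x))"
        unfolding K by eventually_elim (auto simp: indicator_def)
    qed measurable
    also have "\<dots> = K * H x"
      by (simp add: H_def)
    also have "\<dots> = (LINT t|lborel. indicator {0<..<1::real} t * (K * H x))"
      by simp
    also have "\<dots> = (LINT t|lborel. indicator cube (face_proj j t x) * H (face_proj j t x))"
      by (intro Bochner_Integration.integral_cong) (simp_all add: K H_def)
    finally show ?thesis .
  qed
  have "(LINT x|lebesgue_on cube. h x) = (LINT x|lborel. indicator cube x * h x)"
    by (rule integral_cube_lborel) simp
  also have "\<dots> = (LINT x|lborel. indicator cube x * H x)"
    unfolding integral_lborel_slice[OF inth, of j] integral_lborel_slice[OF intH, of j] fib ..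
  also have "\<dots> = (LINT x|lebesgue_on cube. H x)"
    by (rule integral_cube_lborel[symmetric]) simp
  finally show ?thesis unfolding H_def .
qed

text \<open>The fundamental theorem of calculus on each segment in direction \<open>j\<close>,
  averaged over the cube.\<close>

lemma cube_Gauss:
  fixes g :: "real^'n \<Rightarrow> real"
  assumes g: "smooth g"
  shows "(LINT x|lebesgue_on cube. partial_deriv j g x)
    = (LINT x|face_measure j 1. g x) - (LINT x|face_measure j 0. g x)"
proof -
  have c: "continuous_on UNIV g" and c': "continuous_on UNIV (partial_deriv j g)"
    using g by (auto intro: smooth_continuous smooth_partial_deriv)
  have "(LINT t|lborel. indicator {0..1} t *\<^sub>R partial_deriv j g (face_proj j t x))
      = g (face_proj j 1 x) - g (face_proj j 0 x)" for x
  proof (rule integral_FTC_atLeastAtMost)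
    show "(0::real) \<le> 1" by simp
    show "continuous_on {0..1} (\<lambda>t. partial_deriv j g (face_proj j t x))"
      by (rule continuous_on_compose2[OF c']) (auto intro!: continuous_face_proj continuous_intros)
    fix t :: real
    have "((\<lambda>t. face_proj j t x) has_derivative (\<lambda>h. h *\<^sub>R axis j 1)) (at t within {0..1})"
      unfolding face_proj_eq by (auto intro!: derivative_eq_intros)
    moreover have "(g has_derivative frechet_derivative g (at (face_proj j t x))) (at (face_proj j t x))"
      using smooth_differentiable[OF g] frechet_derivative_works by blast
    ultimately have D: "((\<lambda>t. g (face_proj j t x)) has_derivative
        (\<lambda>h. frechet_derivative g (at (face_proj j t x)) (h *\<^sub>R axis j 1))) (at t within {0..1})"
      by (rule has_derivative_compose)
    have "linear (frechet_derivative g (at (face_proj j t x)))"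
      using smooth_differentiable[OF g] linear_frechet_derivative by blast
    from linear_scale[OF this] D
    show "((\<lambda>t. g (face_proj j t x)) has_vector_derivative partial_deriv j g (face_proj j t x))
        (at t within {0..1})"
      by (simp add: has_vector_derivative_def partial_deriv_def)
  qed
  then have "(LINT x|lebesgue_on cube. partial_deriv j g x)
      = (LINT x|lebesgue_on cube. g (face_proj j 1 x) - g (face_proj j 0 x))"
    using integral_cube_slice[OF c', of j] by simp
  also have "\<dots> = (LINT x|lebesgue_on cube. g (face_proj j 1 x)) - (LINT x|lebesgue_on cube. g (face_proj j 0 x))"
    by (intro Bochner_Integration.integral_diff integrable_cube_continuous
        continuous_on_compose2[OF c] continuous_face_proj continuous_intros) auto
  finally show ?thesis
    by (simp add: integral_face_measure[OF c])
qed

section \<open>Square integrable functions on the cube\<close>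

lemma L2D:
  assumes "v \<in> L2 M"
  shows "v \<in> borel_measurable M" "integrable M (\<lambda>x. (norm (v x))\<^sup>2)"
  using assms by (auto simp: L2_def)

lemma L2_inner_integrable:
  fixes v w :: "'a \<Rightarrow> 'b::euclidean_space"
  assumes "v \<in> L2 M" "w \<in> L2 M"
  shows "integrable M (\<lambda>x. v x \<bullet> w x)"
proof (rule Bochner_Integration.integrable_bound)
  show "integrable M (\<lambda>x. (norm (v x))\<^sup>2 + (norm (w x))\<^sup>2)"
    using assms by (auto dest: L2D)
  have [measurable]: "v \<in> borel_measurable M" "w \<in> borel_measurable M"
    using assms by (auto dest: L2D)
  show "(\<lambda>x. v x \<bullet> w x) \<in> borel_measurable M" by measurable
  have "\<bar>v x \<bullet> w x\<bar> \<le> (norm (v x))\<^sup>2 + (norm (w x))\<^sup>2" for x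
  proof -
    have "\<bar>v x \<bullet> w x\<bar> \<le> norm (v x) * norm (w x)" by (rule Cauchy_Schwarz_ineq2)
    also have "\<dots> \<le> (norm (v x))\<^sup>2 + (norm (w x))\<^sup>2"
      using sum_squares_bound[of "norm (v x)" "norm (w x)"] zero_le_power2[of "norm (v x)"]
        zero_le_power2[of "norm (w x)"] mult_nonneg_nonneg[of "norm (v x)" "norm (w x)"] norm_ge_zero
      by linarith
    finally show ?thesis .
  qed
  then show "AE x in M. norm (v x \<bullet> w x) \<le> norm ((norm (v x))\<^sup>2 + (norm (w x))\<^sup>2)"
    by simp
qed

lemma L2_bound:
  assumes "v \<in> L2 M" "w \<in> borel_measurable M" "AE x in M. norm (w x) \<le> C * norm (v x)"
  shows "w \<in> L2 M"
proof -
  have "integrable M (\<lambda>x. (norm (w x))\<^sup>2)"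
  proof (rule Bochner_Integration.integrable_bound)
    show "integrable M (\<lambda>x. C\<^sup>2 * (norm (v x))\<^sup>2)"
      using assms(1) by (auto dest: L2D)
    show "(\<lambda>x. (norm (w x))\<^sup>2) \<in> borel_measurable M" using assms(2) by measurable
    show "AE x in M. norm ((norm (w x))\<^sup>2) \<le> norm (C\<^sup>2 * (norm (v x))\<^sup>2)"
      using assms(3)
    proof eventually_elim
      case (elim x)
      then have "(norm (w x))\<^sup>2 \<le> (C * norm (v x))\<^sup>2" by (intro power_mono) auto
      then show ?case by (simp add: power_mult_distrib)
    qed
  qed
  with assms(2) show ?thesis by (simp add: L2_def)
qed

lemma L2_add:
  assumes "v \<in> L2 M" "w \<in> L2 M"
  shows "(\<lambda>x. v x + w x) \<in> L2 M"
proof -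
  have "integrable M (\<lambda>x. (norm (v x))\<^sup>2 + 2 * (v x \<bullet> w x) + (norm (w x))\<^sup>2)"
    by (intro Bochner_Integration.integrable_add integrable_mult_right L2D(2) assms L2_inner_integrable)
  moreover have "(norm (v x))\<^sup>2 + 2 * (v x \<bullet> w x) + (norm (w x))\<^sup>2 = (norm (v x + w x))\<^sup>2" for x
    by (simp add: power2_norm_eq_inner inner_add inner_commute)
  ultimately show ?thesis
    using assms by (auto simp: L2_def)
qed

lemma L2_scale: "v \<in> L2 M \<Longrightarrow> (\<lambda>x. c *\<^sub>R v x) \<in> L2 M"
  by (rule L2_bound[where C = "\<bar>c\<bar>"]) (auto dest: L2D)

lemma L2_cmult: "v \<in> L2 M \<Longrightarrow> (\<lambda>x. c * v x :: real) \<in> L2 M"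
  using L2_scale[of v M c] by simp

lemma L2_minus: "v \<in> L2 M \<Longrightarrow> (\<lambda>x. - v x) \<in> L2 M"
  using L2_scale[of v M "-1"] by simp

lemma L2_diff: "v \<in> L2 M \<Longrightarrow> w \<in> L2 M \<Longrightarrow> (\<lambda>x. v x - w x) \<in> L2 M"
  using L2_add[OF _ L2_minus, of v M w] by simp

lemma L2_zero [simp]: "(\<lambda>x. 0) \<in> L2 M"
  by (simp add: L2_def)

lemma L2_sum: "(\<And>a. a \<in> S \<Longrightarrow> f a \<in> L2 M) \<Longrightarrow> (\<lambda>x. \<Sum>a\<in>S. f a x) \<in> L2 M"
  by (induction S rule: infinite_finite_induct) (auto intro: L2_add)

lemma L2_continuous:
  fixes f :: "real^'n \<Rightarrow> 'b::euclidean_space"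
  assumes "continuous_on UNIV f"
  shows "f \<in> L2_cube"
proof -
  have "continuous_on UNIV (\<lambda>x. (norm (f x))\<^sup>2)"
    by (intro continuous_intros assms)
  from integrable_cube_continuous[OF this] show ?thesis
    by (simp add: L2_def continuous_measurable_cube[OF assms])
qed

lemma L2_cong_AE:
  assumes "v \<in> L2 M" "w \<in> borel_measurable M" "AE x in M. w x = v x"
  shows "w \<in> L2 M"
  by (rule L2_bound[OF assms(1,2), of 1]) (use assms(3) in auto)

definition L2_norm :: "(real^'n \<Rightarrow> 'b::euclidean_space) \<Rightarrow> real" where
  "L2_norm v = sqrt (L2_inner v v)"

lemma L2_inner_nonneg [simp]: "0 \<le> L2_inner v v"
  by (simp add: L2_inner_def)

lemma L2_norm_nonneg [simp]: "0 \<le> L2_norm v"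
  by (simp add: L2_norm_def)

lemma L2_norm_power2: "(L2_norm v)\<^sup>2 = L2_inner v v"
  by (simp add: L2_norm_def)

lemma L2_inner_commute: "L2_inner v w = L2_inner w v"
  by (simp add: L2_inner_def inner_commute)

lemma L2_inner_cong:
  assumes "AE x in lebesgue_on cube. v x = v' x" "AE x in lebesgue_on cube. w x = w' x"
    and "v \<in> borel_measurable (lebesgue_on cube)" "v' \<in> borel_measurable (lebesgue_on cube)"
    and "w \<in> borel_measurable (lebesgue_on cube)" "w' \<in> borel_measurable (lebesgue_on cube)"
  shows "L2_inner v w = L2_inner v' w'"
  unfolding L2_inner_def
  by (rule integral_cong_AE) (use assms in \<open>auto intro: borel_measurable_inner\<close>)

lemma L2_norm_cong:
  assumes "AE x in lebesgue_on cube. v x = v' x"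
    and "v \<in> borel_measurable (lebesgue_on cube)" "v' \<in> borel_measurable (lebesgue_on cube)"
  shows "L2_norm v = L2_norm v'"
  unfolding L2_norm_def using L2_inner_cong[OF assms(1) assms(1)] assms(2,3) by simp

lemma L2_inner_add_left:
  assumes "u \<in> L2_cube" "v \<in> L2_cube" "w \<in> L2_cube"
  shows "L2_inner (\<lambda>x. u x + v x) w = L2_inner u w + L2_inner v w"
  unfolding L2_inner_def inner_add_left
  by (intro Bochner_Integration.integral_add L2_inner_integrable assms)

lemma L2_inner_scale_left: "L2_inner (\<lambda>x. c *\<^sub>R u x) w = c * L2_inner u w"
  by (simp add: L2_inner_def)

lemma L2_inner_cmult_left: "L2_inner (\<lambda>x. c * u x :: real) w = c * L2_inner u w"
  using L2_inner_scale_left[of c u w] by simp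

lemma L2_inner_minus_left: "L2_inner (\<lambda>x. - u x) w = - L2_inner u w"
  using L2_inner_scale_left[of "-1" u w] by simp

lemma L2_inner_diff_left:
  assumes "u \<in> L2_cube" "v \<in> L2_cube" "w \<in> L2_cube"
  shows "L2_inner (\<lambda>x. u x - v x) w = L2_inner u w - L2_inner v w"
  unfolding L2_inner_def inner_diff_left
  by (intro Bochner_Integration.integral_diff L2_inner_integrable assms)

lemma L2_inner_sum_left:
  assumes "\<And>a. a \<in> S \<Longrightarrow> f a \<in> L2_cube" "w \<in> L2_cube"
  shows "L2_inner (\<lambda>x. \<Sum>a\<in>S. f a x) w = (\<Sum>a\<in>S. L2_inner (f a) w)"
  unfolding L2_inner_def inner_sum_left
  by (intro Bochner_Integration.integral_sum L2_inner_integrable assms)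

lemma L2_inner_add_right:
  assumes "u \<in> L2_cube" "v \<in> L2_cube" "w \<in> L2_cube"
  shows "L2_inner w (\<lambda>x. u x + v x) = L2_inner w u + L2_inner w v"
  using L2_inner_add_left[OF assms] by (simp add: L2_inner_commute)

lemma L2_inner_diff_right:
  assumes "u \<in> L2_cube" "v \<in> L2_cube" "w \<in> L2_cube"
  shows "L2_inner w (\<lambda>x. u x - v x) = L2_inner w u - L2_inner w v"
  using L2_inner_diff_left[OF assms] by (simp add: L2_inner_commute)

lemma L2_inner_scale_right: "L2_inner u (\<lambda>x. c *\<^sub>R w x) = c * L2_inner u w"
  by (simp add: L2_inner_def)

lemma L2_inner_cmult_right: "L2_inner u (\<lambda>x. c * w x :: real) = c * L2_inner u w"
  using L2_inner_scale_right[of u c w] by simp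

lemma L2_inner_minus_right: "L2_inner u (\<lambda>x. - w x) = - L2_inner u w"
  using L2_inner_scale_right[of u "-1" w] by simp

lemma L2_inner_sum_right:
  assumes "\<And>a. a \<in> S \<Longrightarrow> f a \<in> L2_cube" "w \<in> L2_cube"
  shows "L2_inner w (\<lambda>x. \<Sum>a\<in>S. f a x) = (\<Sum>a\<in>S. L2_inner w (f a))"
  using L2_inner_sum_left[OF assms] by (simp add: L2_inner_commute)

lemma L2_norm_scale: "L2_norm (\<lambda>x. c *\<^sub>R u x) = \<bar>c\<bar> * L2_norm u"
  by (simp add: L2_norm_def L2_inner_scale_left L2_inner_scale_right real_sqrt_mult
      flip: mult.assoc power2_eq_square)

lemma L2_norm_minus: "L2_norm (\<lambda>x. - u x) = L2_norm u"
  using L2_norm_scale[of "-1" u] by simp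

lemma L2_norm_diff_commute: "L2_norm (\<lambda>x. u x - v x) = L2_norm (\<lambda>x. v x - u x)"
  using L2_norm_minus[of "\<lambda>x. u x - v x"] by simp

text \<open>Stated for semidefinite data, so \<open>c = 0\<close> is allowed. It yields the
  Cauchy-Schwarz inequality both in \<open>L2\<close> and in an abstract form space, and later the
  Euler equation for a minimising sequence.\<close>

lemma quadratic_discriminant:
  fixes a b c :: real
  assumes nn: "\<And>t. 0 \<le> a + 2 * t * b + t\<^sup>2 * c" and a: "0 \<le> a" and c: "0 \<le> c"
  shows "\<bar>b\<bar> \<le> sqrt a * sqrt c"
proof -
  have "b\<^sup>2 \<le> a * c"
  proof (cases "c = 0")
    case True
    have "b = 0"
    proof (rule ccontr)
      assume "b \<noteq> 0"
      \<comment> \<open>At this \<open>t\<close> the affine function a + 2 t b takes the value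
        -1.\<close>
      then have "2 * (- (a + 1) / (2 * b)) * b = - (a + 1)" by (simp add: field_simps)
      with nn[of "- (a + 1) / (2 * b)"] show False unfolding True by linarith
    qed
    with True show ?thesis by simp
  next
    case False
    with c have "c > 0" by simp
    with nn[of "- b / c"] have "0 \<le> a - b\<^sup>2 / c"
      by (simp add: power2_eq_square)
    with \<open>c > 0\<close> show ?thesis by (simp add: field_simps)
  qed
  then have "sqrt (b\<^sup>2) \<le> sqrt (a * c)" by (rule real_sqrt_le_mono)
  then show ?thesis by (simp add: real_sqrt_mult)
qed

lemma L2_norm_add_power2:
  assumes "u \<in> L2_cube" "v \<in> L2_cube"
  shows "(L2_norm (\<lambda>x. u x + v x))\<^sup>2 = (L2_norm u)\<^sup>2 + 2 * L2_inner u v + (L2_norm v)\<^sup>2"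
  using assms by (simp add: L2_norm_power2 L2_inner_add_left L2_inner_add_right L2_add
      L2_inner_commute[of v u])

lemma L2_Cauchy_Schwarz:
  assumes "u \<in> L2_cube" "v \<in> L2_cube"
  shows "\<bar>L2_inner u v\<bar> \<le> L2_norm u * L2_norm v"
  unfolding L2_norm_def
proof (rule quadratic_discriminant)
  fix t
  have "L2_inner u u + 2 * t * L2_inner u v + t\<^sup>2 * L2_inner v v = (L2_norm (\<lambda>x. u x + t *\<^sub>R v x))\<^sup>2"
    using assms by (subst L2_norm_add_power2)
      (auto simp: L2_scale L2_norm_scale L2_inner_scale_right power_mult_distrib L2_norm_power2)
  then show "0 \<le> L2_inner u u + 2 * t * L2_inner u v + t\<^sup>2 * L2_inner v v" by simp
qed auto

lemma L2_norm_triangle: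
  assumes "u \<in> L2_cube" "v \<in> L2_cube"
  shows "L2_norm (\<lambda>x. u x + v x) \<le> L2_norm u + L2_norm v"
proof (rule power2_le_imp_le)
  show "(L2_norm (\<lambda>x. u x + v x))\<^sup>2 \<le> (L2_norm u + L2_norm v)\<^sup>2"
    using L2_Cauchy_Schwarz[OF assms] by (simp add: L2_norm_add_power2[OF assms] power2_sum)
qed simp

lemma L2_norm_triangle_diff:
  assumes "u \<in> L2_cube" "v \<in> L2_cube" "w \<in> L2_cube"
  shows "L2_norm (\<lambda>x. u x - w x) \<le> L2_norm (\<lambda>x. u x - v x) + L2_norm (\<lambda>x. v x - w x)"
  using L2_norm_triangle[OF L2_diff[OF assms(1,2)] L2_diff[OF assms(2,3)]] by simp

lemma L2_norm_le_diff:
  assumes "u \<in> L2_cube" "v \<in> L2_cube"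
  shows "\<bar>L2_norm u - L2_norm v\<bar> \<le> L2_norm (\<lambda>x. u x - v x)"
  using L2_norm_triangle[OF L2_diff[OF assms] assms(2)]
    L2_norm_triangle[OF L2_diff[OF assms(2,1)] assms(1)] L2_norm_diff_commute[of u v]
  by simp

lemma L2_norm_eq_0_imp:
  assumes "u \<in> L2_cube" "L2_norm u = 0"
  shows "AE x in lebesgue_on cube. u x = 0"
proof -
  have "(LINT x|lebesgue_on cube. (norm (u x))\<^sup>2) = 0"
    using assms(2) by (simp add: L2_norm_def L2_inner_def power2_norm_eq_inner)
  then have "AE x in lebesgue_on cube. (norm (u x))\<^sup>2 = 0"
    using integral_nonneg_eq_0_iff_AE[OF L2D(2)[OF assms(1)]] by simp
  then show ?thesis by simp
qed

section \<open>Convergence and completeness in L2\<close>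

definition L2_tendsto :: "(nat \<Rightarrow> real^'n \<Rightarrow> 'b::euclidean_space) \<Rightarrow> (real^'n \<Rightarrow> 'b) \<Rightarrow> bool" where
  "L2_tendsto s v \<longleftrightarrow> (\<lambda>m. L2_norm (\<lambda>x. s m x - v x)) \<longlonglongrightarrow> 0"

lemma L2_tendsto_inner:
  assumes "L2_tendsto s v" "\<And>m. s m \<in> L2_cube" "v \<in> L2_cube" "w \<in> L2_cube"
  shows "(\<lambda>m. L2_inner (s m) w) \<longlonglongrightarrow> L2_inner v w"
proof (rule Lim_null[THEN iffD2], rule Lim_null_comparison)
  show "\<forall>\<^sub>F m in sequentially. norm (L2_inner (s m) w - L2_inner v w) \<le> L2_norm (\<lambda>x. s m x - v x) * L2_norm w"
    using assms(2-) L2_Cauchy_Schwarz[OF L2_diff[OF assms(2,3)] assms(4)]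
    by (simp add: L2_inner_diff_left)
  show "(\<lambda>m. L2_norm (\<lambda>x. s m x - v x) * L2_norm w) \<longlonglongrightarrow> 0"
    using assms(1) by (intro tendsto_mult_left_zero) (simp add: L2_tendsto_def)
qed

lemma L2_tendsto_norm:
  assumes "L2_tendsto s v" "\<And>m. s m \<in> L2_cube" "v \<in> L2_cube"
  shows "(\<lambda>m. L2_norm (s m)) \<longlonglongrightarrow> L2_norm v"
proof (rule Lim_null[THEN iffD2], rule Lim_null_comparison)
  show "\<forall>\<^sub>F m in sequentially. norm (L2_norm (s m) - L2_norm v) \<le> L2_norm (\<lambda>x. s m x - v x)"
    using L2_norm_le_diff[OF assms(2,3)] by simp
  show "(\<lambda>m. L2_norm (\<lambda>x. s m x - v x)) \<longlonglongrightarrow> 0"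
    using assms(1) by (simp add: L2_tendsto_def)
qed

lemma L2_tendsto_unique:
  assumes "L2_tendsto s v" "L2_tendsto s w" "\<And>m. s m \<in> L2_cube" "v \<in> L2_cube" "w \<in> L2_cube"
  shows "AE x in lebesgue_on cube. v x = w x"
proof -
  have "(\<lambda>m. L2_norm (\<lambda>x. s m x - v x) + L2_norm (\<lambda>x. s m x - w x)) \<longlonglongrightarrow> 0 + 0"
    using assms(1,2) unfolding L2_tendsto_def by (rule tendsto_add)
  moreover have "L2_norm (\<lambda>x. v x - w x) \<le> L2_norm (\<lambda>x. s m x - v x) + L2_norm (\<lambda>x. s m x - w x)" for m
    using L2_norm_triangle_diff[OF assms(4,3,5)] by (simp add: L2_norm_diff_commute[of v])
  ultimately have "L2_norm (\<lambda>x. v x - w x) \<le> 0 + 0"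
    by (intro LIMSEQ_le_const) auto
  then have "L2_norm (\<lambda>x. v x - w x) = 0"
    using L2_norm_nonneg[of "\<lambda>x. v x - w x"] by linarith
  from L2_norm_eq_0_imp[OF L2_diff[OF assms(4,5)] this] show ?thesis by simp
qed

lemma L2_tendsto_add:
  assumes "L2_tendsto s v" "L2_tendsto r w" "\<And>m. s m \<in> L2_cube" "v \<in> L2_cube"
    "\<And>m. r m \<in> L2_cube" "w \<in> L2_cube"
  shows "L2_tendsto (\<lambda>m x. s m x + r m x) (\<lambda>x. v x + w x)"
  unfolding L2_tendsto_def
proof (rule Lim_null_comparison)
  show "(\<lambda>m. L2_norm (\<lambda>x. s m x - v x) + L2_norm (\<lambda>x. r m x - w x)) \<longlonglongrightarrow> 0"
    using tendsto_add[of _ 0 _ _ 0] assms(1,2) unfolding L2_tendsto_def by fastforce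
  show "\<forall>\<^sub>F m in sequentially. norm (L2_norm (\<lambda>x. s m x + r m x - (v x + w x)))
      \<le> L2_norm (\<lambda>x. s m x - v x) + L2_norm (\<lambda>x. r m x - w x)"
    using L2_norm_triangle[OF L2_diff[OF assms(3,4)] L2_diff[OF assms(5,6)]]
    by (simp add: add_diff_add)
qed

lemma L2_tendsto_scale:
  assumes "L2_tendsto s v"
  shows "L2_tendsto (\<lambda>m x. c *\<^sub>R s m x) (\<lambda>x. c *\<^sub>R v x)"
proof -
  have "(\<lambda>m. \<bar>c\<bar> * L2_norm (\<lambda>x. s m x - v x)) \<longlonglongrightarrow> \<bar>c\<bar> * 0"
    using assms unfolding L2_tendsto_def by (intro tendsto_intros)
  then show ?thesis
    by (simp add: L2_tendsto_def L2_norm_scale flip: scaleR_diff_right)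
qed

lemma L1_le_L2:
  assumes "v \<in> (L2_cube :: (real^'n \<Rightarrow> real) set)"
  shows "integrable (lebesgue_on cube) v"
    "(LINT x|lebesgue_on cube. \<bar>v x\<bar>) \<le> L2_norm (\<lambda>x :: real^'n. 1 :: real) * L2_norm v"
proof -
  have 1: "(\<lambda>x. 1) \<in> (L2_cube :: (real^'n \<Rightarrow> real) set)"
    by (intro L2_continuous continuous_intros)
  from L2_inner_integrable[OF assms 1] show "integrable (lebesgue_on cube) v" by simp
  have a: "(\<lambda>x. \<bar>v x\<bar>) \<in> L2_cube"
    by (rule L2_bound[OF assms, of _ 1]) (use assms in \<open>auto dest: L2D\<close>)
  have "L2_norm (\<lambda>x. \<bar>v x\<bar>) = L2_norm v"
    by (simp add: L2_norm_def L2_inner_def)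
  with L2_Cauchy_Schwarz[OF 1 a]
  show "(LINT x|lebesgue_on cube. \<bar>v x\<bar>) \<le> L2_norm (\<lambda>x :: real^'n. 1 :: real) * L2_norm v"
    by (simp add: L2_inner_def)
qed

lemma nn_integral_L2_norm:
  fixes v :: "real^'n \<Rightarrow> real"
  assumes "v \<in> L2_cube"
  shows "(\<integral>\<^sup>+x. ennreal ((v x)\<^sup>2) \<partial>lebesgue_on cube) = ennreal ((L2_norm v)\<^sup>2)"
  using nn_integral_eq_integral[of "lebesgue_on cube" "\<lambda>x. (v x)\<^sup>2"] L2D(2)[OF assms]
  by (simp only: L2_norm_power2 L2_inner_def) (simp add: power2_eq_square)

text \<open>The Riesz-Fischer argument: along a rapidly Cauchy subsequence the increments are
  summable in L1, hence almost everywhere, which defines a pointwise limit. Fatou's lemma then gives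
  convergence in norm for the whole sequence.\<close>

lemma L2_complete:
  fixes s :: "nat \<Rightarrow> real^'n \<Rightarrow> real"
  assumes s: "\<And>m. s m \<in> L2_cube"
    and cauchy: "\<And>e. e > 0 \<Longrightarrow> \<exists>N. \<forall>m\<ge>N. \<forall>n\<ge>N. L2_norm (\<lambda>x. s m x - s n x) < e"
  obtains v where "v \<in> L2_cube" "L2_tendsto s v"
proof -
  let ?M = "lebesgue_on (cube :: (real^'n) set)"
  have "\<exists>N. \<forall>m\<ge>N. \<forall>n\<ge>N. L2_norm (\<lambda>x. s m x - s n x) < (1/2) ^ k" for k :: nat
    using cauchy[of "(1/2) ^ k"] by simp
  then obtain N where N: "\<And>k m n. m \<ge> N k \<Longrightarrow> n \<ge> N k \<Longrightarrow> L2_norm (\<lambda>x. s m x - s n x) < (1/2) ^ k"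
    by metis
  \<comment> \<open>Summing the thresholds makes \<open>r k\<close> dominate \<open>N i\<close> for
    every \<open>i\<close> up to \<open>k\<close>, although \<open>N\<close> itself need not be
    monotone.\<close>
  define r where "r k = (\<Sum>i\<le>k. N i)" for k
  have rN: "N k \<le> r k" for k
    unfolding r_def by (rule member_le_sum) auto
  have rS: "N k \<le> r (Suc k)" for k
    using rN[of k] by (simp add: r_def)
  have rmono: "N k \<le> r j" if "k \<le> j" for k j
    unfolding r_def by (rule member_le_sum) (use that in auto)
  define d where "d k x = s (r (Suc k)) x - s (r k) x" for k x
  have dL2: "d k \<in> L2_cube" for k
    unfolding d_def by (intro L2_diff s)
  have [measurable]: "s k \<in> borel_measurable ?M" "d k \<in> borel_measurable ?M" for k
    using s dL2 by (auto dest: L2D)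
  have dn: "L2_norm (d k) \<le> (1/2) ^ k" for k
    unfolding d_def using N[OF rS rN] by (rule less_imp_le)
  define C where "C = L2_norm (\<lambda>x :: real^'n. 1 :: real)"
  have "(\<integral>\<^sup>+x. ennreal \<bar>d k x\<bar> \<partial>?M) \<le> ennreal (C * (1/2) ^ k)" for k
  proof -
    have "(\<integral>\<^sup>+x. ennreal \<bar>d k x\<bar> \<partial>?M) = ennreal (LINT x|?M. \<bar>d k x\<bar>)"
      by (rule nn_integral_eq_integral) (use L1_le_L2(1)[OF dL2] in auto)
    also have "\<dots> \<le> ennreal (C * (1/2) ^ k)"
    proof (rule ennreal_leI)
      have "(LINT x|?M. \<bar>d k x\<bar>) \<le> C * L2_norm (d k)"
        unfolding C_def by (rule L1_le_L2(2)[OF dL2])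
      also have "\<dots> \<le> C * (1/2) ^ k"
        by (rule mult_left_mono[OF dn]) (simp add: C_def)
      finally show "(LINT x|?M. \<bar>d k x\<bar>) \<le> C * (1/2) ^ k" .
    qed
    finally show ?thesis .
  qed
  then have "(\<integral>\<^sup>+x. (\<Sum>k. ennreal \<bar>d k x\<bar>) \<partial>?M) \<le> (\<Sum>k. ennreal (C * (1/2) ^ k))"
    by (subst nn_integral_suminf) (auto intro!: suminf_le)
  also have "\<dots> = ennreal (\<Sum>k. C * (1/2) ^ k)"
    by (intro suminf_ennreal2) (auto simp: C_def intro!: summable_mult summable_geometric)
  finally have "(\<integral>\<^sup>+x. (\<Sum>k. ennreal \<bar>d k x\<bar>) \<partial>?M) \<noteq> \<infinity>"
    by (metis ennreal_neq_top infinity_ennreal_def neq_top_trans)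
  then have "AE x in ?M. (\<Sum>k. ennreal \<bar>d k x\<bar>) \<noteq> \<infinity>"
    by (intro nn_integral_PInf_AE) auto
  then have conv: "AE x in ?M. convergent (\<lambda>k. s (r k) x)"
  proof eventually_elim
    case (elim x)
    then have "summable (\<lambda>k. \<bar>d k x\<bar>)"
      by (intro summable_suminf_not_top) auto
    then have "summable (\<lambda>k. d k x)"
      by (rule summable_rabs_cancel)
    then have "convergent (\<lambda>n. \<Sum>k<n. d k x)"
      by (simp add: summable_iff_convergent)
    moreover have "(\<Sum>k<n. d k x) = s (r n) x - s (r 0) x" for n
      unfolding d_def by (rule sum_lessThan_telescope)
    ultimately have "convergent (\<lambda>n. s (r n) x - s (r 0) x)" by simp
    from convergent_add[OF this convergent_const[of "s (r 0) x"]] show ?case by simp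
  qed
  define v where "v x = lim (\<lambda>k. s (r k) x)" for x
  have [measurable]: "v \<in> borel_measurable ?M"
    unfolding v_def by measurable
  \<comment> \<open>Fatou's lemma for \<open>k\<close> tending to infinity, with \<open>m\<close>
    fixed.\<close>
  have key: "(\<integral>\<^sup>+x. ennreal ((s m x - v x)\<^sup>2) \<partial>?M) \<le> ennreal (((1/2) ^ j)\<^sup>2)" if m: "m \<ge> N j" for m j
  proof -
    have "(\<integral>\<^sup>+x. ennreal ((s m x - v x)\<^sup>2) \<partial>?M)
        = (\<integral>\<^sup>+x. liminf (\<lambda>k. ennreal ((s m x - s (r k) x)\<^sup>2)) \<partial>?M)"
    proof (rule nn_integral_cong_AE)
      show "AE x in ?M. ennreal ((s m x - v x)\<^sup>2) = liminf (\<lambda>k. ennreal ((s m x - s (r k) x)\<^sup>2))"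
        using conv
      proof eventually_elim
        case (elim x)
        then have "(\<lambda>k. s (r k) x) \<longlonglongrightarrow> v x"
          by (simp add: v_def convergent_LIMSEQ_iff)
        then have "(\<lambda>k. ennreal ((s m x - s (r k) x)\<^sup>2)) \<longlonglongrightarrow> ennreal ((s m x - v x)\<^sup>2)"
          by (intro tendsto_intros)
        from lim_imp_Liminf[OF _ this] show ?case by simp
      qed
    qed
    also have "\<dots> \<le> liminf (\<lambda>k. \<integral>\<^sup>+x. ennreal ((s m x - s (r k) x)\<^sup>2) \<partial>?M)"
      by (rule nn_integral_liminf) measurable
    also have "\<dots> \<le> ennreal (((1/2) ^ j)\<^sup>2)"
    proof (rule Liminf_le)
      show "\<forall>\<^sub>F k in sequentially. (\<integral>\<^sup>+x. ennreal ((s m x - s (r k) x)\<^sup>2) \<partial>?M) \<le> ennreal (((1/2) ^ j)\<^sup>2)"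
        unfolding eventually_sequentially
      proof (intro exI[of _ j] allI impI)
        fix k assume "j \<le> k"
        from N[OF m rmono[OF this]] show "(\<integral>\<^sup>+x. ennreal ((s m x - s (r k) x)\<^sup>2) \<partial>?M) \<le> ennreal (((1/2) ^ j)\<^sup>2)"
          unfolding nn_integral_L2_norm[OF L2_diff[OF s s]]
          by (intro ennreal_leI power_mono) auto
      qed
    qed simp
    finally show ?thesis .
  qed
  \<comment> \<open>The bound from Fatou's lemma also supplies integrability; \<open>v\<close> then
    lies in \<open>L2\<close> as a difference of two members.\<close>
  have diff: "(\<lambda>x. s m x - v x) \<in> L2_cube" if "m \<ge> N j" for m j
    unfolding L2_def using key[OF that]
    by (auto intro!: integrableI_bounded simp: top.not_eq_extremum intro: le_less_trans)
  have v: "v \<in> L2_cube"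
    using L2_diff[OF s diff[OF order_refl, of 0], of "N 0"] by simp
  have le: "L2_norm (\<lambda>x. s m x - v x) \<le> (1/2) ^ j" if "m \<ge> N j" for m j
  proof (rule power2_le_imp_le)
    show "(L2_norm (\<lambda>x. s m x - v x))\<^sup>2 \<le> ((1/2) ^ j)\<^sup>2"
      using key[OF that] unfolding nn_integral_L2_norm[OF diff[OF that]]
      by (rule ennreal_le_iff[THEN iffD1, rotated]) (rule zero_le_power2)
  qed simp
  have "L2_tendsto s v"
    unfolding L2_tendsto_def
  proof (rule LIMSEQ_I)
    fix e :: real assume "e > 0"
    then obtain j where j: "(1/2) ^ j < e"
      using real_arch_pow_inv[of e "1/2"] by auto
    have "norm (L2_norm (\<lambda>x. s n x - v x) - 0) < e" if "n \<ge> N j" for n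
      using le_less_trans[OF le[OF that] j] by simp
    then show "\<exists>no. \<forall>n\<ge>no. norm (L2_norm (\<lambda>x. s n x - v x) - 0) < e"
      by blast
  qed
  with v that show ?thesis by blast
qed

section \<open>The trigonometric systems\<close>

definition trig_factor :: "bool \<Rightarrow> real \<Rightarrow> real \<Rightarrow> real" where
  "trig_factor c a t = (if c then cos (a * pi * t) else sin (a * pi * t))"

definition trig :: "'n set \<Rightarrow> ('n \<Rightarrow> nat) \<Rightarrow> real^'n \<Rightarrow> real" where
  "trig T k x = (\<Prod>i\<in>UNIV. trig_factor (i \<in> T) (real (k i)) (x $ i))"

definition flip :: "'n \<Rightarrow> 'n set \<Rightarrow> 'n set" where
  "flip j T = (if j \<in> T then T - {j} else insert j T)"

text \<open>The sign produced by differentiating the factor in direction \<open>j\<close>: the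
  derivative of a cosine carries a minus.\<close>

definition tsign :: "'n \<Rightarrow> 'n set \<Rightarrow> real" where
  "tsign j T = (if j \<in> T then -1 else 1)"

lemma flip_flip [simp]: "flip j (flip j T) = T"
  by (auto simp: flip_def)

lemma tsign_flip [simp]: "tsign j (flip j T) = - tsign j T"
  by (auto simp: flip_def tsign_def)

lemma tsign_sq [simp]: "tsign j T * tsign j T = 1"
  by (auto simp: tsign_def)

lemma in_flip [simp]: "i \<in> flip j T \<longleftrightarrow> (if i = j then j \<notin> T else i \<in> T)"
  by (auto simp: flip_def)

lemma smooth1_trig_factor: "smooth1 (trig_factor c a)"
proof -
  have "trig_factor c a = (if c then (\<lambda>t. cos (a * pi * t)) else (\<lambda>t. sin (a * pi * t)))"
    by (auto simp: trig_factor_def)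
  then show ?thesis using smooth1_sin_cos[of "a * pi"] by simp
qed

lemma trig_factor_deriv:
  "(trig_factor c a has_real_derivative (if c then -1 else 1) * (a * pi) * trig_factor (\<not> c) a t) (at t)"
proof -
  have "trig_factor c a = (if c then (\<lambda>t. cos (a * pi * t)) else (\<lambda>t. sin (a * pi * t)))"
    by (auto simp: trig_factor_def)
  then show ?thesis
    by (auto simp: trig_factor_def intro!: derivative_eq_intros)
qed

lemma trig_factor_abs_le: "\<bar>trig_factor c a t\<bar> \<le> 1"
  by (simp add: trig_factor_def)

lemma trig_factor_sin_int [simp]: "trig_factor False (real a) 0 = 0" "trig_factor False (real a) 1 = 0"
  by (simp_all add: trig_factor_def)

text \<open>The product-to-sum formulas. Sine and cosine are treated at once: multiplication by cos
  (pi t) shifts the frequency by one both ways and preserves the type of the factor.\<close>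

lemma cos_mult_trig_factor:
  "cos (pi * t) * trig_factor c (real (Suc a)) t
    = (trig_factor c (real (Suc (Suc a))) t + trig_factor c (real a) t) / 2"
proof -
  have e: "real (Suc (Suc a)) * pi * t = real (Suc a) * pi * t + pi * t"
    "real a * pi * t = real (Suc a) * pi * t - pi * t"
    by (simp_all add: algebra_simps)
  show ?thesis
    unfolding trig_factor_def e
    by (simp add: cos_add cos_diff sin_add sin_diff)
qed

lemma cos_mult_trig_factor_0:
  "cos (pi * t) * trig_factor c (real 0) t = (if c then trig_factor c (real 1) t else 0)"
  by (simp add: trig_factor_def)

lemma smooth_trig_factor: "smooth (\<lambda>x. trig_factor c a (x $ i))"
  by (rule smooth_compose1[OF smooth1_trig_factor smooth_nth])

lemma smooth_trig: "smooth (trig T k)"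
  unfolding trig_def by (intro smooth_prod smooth_trig_factor)

lemma continuous_trig: "continuous_on UNIV (trig T k)"
  by (rule smooth_continuous[OF smooth_trig])

lemma L2_trig: "trig T k \<in> L2_cube"
  by (rule L2_continuous[OF continuous_trig])

lemma trig_remove:
  "trig T k x = trig_factor (j \<in> T) (real (k j)) (x $ j)
    * (\<Prod>i\<in>UNIV - {j}. trig_factor (i \<in> T) (real (k i)) (x $ i))"
  unfolding trig_def by (rule prod.remove) auto

lemma prod_rest_le:
  fixes f :: "'a \<Rightarrow> real"
  assumes "\<And>i. \<bar>f i\<bar> \<le> 1"
  shows "\<bar>\<Prod>i\<in>S. f i\<bar> \<le> 1"
  unfolding abs_prod using assms by (intro prod_le_1) auto

lemma partial_deriv_trig:
  "partial_deriv j (trig T k) x = tsign j T * (real (k j) * pi) * trig (flip j T) k x"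
proof -
  let ?f = "\<lambda>i. trig_factor (i \<in> T) (real (k i))"
  have eq: "partial_deriv j (\<lambda>x. ?f i (x $ i)) x
      = (if i = j then tsign j T * (real (k j) * pi) * trig_factor (j \<notin> T) (real (k j)) (x $ j) else 0)" for i
    unfolding partial_deriv_coord[OF trig_factor_deriv] by (auto simp: tsign_def)
  have "partial_deriv j (trig T k) x
      = (\<Sum>i\<in>UNIV. partial_deriv j (\<lambda>x. ?f i (x $ i)) x * (\<Prod>b\<in>UNIV - {i}. ?f b (x $ b)))"
    unfolding trig_def[abs_def] by (rule partial_deriv_prod) (auto intro: smooth_trig_factor)
  also have "\<dots> = (\<Sum>i\<in>UNIV. if i = j then tsign j T * (real (k j) * pi)
      * trig_factor (j \<notin> T) (real (k j)) (x $ j) * (\<Prod>b\<in>UNIV - {j}. ?f b (x $ b)) else 0)"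
    unfolding eq by (intro sum.cong) auto
  also have "\<dots> = tsign j T * (real (k j) * pi)
      * (trig_factor (j \<notin> T) (real (k j)) (x $ j) * (\<Prod>b\<in>UNIV - {j}. ?f b (x $ b)))"
    by simp
  also have "trig_factor (j \<notin> T) (real (k j)) (x $ j) * (\<Prod>b\<in>UNIV - {j}. ?f b (x $ b)) = trig (flip j T) k x"
    unfolding trig_remove[of _ _ _ j] by (intro arg_cong2[of _ _ _ _ "(*)"] prod.cong) auto
  finally show ?thesis .
qed

lemma cos_mult_trig:
  "cos (pi * x $ i) * trig T k x =
    (case k i of 0 \<Rightarrow> if i \<in> T then trig T (k(i := 1)) x else 0
      | Suc a \<Rightarrow> (trig T (k(i := Suc (Suc a))) x + trig T (k(i := a)) x) / 2)"
proof -
  define R where "R = (\<Prod>b\<in>UNIV - {i}. trig_factor (b \<in> T) (real (k b)) (x $ b))"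
  have R: "(\<Prod>b\<in>UNIV - {i}. trig_factor (b \<in> T) (real ((k(i := a)) b)) (x $ b)) = R" for a
    unfolding R_def by (intro prod.cong) auto
  have t: "trig T (k(i := a)) x = trig_factor (i \<in> T) (real a) (x $ i) * R" for a
    unfolding trig_remove[of T "k(i := a)" x i] R by simp
  have "cos (pi * x $ i) * trig T k x = (cos (pi * x $ i) * trig_factor (i \<in> T) (real (k i)) (x $ i)) * R"
    unfolding R_def trig_remove[of T k x i] by (simp only: mult.assoc)
  also have "\<dots> = (case k i of 0 \<Rightarrow> if i \<in> T then trig T (k(i := 1)) x else 0
      | Suc a \<Rightarrow> (trig T (k(i := Suc (Suc a))) x + trig T (k(i := a)) x) / 2)"
    by (cases "k i") (simp_all only: t cos_mult_trig_factor cos_mult_trig_factor_0, auto simp: algebra_simps)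
  finally show ?thesis .
qed

section \<open>Totality of each product system\<close>

lemma integrable_mult_continuous:
  fixes g h :: "real^'n \<Rightarrow> real"
  assumes g: "integrable (lebesgue_on cube) g" and h: "continuous_on UNIV h"
  shows "integrable (lebesgue_on cube) (\<lambda>x. g x * h x)"
proof -
  obtain B where B: "0 < B" "\<And>x. x \<in> cbox 0 1 \<Longrightarrow> norm (h x) \<le> B"
    using continuous_bounded_cbox[OF h] by blast
  show ?thesis
  proof (rule Bochner_Integration.integrable_bound)
    show "integrable (lebesgue_on cube) (\<lambda>x. B * g x)" using g by simp
    show "(\<lambda>x. g x * h x) \<in> borel_measurable (lebesgue_on cube)"
      using g continuous_measurable_cube[OF h] by simp
    have "norm (g x * h x) \<le> norm (B * g x)" if "x \<in> cube" for x
    proof -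
      have "norm (h x) \<le> B" using that cube_subset_cbox B(2) by blast
      then have "\<bar>h x\<bar> * \<bar>g x\<bar> \<le> B * \<bar>g x\<bar>" by (intro mult_right_mono) auto
      then show ?thesis using B(1) by (simp add: abs_mult mult.commute)
    qed
    then show "AE x in lebesgue_on cube. norm (g x * h x) \<le> norm (B * g x)"
      by (simp add: AE_restrict_space_iff)
  qed
qed

text \<open>The sign of \<open>G\<close> is an almost everywhere limit of continuous functions.
  Truncated to [-1, 1] they keep this limit and stay bounded, so by dominated convergence the
  integral of |G| is a limit of zeros.\<close>

lemma AE_zero_if_orthogonal_continuous:
  fixes G :: "real^'n \<Rightarrow> real"
  assumes G: "integrable (lebesgue_on cube) G"
    and orth: "\<And>h. continuous_on UNIV h \<Longrightarrow> (LINT x|lebesgue_on cube. G x * h x) = 0"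
  shows "AE x in lebesgue_on cube. G x = 0"
proof -
  let ?M = "lebesgue_on (cube :: (real^'n) set)"
  have [measurable]: "G \<in> borel_measurable ?M" using G by simp
  have "(\<lambda>x. sgn (G x)) \<in> borel_measurable ?M" by measurable
  then have "(\<lambda>x. sgn (G x)) measurable_on cube"
    by (simp add: measurable_on_iff_borel_measurable)
  then obtain N g where N: "negligible N" and g: "\<And>n. continuous_on UNIV (g n)"
    and lim: "\<And>x. x \<notin> N \<Longrightarrow> (\<lambda>n. g n x) \<longlonglongrightarrow> (if x \<in> cube then sgn (G x) else 0)"
    unfolding measurable_on_def by metis
  define h where "h n x = max (-1) (min 1 (g n x))" for n x
  have hc: "continuous_on UNIV (h n)" for n
    unfolding h_def by (intro continuous_intros g)
  have "(\<lambda>n. LINT x|?M. G x * h n x) \<longlonglongrightarrow> (LINT x|?M. \<bar>G x\<bar>)"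
  proof (rule integral_dominated_convergence[where w = "\<lambda>x. \<bar>G x\<bar>"])
    have "AE x in lebesgue. x \<notin> N"
      using N by (auto simp: negligible_iff_null_sets intro: AE_not_in)
    then have "AE x in ?M. x \<notin> N"
      by (intro AE_restrict_space_iff[THEN iffD2]) auto
    moreover have "AE x in ?M. x \<in> cube"
      by (simp add: AE_restrict_space_iff)
    ultimately show "AE x in ?M. (\<lambda>n. G x * h n x) \<longlonglongrightarrow> \<bar>G x\<bar>"
    proof eventually_elim
      case (elim x)
      then have "(\<lambda>n. g n x) \<longlonglongrightarrow> sgn (G x)" using lim[of x] by simp
      then have "(\<lambda>n. G x * h n x) \<longlonglongrightarrow> G x * max (-1) (min 1 (sgn (G x)))"
        unfolding h_def by (intro tendsto_intros)
      moreover have "G x * max (-1) (min 1 (sgn (G x))) = \<bar>G x\<bar>"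
        by (auto simp: sgn_if)
      ultimately show ?case by simp
    qed
    show "AE x in ?M. norm (G x * h n x) \<le> \<bar>G x\<bar>" for n
      by (rule AE_I2) (auto simp: h_def abs_mult intro!: mult_left_le)
    show "(\<lambda>x. G x * h n x) \<in> borel_measurable ?M" for n
      using continuous_measurable_cube[OF hc] by simp
  qed (use G in auto)
  then have "(LINT x|?M. \<bar>G x\<bar>) = 0"
    using orth[OF hc] by (simp add: LIMSEQ_const_iff)
  then have "AE x in ?M. \<bar>G x\<bar> = 0"
    using integral_nonneg_eq_0_iff_AE[of ?M "\<lambda>x. \<bar>G x\<bar>"] G by simp
  then show ?thesis by simp
qed

text \<open>The algebra for the Stone-Weierstrass theorem. It separates the points of the closed
  cube because cos (pi t) is injective on [0, 1]. The systems with sine factors could not be used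
  directly: their functions vanish on faces and their spans are not closed under products.\<close>

inductive cos_poly :: "(real^'n \<Rightarrow> real) \<Rightarrow> bool" where
  const: "cos_poly (\<lambda>x. c)"
| coord: "cos_poly (\<lambda>x. cos (pi * x $ i))"
| add: "cos_poly p \<Longrightarrow> cos_poly q \<Longrightarrow> cos_poly (\<lambda>x. p x + q x)"
| mult: "cos_poly p \<Longrightarrow> cos_poly q \<Longrightarrow> cos_poly (\<lambda>x. p x * q x)"

lemma continuous_cos_poly: "cos_poly p \<Longrightarrow> continuous_on UNIV p"
  by (induction rule: cos_poly.induct) (auto intro!: continuous_intros)

text \<open>
  The functions \<open>h\<close> for which \<open>g h\<close> is orthogonal to the system form a module over the
  polynomials in \<open>cos (pi x\<^sub>i)\<close>, since multiplication by \<open>cos (pi x\<^sub>i)\<close> preserves the span of the system.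
\<close>

lemma trig_total:
  fixes g :: "real^'n \<Rightarrow> real"
  assumes g: "integrable (lebesgue_on cube) g"
    and orth: "\<And>k. (LINT x|lebesgue_on cube. g x * trig T k x) = 0"
  shows "AE x in lebesgue_on cube. g x = 0"
proof -
  let ?M = "lebesgue_on (cube :: (real^'n) set)"
  define W where "W h \<longleftrightarrow> continuous_on UNIV h \<and> (\<forall>k. (LINT x|?M. (g x * h x) * trig T k x) = 0)" for h
  have int: "integrable ?M (\<lambda>x. (g x * h x) * trig T k x)" if "continuous_on UNIV h" for h k
    by (intro integrable_mult_continuous g that continuous_trig)
  have W_poly: "W (\<lambda>x. h x * p x)" if "cos_poly p" "W h" for h p
    using that
  proof (induction arbitrary: h rule: cos_poly.induct)
    case (const c)
    have "(LINT x|?M. (g x * (h x * c)) * trig T k x) = c * (LINT x|?M. (g x * h x) * trig T k x)" for k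
      by (simp add: algebra_simps flip: integral_mult_right_zero)
    then show ?case using const by (auto simp: W_def intro!: continuous_intros)
  next
    case (coord i)
    have hc: "continuous_on UNIV h" and h0: "\<And>k. (LINT x|?M. (g x * h x) * trig T k x) = 0"
      using coord by (auto simp: W_def)
    have "(LINT x|?M. (g x * (h x * cos (pi * x $ i))) * trig T k x) = 0" for k
    proof -
      have eq: "(g x * (h x * cos (pi * x $ i))) * trig T k x
          = (g x * h x) * (cos (pi * x $ i) * trig T k x)" for x
        by (simp only: mult_ac)
      show ?thesis
      proof (cases "k i")
        case 0
        then show ?thesis unfolding eq cos_mult_trig using h0 by (cases "i \<in> T") simp_all
      next
        case (Suc a)
        have "(LINT x|?M. (g x * h x) * (cos (pi * x $ i) * trig T k x))
          = (LINT x|?M. ((g x * h x) * trig T (k(i := Suc (Suc a))) x + (g x * h x) * trig T (k(i := a)) x) / 2)"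
          unfolding cos_mult_trig Suc by (simp add: algebra_simps add_divide_distrib)
        also have "\<dots> = 0"
          using h0 int[OF hc] by (simp add: Bochner_Integration.integral_add)
        finally show ?thesis unfolding eq .
      qed
    qed
    then show ?case using hc by (auto simp: W_def intro!: continuous_intros)
  next
    case (add p q)
    have "W (\<lambda>x. h x * p x)" "W (\<lambda>x. h x * q x)"
      using add by blast+
    then have c: "continuous_on UNIV (\<lambda>x. h x * p x)" "continuous_on UNIV (\<lambda>x. h x * q x)"
      and z: "\<And>k. (LINT x|?M. (g x * (h x * p x)) * trig T k x) = 0"
        "\<And>k. (LINT x|?M. (g x * (h x * q x)) * trig T k x) = 0"
      by (auto simp: W_def)
    have "(LINT x|?M. (g x * (h x * (p x + q x))) * trig T k x)
      = (LINT x|?M. (g x * (h x * p x)) * trig T k x + (g x * (h x * q x)) * trig T k x)" for k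
      by (simp add: algebra_simps)
    also have "\<dots> k = 0" for k
      using z int[OF c(1)] int[OF c(2)] by simp
    finally show ?case
      using c continuous_on_add[OF c] by (simp add: W_def algebra_simps)
  next
    case (mult p q)
    have "W (\<lambda>x. (h x * p x) * q x)"
      using mult by blast
    then show ?case by (simp only: mult.assoc)
  qed
  \<comment> \<open>\<open>e\<close> is the lowest nontrivial mode of the system, a product of
    functions sin (pi t) in the sine directions. It has no zero in the open cube, so it suffices to
    show that \<open>g\<close> times \<open>e\<close> vanishes. Orthogonality of g p to
    \<open>e\<close>, for polynomials p in the cosines, says that g e is orthogonal to a dense
    algebra.\<close>
  define k1 where "k1 i = (if i \<in> T then 0 else 1 :: nat)" for i
  define e where "e = trig T k1"
  have ec: "continuous_on UNIV e"
    unfolding e_def by (rule continuous_trig)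
  have W1: "W (\<lambda>x. 1)"
    using orth by (simp add: W_def)
  have ge: "integrable ?M (\<lambda>x. g x * e x)"
    by (intro integrable_mult_continuous g ec)
  have "AE x in ?M. g x * e x = 0"
  proof (rule AE_zero_if_orthogonal_continuous[OF ge])
    fix h :: "real^'n \<Rightarrow> real" assume h: "continuous_on UNIV h"
    define C where "C = (LINT x|?M. \<bar>g x * e x\<bar>)"
    have C: "0 \<le> C" unfolding C_def by simp
    have small: "\<bar>LINT x|?M. g x * e x * h x\<bar> \<le> 0 + \<epsilon>" if "\<epsilon> > 0" for \<epsilon>
    proof -
      define d where "d = \<epsilon> / (C + 1)"
      have d: "d > 0" using that C by (simp add: d_def)
      have "\<exists>q. cos_poly q \<and> (\<forall>x\<in>cbox 0 (1 :: real^'n). \<bar>h x - q x\<bar> < d)"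
      proof (rule Stone_Weierstrass_HOL)
        fix x y :: "real^'n"
        assume "x \<in> cbox 0 1 \<and> y \<in> cbox 0 1 \<and> x \<noteq> y"
        then obtain i where i: "x $ i \<noteq> y $ i" and x: "x \<in> cbox 0 1" and y: "y \<in> cbox 0 1"
          by (auto simp: vec_eq_iff)
        from x y have "0 \<le> x $ i" "x $ i \<le> 1" "0 \<le> y $ i" "y $ i \<le> 1"
          by (auto simp: mem_box_cart)
        then have "cos (pi * x $ i) \<noteq> cos (pi * y $ i)"
          using i cos_inj_pi[of "pi * x $ i" "pi * y $ i"] by (auto simp: mult_le_cancel_left)
        then show "\<exists>f. cos_poly f \<and> f x \<noteq> f y"
          by (intro exI[of _ "\<lambda>x. cos (pi * x $ i)"]) (auto intro: cos_poly.coord)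
      next
        show "continuous_on (cbox 0 1) f" if "cos_poly f" for f :: "real^'n \<Rightarrow> real"
          using continuous_cos_poly[OF that] by (rule continuous_on_subset) simp
        show "continuous_on (cbox 0 1) h"
          using h by (rule continuous_on_subset) simp
        show "cos_poly (\<lambda>x. c)" for c by (rule cos_poly.const)
        show "cos_poly (\<lambda>x. p x + q x)" if "cos_poly p \<and> cos_poly q" for p q :: "real^'n \<Rightarrow> real"
          using that cos_poly.add by blast
        show "cos_poly (\<lambda>x. p x * q x)" if "cos_poly p \<and> cos_poly q" for p q :: "real^'n \<Rightarrow> real"
          using that cos_poly.mult by blast
        show "0 < d" by (rule d)
        show "compact (cbox 0 (1 :: real^'n))" by (rule compact_cbox)
      qed
      then obtain q where q: "cos_poly q" "\<And>x. x \<in> cbox 0 1 \<Longrightarrow> \<bar>h x - q x\<bar> < d"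
        by blast
      have qc: "continuous_on UNIV q" using q(1) by (rule continuous_cos_poly)
      have "W q" using W_poly[OF q(1) W1] by simp
      then have "(LINT x|?M. g x * e x * q x) = 0"
        unfolding W_def e_def by (simp add: mult_ac)
      then have "\<bar>LINT x|?M. g x * e x * h x\<bar> = \<bar>LINT x|?M. g x * e x * h x - g x * e x * q x\<bar>"
        using integrable_mult_continuous[OF ge h] integrable_mult_continuous[OF ge qc] by simp
      also have "\<dots> \<le> (LINT x|?M. \<bar>g x * e x * h x - g x * e x * q x\<bar>)"
        by (rule integral_abs_bound)
      also have "\<dots> \<le> (LINT x|?M. \<bar>g x * e x\<bar> * d)"
      proof (rule integral_mono_AE)
        have "\<bar>g x * e x * h x - g x * e x * q x\<bar> \<le> \<bar>g x * e x\<bar> * d" if "x \<in> cube" for x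
        proof -
          have "\<bar>h x - q x\<bar> \<le> d" using q(2)[of x] that cube_subset_cbox by force
          then have "\<bar>g x * e x\<bar> * \<bar>h x - q x\<bar> \<le> \<bar>g x * e x\<bar> * d" by (rule mult_left_mono) simp
          then show ?thesis by (simp add: right_diff_distrib flip: abs_mult)
        qed
        then show "AE x in ?M. \<bar>g x * e x * h x - g x * e x * q x\<bar> \<le> \<bar>g x * e x\<bar> * d"
          by (simp add: AE_restrict_space_iff)
      qed (use ge integrable_mult_continuous[OF ge h] integrable_mult_continuous[OF ge qc] in auto)
      also have "\<dots> = C * d" by (simp add: C_def)
      also have "\<dots> \<le> 0 + \<epsilon>" using C that by (simp add: d_def field_simps)
      finally show ?thesis .
    qed
    have "\<bar>LINT x|?M. g x * e x * h x\<bar> \<le> 0"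
      by (rule field_le_epsilon) (rule small)
    then show "(LINT x|?M. g x * e x * h x) = 0" by simp
  qed
  moreover have "e x \<noteq> 0" if "x \<in> cube" for x
  proof -
    have "trig_factor (i \<in> T) (real (k1 i)) (x $ i) \<noteq> 0" for i
    proof (cases "i \<in> T")
      case False
      have "0 < x $ i" "x $ i < 1" using that by (auto simp: cube_def)
      then have "0 < sin (pi * x $ i)" by (intro sin_gt_zero) auto
      then show ?thesis using False by (simp add: trig_factor_def k1_def)
    qed (simp add: trig_factor_def k1_def)
    then show ?thesis by (simp add: e_def trig_def)
  qed
  moreover have "AE x in ?M. x \<in> cube"
    by (simp add: AE_restrict_space_iff)
  ultimately show ?thesis
    by (auto elim!: eventually_elim2)
qed

section \<open>Cutoff functions\<close>

text \<open>
  The argument of \<open>bump\<close> equals \<open>M (t - 1/M) (1 - 1/M - t)\<close> for \<open>M = m + 3\<close>, so \<open>chi m\<close> is supported in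
  \<open>[1/M, 1 - 1/M]\<close>.
\<close>

definition chi :: "nat \<Rightarrow> real \<Rightarrow> real" where
  "chi m t = bump ((real m + 3) * (t * (1 - t)) - 1 + 1 / (real m + 3))"

definition chi' :: "nat \<Rightarrow> real \<Rightarrow> real" where
  "chi' m t = (let s = (real m + 3) * (t * (1 - t)) - 1 + 1 / (real m + 3)
    in bump s / s\<^sup>2 * ((real m + 3) * (1 - 2 * t)))"

definition cutoff :: "nat \<Rightarrow> real^'n \<Rightarrow> real" where
  "cutoff m x = (\<Prod>i\<in>UNIV. chi m (x $ i))"

lemma bump_bounds: "0 \<le> bump s" "bump s \<le> 1"
  by (auto simp: bump_def)

lemma chi_bounds: "0 \<le> chi m t" "chi m t \<le> 1"
  by (auto simp: chi_def bump_bounds)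

lemma chi_deriv: "(chi m has_real_derivative chi' m t) (at t)"
proof -
  have "((\<lambda>t. (real m + 3) * (t * (1 - t)) - 1 + 1 / (real m + 3)) has_real_derivative
      (real m + 3) * (1 - 2 * t)) (at t)"
    by (auto intro!: derivative_eq_intros)
  from DERIV_chain2[OF bump_deriv this] show ?thesis
    by (simp add: chi_def[abs_def] chi'_def Let_def)
qed

lemma chi_nonzero_imp:
  assumes "chi m t \<noteq> 0"
  shows "1 / (real m + 3) \<le> t" "t \<le> 1 - 1 / (real m + 3)"
proof -
  define a where "a = 1 / (real m + 3)"
  have a: "0 < a" "a \<le> 1/3" "(real m + 3) * a = 1"
    by (auto simp: a_def field_simps)
  have "(real m + 3) * (t * (1 - t)) - 1 + a > 0"
    using assms by (auto simp: chi_def bump_def a_def split: if_splits)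
  then have "a * ((real m + 3) * (t * (1 - t)) - 1 + a) > 0"
    using a(1) by simp
  then have "t * (1 - t) - a + a * a > 0"
  proof -
    have "a * ((real m + 3) * (t * (1 - t)) - 1 + a) = ((real m + 3) * a) * (t * (1 - t)) - a + a * a"
      by (simp add: algebra_simps)
    then show ?thesis using \<open>a * ((real m + 3) * (t * (1 - t)) - 1 + a) > 0\<close> a(3) by simp
  qed
  then have "(t - a) * ((1 - a) - t) > 0"
    by (simp add: algebra_simps)
  then have "a < t \<and> t < 1 - a"
    using a(2) by (auto simp: zero_less_mult_iff)
  then show "1 / (real m + 3) \<le> t" "t \<le> 1 - 1 / (real m + 3)"
    by (auto simp: a_def)
qed

lemma smooth_cutoff: "smooth (cutoff m :: real^'n \<Rightarrow> real)"
proof -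
  have "smooth (\<lambda>x :: real^'n. chi m (x $ i))" for i
    unfolding chi_def
    by (intro smooth_compose1[OF smooth1_bump] smooth_add smooth_diff smooth_mult smooth_nth smooth_const)
  then show ?thesis unfolding cutoff_def[abs_def] by (intro smooth_prod)
qed

lemma cutoff_mult_test:
  fixes v :: "real^'n \<Rightarrow> real"
  assumes "smooth v"
  shows "(\<lambda>x. v x * cutoff m x) \<in> test_functions"
proof -
  define a where "a = 1 / (real m + 3)"
  have a: "0 < a" by (simp add: a_def)
  define K :: "(real^'n) set" where "K = cbox (\<chi> i. a) (\<chi> i. 1 - a)"
  have sub: "{x. v x * cutoff m x \<noteq> 0} \<subseteq> K"
  proof
    fix x assume "x \<in> {x. v x * cutoff m x \<noteq> 0}"
    then have "chi m (x $ i) \<noteq> 0" for i by (auto simp: cutoff_def)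
    from chi_nonzero_imp[OF this] show "x \<in> K"
      by (auto simp: K_def mem_box_cart a_def)
  qed
  have "compact K" "closed K" by (auto simp: K_def closed_cbox)
  have cl: "closure {x. v x * cutoff m x \<noteq> 0} \<subseteq> K"
    using sub \<open>closed K\<close> by (rule closure_minimal)
  moreover have "K \<subseteq> cube"
  proof
    fix x assume "x \<in> K"
    then have "a \<le> x $ i" "x $ i \<le> 1 - a" for i by (auto simp: K_def mem_box_cart)
    with a have "0 < x $ i" "x $ i < 1" for i by (smt (verit))+
    then show "x \<in> cube" by (simp add: cube_def)
  qed
  moreover have "compact (closure {x. v x * cutoff m x \<noteq> 0})"
    by (rule back_subst[of compact, OF compact_Int_closed[OF \<open>compact K\<close> closed_closure] inf.absorb2[OF cl]])
  ultimately show ?thesis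
    using smooth_mult[OF assms smooth_cutoff] by (auto simp: test_functions_def)
qed

lemma chi_arg_tendsto:
  assumes "0 < t" "t < (1::real)"
  shows "filterlim (\<lambda>m. (real m + 3) * (t * (1 - t)) - 1 + 1 / (real m + 3)) at_top sequentially"
proof (rule filterlim_at_top_mono)
  show "filterlim (\<lambda>m. -1 + (t * (1 - t)) * real m) at_top sequentially"
    by (intro filterlim_tendsto_add_at_top[OF tendsto_const]
        filterlim_tendsto_pos_mult_at_top[OF tendsto_const _ filterlim_real_sequentially])
      (use assms in auto)
  have "-1 + (t * (1 - t)) * real m \<le> (real m + 3) * (t * (1 - t)) - 1 + 1 / (real m + 3)" for m
  proof -
    have "0 \<le> t * (1 - t)" using assms by simp
    moreover have "(real m + 3) * (t * (1 - t)) = (t * (1 - t)) * real m + 3 * (t * (1 - t))"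
      by (simp only: algebra_simps)
    moreover have "0 \<le> 1 / (real m + 3)" by simp
    ultimately show ?thesis by linarith
  qed
  then show "\<forall>\<^sub>F m in sequentially. -1 + (t * (1 - t)) * real m
      \<le> (real m + 3) * (t * (1 - t)) - 1 + 1 / (real m + 3)" by simp
qed

lemma bump_tendsto: "(bump \<longlongrightarrow> 1) at_top"
proof -
  have "((\<lambda>s. exp (- inverse s)) \<longlongrightarrow> exp (- 0)) (at_top :: real filter)"
    by (intro tendsto_intros tendsto_inverse_0_at_top filterlim_ident)
  moreover have "\<forall>\<^sub>F s in at_top. exp (- inverse s) = bump s"
    using eventually_gt_at_top[of 0] by eventually_elim (simp add: bump_def inverse_eq_divide)
  ultimately show ?thesis
    using Lim_transform_eventually by force
qed

lemma chi_tendsto: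
  assumes "0 < t" "t < 1"
  shows "(\<lambda>m. chi m t) \<longlonglongrightarrow> 1"
  unfolding chi_def by (rule filterlim_compose[OF bump_tendsto chi_arg_tendsto[OF assms]])

lemma cutoff_tendsto:
  fixes x :: "real^'n"
  assumes "x \<in> cube"
  shows "(\<lambda>m. cutoff m x) \<longlonglongrightarrow> 1"
proof -
  have "(\<lambda>m. \<Prod>i\<in>UNIV. chi m (x $ i)) \<longlonglongrightarrow> (\<Prod>i\<in>(UNIV :: 'n set). 1)"
    by (intro tendsto_prod chi_tendsto) (use assms in \<open>auto simp: cube_def\<close>)
  then show ?thesis by (simp add: cutoff_def)
qed

lemma cutoff_bounds: "\<bar>cutoff m x\<bar> \<le> 1"
  unfolding cutoff_def by (rule prod_rest_le) (simp add: chi_bounds abs_le_iff order_trans[OF _ chi_bounds(1)])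

lemma partial_deriv_cutoff:
  "partial_deriv j (cutoff m) x = chi' m (x $ j) * (\<Prod>i\<in>UNIV - {j}. chi m (x $ i))"
proof -
  have "smooth (\<lambda>x :: real^'a. chi m (x $ i))" for i
    unfolding chi_def
    by (intro smooth_compose1[OF smooth1_bump] smooth_add smooth_diff smooth_mult smooth_nth smooth_const)
  then have "partial_deriv j (cutoff m) x
      = (\<Sum>i\<in>UNIV. partial_deriv j (\<lambda>x. chi m (x $ i)) x * (\<Prod>b\<in>UNIV - {i}. chi m (x $ b)))"
    unfolding cutoff_def[abs_def] by (intro partial_deriv_prod) auto
  also have "\<dots> = (\<Sum>i\<in>UNIV. if i = j then chi' m (x $ j) * (\<Prod>b\<in>UNIV - {j}. chi m (x $ b)) else 0)"
    unfolding partial_deriv_coord[OF chi_deriv] by (intro sum.cong) auto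
  finally show ?thesis by simp
qed

text \<open>Near each end point |sin y| is at most the distance to the zero there, scaled by the
  frequency; the far end point costs the factor 2. Integrality of the frequency provides the zero at
  1.\<close>

lemma abs_sin_le_parabola:
  assumes "0 < t" "t < 1"
  shows "\<bar>sin (real k * pi * t)\<bar> \<le> 2 * (real k * pi) * (t * (1 - t))"
proof (cases "t \<le> 1/2")
  case True
  have "\<bar>sin (real k * pi * t)\<bar> \<le> \<bar>real k * pi * t\<bar>" by (rule abs_sin_x_le_abs_x)
  also have "\<dots> = (real k * pi * t) * 1" using assms by simp
  also have "\<dots> \<le> (real k * pi * t) * (2 * (1 - t))"
    using True assms by (intro mult_left_mono) auto
  finally show ?thesis by (simp add: mult_ac)
next
  case False
  have "sin (real k * pi * t) = sin (real k * pi - real k * pi * (1 - t))"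
    by (simp add: algebra_simps)
  then have "\<bar>sin (real k * pi * t)\<bar> = \<bar>sin (real k * pi * (1 - t))\<bar>"
    by (simp add: sin_diff abs_mult)
  also have "\<dots> \<le> \<bar>real k * pi * (1 - t)\<bar>" by (rule abs_sin_x_le_abs_x)
  also have "\<dots> = (real k * pi * (1 - t)) * 1" using assms by simp
  also have "\<dots> \<le> (real k * pi * (1 - t)) * (2 * t)"
    using False assms by (intro mult_left_mono) auto
  finally show ?thesis by (simp add: mult_ac)
qed

text \<open>The decay of the sine at the boundary compensates the growth of the derivative of the cutoff.\<close>

lemma sin_mult_chi'_bound:
  assumes t: "0 < t" "t < 1"
    and s: "s = (real m + 3) * (t * (1 - t)) - 1 + 1 / (real m + 3)" "s > 0"
  shows "\<bar>sin (real k * pi * t) * chi' m t\<bar> \<le> 2 * (real k * pi) * ((s + 1) / s\<^sup>2 * bump s)"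
proof -
  have le: "(real m + 3) * (t * (1 - t)) \<le> s + 1"
    by (simp add: s(1))
  have "\<bar>chi' m t\<bar> = bump s / s\<^sup>2 * ((real m + 3) * \<bar>1 - 2 * t\<bar>)"
    unfolding chi'_def s(1)[symmetric] Let_def by (simp add: abs_mult bump_bounds)
  also have "\<dots> \<le> bump s / s\<^sup>2 * ((real m + 3) * 1)"
    using t by (intro mult_left_mono) (auto simp: bump_bounds)
  finally have c: "\<bar>chi' m t\<bar> \<le> bump s / s\<^sup>2 * (real m + 3)" by simp
  have "\<bar>sin (real k * pi * t) * chi' m t\<bar>
      \<le> (2 * (real k * pi) * (t * (1 - t))) * (bump s / s\<^sup>2 * (real m + 3))"
    unfolding abs_mult using abs_sin_le_parabola[OF t] c t by (intro mult_mono) auto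
  also have "\<dots> = 2 * (real k * pi) * (bump s / s\<^sup>2) * ((real m + 3) * (t * (1 - t)))"
    by (simp only: mult_ac)
  also have "\<dots> \<le> 2 * (real k * pi) * (bump s / s\<^sup>2) * (s + 1)"
    using le by (intro mult_left_mono) (auto simp: bump_bounds)
  also have "\<dots> = 2 * (real k * pi) * ((s + 1) / s\<^sup>2 * bump s)"
    by simp
  finally show ?thesis .
qed

text \<open>With y = 1/s the left-hand side is (y + y^2) exp (-y), and the quadratic Taylor bound
  gives 2 exp y >= 2 + 2 y + y^2.\<close>

lemma bump_weight_le:
  assumes "s > 0"
  shows "(s + 1) / s\<^sup>2 * bump s \<le> 2"
proof -
  define y where "y = 1 / s"
  have y: "y > 0" "s = 1 / y" using assms by (auto simp: y_def)
  have "1 + y + y\<^sup>2 / 2 \<le> exp y"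
    using exp_lower_Taylor_quadratic[of y] y by simp
  then have "y + y\<^sup>2 \<le> 2 * exp y" using y by simp
  then have "(y + y\<^sup>2) * exp (- y) \<le> 2 * exp y * exp (- y)" by (intro mult_right_mono) auto
  then have "(y + y\<^sup>2) * exp (- y) \<le> 2 * (exp y * exp (- y))" by (simp only: mult.assoc)
  then have "(y + y\<^sup>2) * exp (- y) \<le> 2" by (simp add: exp_minus_inverse)
  moreover have "(s + 1) / s\<^sup>2 * bump s = (y + y\<^sup>2) * exp (- y)"
  proof -
    have "bump s = exp (- y)" using assms by (simp add: bump_def y_def)
    moreover have "(s + 1) / s\<^sup>2 = y + y\<^sup>2"
      using assms by (simp add: y_def add_divide_distrib power2_eq_square)
    ultimately show ?thesis by simp
  qed
  ultimately show ?thesis by simp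
qed

text \<open>The bound does not depend on \<open>m\<close>; it is the dominating constant when cutoff
  sine products converge in \<open>H1\<close>.\<close>

lemma sin_mult_chi'_le:
  assumes t: "0 < t" "t < 1"
  shows "\<bar>sin (real k * pi * t) * chi' m t\<bar> \<le> 4 * (real k * pi)"
proof -
  define s where "s = (real m + 3) * (t * (1 - t)) - 1 + 1 / (real m + 3)"
  show ?thesis
  proof (cases "s > 0")
    case True
    have "2 * (real k * pi) * ((s + 1) / s\<^sup>2 * bump s) \<le> 2 * (real k * pi) * 2"
      by (rule mult_left_mono[OF bump_weight_le[OF True]]) simp
    with sin_mult_chi'_bound[OF t s_def True, of k] show ?thesis by simp
  next
    case False
    then have "chi' m t = 0" by (simp add: chi'_def s_def[symmetric] bump_def)
    then show ?thesis by simp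
  qed
qed

lemma sin_mult_chi'_tendsto:
  assumes t: "0 < t" "t < 1"
  shows "(\<lambda>m. sin (real k * pi * t) * chi' m t) \<longlonglongrightarrow> 0"
proof (rule Lim_null_comparison)
  define s where "s m = (real m + 3) * (t * (1 - t)) - 1 + 1 / (real m + 3)" for m
  have sl: "filterlim s at_top sequentially"
    unfolding s_def by (rule chi_arg_tendsto[OF t])
  have "((\<lambda>s. (inverse s + inverse s * inverse s) * bump s) \<longlongrightarrow> (0 + 0 * 0) * 1) (at_top :: real filter)"
    by (intro tendsto_intros tendsto_inverse_0_at_top filterlim_ident bump_tendsto)
  from filterlim_compose[OF this sl]
  have "(\<lambda>m. (inverse (s m) + inverse (s m) * inverse (s m)) * bump (s m)) \<longlonglongrightarrow> 0" by simp
  then show "(\<lambda>m. 2 * (real k * pi) * ((inverse (s m) + inverse (s m) * inverse (s m)) * bump (s m))) \<longlonglongrightarrow> 0"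
    by (rule tendsto_mult_right_zero)
  have "\<forall>\<^sub>F m in sequentially. s m > 0"
    using sl by (simp add: filterlim_at_top_dense)
  then show "\<forall>\<^sub>F m in sequentially. norm (sin (real k * pi * t) * chi' m t)
      \<le> 2 * (real k * pi) * ((inverse (s m) + inverse (s m) * inverse (s m)) * bump (s m))"
  proof eventually_elim
    case (elim m)
    have "(s m + 1) / (s m)\<^sup>2 = inverse (s m) + inverse (s m) * inverse (s m)"
      using elim by (simp add: field_simps power2_eq_square)
    with sin_mult_chi'_bound[OF t s_def elim, of k] show ?case by simp
  qed
qed

text \<open>A sine product times a cutoff is a test function. Hence \<open>g\<close> times the
  cutoff is orthogonal to the sine system and vanishes by totality; the cutoffs tend to 1 pointwise
  in the cube.\<close>

lemma AE_zero_if_orthogonal_test: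
  fixes g :: "real^'n \<Rightarrow> real"
  assumes g: "g \<in> L2_cube" and orth: "\<And>\<psi>. \<psi> \<in> test_functions \<Longrightarrow> L2_inner g \<psi> = 0"
  shows "AE x in lebesgue_on cube. g x = 0"
proof -
  have gi: "integrable (lebesgue_on cube) g"
    by (rule L1_le_L2(1)[OF g])
  have "AE x in lebesgue_on cube. g x * cutoff m x = 0" for m
  proof (rule trig_total)
    show "integrable (lebesgue_on cube) (\<lambda>x. g x * cutoff m x)"
      by (rule integrable_mult_continuous[OF gi smooth_continuous[OF smooth_cutoff]])
    fix k
    show "(LINT x|lebesgue_on cube. g x * cutoff m x * trig {} k x) = 0"
      using orth[OF cutoff_mult_test[OF smooth_trig, of "{}" k m]]
      by (simp add: L2_inner_def mult_ac)
  qed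
  then have "AE x in lebesgue_on cube. \<forall>m. g x * cutoff m x = 0"
    by (simp only: AE_all_countable) blast
  moreover have "AE x in lebesgue_on (cube :: (real^'n) set). x \<in> cube"
    by (simp add: AE_restrict_space_iff)
  ultimately show ?thesis
  proof eventually_elim
    case (elim x)
    have "(\<lambda>m. g x * cutoff m x) \<longlonglongrightarrow> g x * 1"
      using elim(2) by (intro tendsto_intros cutoff_tendsto)
    moreover have "(\<lambda>m. g x * cutoff m x) = (\<lambda>m. 0)"
      using elim(1) by (intro ext) blast
    ultimately show ?case by (simp add: LIMSEQ_const_iff)
  qed
qed

section \<open>Fourier expansions\<close>

lemma integration_by_parts:
  fixes v w :: "real^'n \<Rightarrow> real"
  assumes v: "smooth v" and w: "smooth w"
    and bd: "\<And>c x. c \<in> {0, 1} \<Longrightarrow> x \<in> cube \<Longrightarrow> v (face_proj j c x) * w (face_proj j c x) = 0"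
  shows "L2_inner v (partial_deriv j w) = - L2_inner (partial_deriv j v) w"
proof -
  let ?M = "lebesgue_on (cube :: (real^'n) set)"
  have vw: "smooth (\<lambda>x. v x * w x)" by (rule smooth_mult[OF v w])
  have c: "continuous_on UNIV (\<lambda>x. v x * w x)" by (rule smooth_continuous[OF vw])
  have "(LINT x|face_measure j c. v x * w x) = 0" if "c \<in> {0, 1}" for c
    unfolding integral_face_measure[OF c]
    using Bochner_Integration.integral_cong[OF refl, of ?M "\<lambda>x. v (face_proj j c x) * w (face_proj j c x)" "\<lambda>x. 0"]
      bd[OF that] by simp
  then have "(LINT x|?M. partial_deriv j (\<lambda>x. v x * w x) x) = 0"
    unfolding cube_Gauss[OF vw] by simp
  also have "(LINT x|?M. partial_deriv j (\<lambda>x. v x * w x) x)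
      = (LINT x|?M. partial_deriv j v x * w x + v x * partial_deriv j w x)"
    by (simp add: partial_deriv_mult smooth_differentiable v w)
  also have "\<dots> = (LINT x|?M. partial_deriv j v x * w x) + (LINT x|?M. v x * partial_deriv j w x)"
    by (intro Bochner_Integration.integral_add integrable_cube_continuous smooth_continuous smooth_mult
        smooth_partial_deriv v w)
  finally show ?thesis by (simp add: L2_inner_def)
qed

lemma L2_smooth: "smooth v \<Longrightarrow> v \<in> L2_cube"
  by (rule L2_continuous[OF smooth_continuous])

lemma trig_face:
  assumes "j \<notin> T" "c \<in> {0, 1}"
  shows "trig T k (face_proj j c x) = 0"
  using assms unfolding trig_remove[of T k _ j] by (auto simp: face_proj_nth)

text \<open>The sets \<open>T\<close> and \<open>flip j T\<close> differ at \<open>j\<close>, so one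
  of the two functions is a sine in direction \<open>j\<close> and the boundary term vanishes. For
  \<open>k = l\<close> with \<open>k j\<close> positive this says that the modes for
  \<open>T\<close> and \<open>flip j T\<close> have equal norms.\<close>

lemma trig_parts:
  "real (k j) * L2_inner (trig (flip j T) k) (trig (flip j T) l)
    = real (l j) * L2_inner (trig T k) (trig T l)"
proof -
  have pd: "partial_deriv j (trig T k) = (\<lambda>x. (tsign j T * (real (k j) * pi)) * trig (flip j T) k x)" for T k
    by (rule ext) (rule partial_deriv_trig)
  have "L2_inner (trig T k) (partial_deriv j (trig (flip j T) l))
      = - L2_inner (partial_deriv j (trig T k)) (trig (flip j T) l)"
    by (rule integration_by_parts[OF smooth_trig smooth_trig]) (cases "j \<in> T", auto simp: trig_face)
  then have "tsign j T * pi * (real (l j) * L2_inner (trig T k) (trig T l))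
      = tsign j T * pi * (real (k j) * L2_inner (trig (flip j T) k) (trig (flip j T) l))"
    unfolding pd L2_inner_cmult_left L2_inner_cmult_right flip_flip tsign_flip by (simp add: mult_ac)
  then show ?thesis by (auto simp: tsign_def split: if_splits)
qed

text \<open>Eigenfunctions of a symmetric operator: two applications of \<open>trig_parts\<close>
  amount to moving the second derivative in direction \<open>j\<close> from one function to the
  other, and its eigenvalues differ when \<open>k j\<close> and \<open>l j\<close> do.\<close>

lemma trig_orthogonal:
  assumes "k \<noteq> l"
  shows "L2_inner (trig T k) (trig T l) = 0"
proof -
  obtain j where j: "k j \<noteq> l j" using assms by auto
  have "real (l j) * (real (l j) * L2_inner (trig T k) (trig T l))
      = real (k j) * (real (l j) * L2_inner (trig (flip j T) k) (trig (flip j T) l))"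
    by (simp add: trig_parts[symmetric, of l] trig_parts[of k j T l, symmetric])
  also have "\<dots> = real (k j) * (real (k j) * L2_inner (trig T k) (trig T l))"
    using trig_parts[of l j T k] by (simp add: L2_inner_commute)
  finally have "((real (l j))\<^sup>2 - (real (k j))\<^sup>2) * L2_inner (trig T k) (trig T l) = 0"
    by (simp add: power2_eq_square algebra_simps)
  moreover have "(real (l j))\<^sup>2 \<noteq> (real (k j))\<^sup>2"
    using j by (simp add: power2_eq_iff_nonneg)
  ultimately show ?thesis by simp
qed

section \<open>Fourier coefficients and partial sums\<close>

definition freqs :: "nat \<Rightarrow> ('n \<Rightarrow> nat) set" where
  "freqs N = {k. \<forall>i. k i \<le> N}"

text \<open>A mode with frequency zero in a sine direction is the zero function; division by zero
  then gives it the coefficient 0.\<close>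

definition fcoef :: "'n set \<Rightarrow> ('n \<Rightarrow> nat) \<Rightarrow> (real^'n \<Rightarrow> real) \<Rightarrow> real" where
  "fcoef T k g = L2_inner g (trig T k) / L2_inner (trig T k) (trig T k)"

definition trig_sum :: "'n set \<Rightarrow> nat \<Rightarrow> (('n \<Rightarrow> nat) \<Rightarrow> real) \<Rightarrow> real^'n \<Rightarrow> real" where
  "trig_sum T N a x = (\<Sum>k\<in>freqs N. a k * trig T k x)"

definition fsum :: "'n set \<Rightarrow> nat \<Rightarrow> (real^'n \<Rightarrow> real) \<Rightarrow> real^'n \<Rightarrow> real" where
  "fsum T N g = trig_sum T N (\<lambda>k. fcoef T k g)"

lemma finite_freqs [simp]: "finite (freqs N :: ('n::finite \<Rightarrow> nat) set)"
proof -
  have "(freqs N :: ('n \<Rightarrow> nat) set) = PiE UNIV (\<lambda>_. {..N})"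
    by (auto simp: freqs_def PiE_def)
  then show ?thesis by (simp add: finite_PiE)
qed

lemma freqs_mono: "N \<le> M \<Longrightarrow> freqs N \<subseteq> freqs M"
  unfolding freqs_def using le_trans by blast

lemma fcoef_mult:
  assumes "g \<in> L2_cube"
  shows "fcoef T k g * L2_inner (trig T k) (trig T k) = L2_inner g (trig T k)"
proof (cases "L2_inner (trig T k) (trig T k) = 0")
  case True
  then have "L2_norm (trig T k) = 0" by (simp add: L2_norm_def)
  then have "L2_inner g (trig T k) = 0"
    using L2_Cauchy_Schwarz[OF assms L2_trig, of T k] by simp
  then show ?thesis using True by simp
qed (simp add: fcoef_def)

lemma smooth_trig_sum: "smooth (trig_sum T N a)"
  unfolding trig_sum_def[abs_def] by (intro smooth_sum smooth_mult smooth_const smooth_trig)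

lemma smooth_fsum: "smooth (fsum T N g)"
  unfolding fsum_def by (rule smooth_trig_sum)

lemma L2_fsum: "fsum T N g \<in> L2_cube"
  by (rule L2_smooth[OF smooth_fsum])

lemma fsum_inner_left:
  assumes "w \<in> L2_cube"
  shows "L2_inner (fsum T N g) w = (\<Sum>k\<in>freqs N. fcoef T k g * L2_inner (trig T k) w)"
  unfolding fsum_def trig_sum_def[abs_def]
  by (subst L2_inner_sum_left) (auto intro: L2_cmult L2_trig assms simp: L2_inner_cmult_left)

lemma fsum_inner_trig:
  assumes "g \<in> L2_cube" "l \<in> freqs N"
  shows "L2_inner (fsum T N g) (trig T l) = L2_inner g (trig T l)"
proof -
  have "L2_inner (fsum T N g) (trig T l)
      = (\<Sum>k\<in>freqs N. if k = l then fcoef T l g * L2_inner (trig T l) (trig T l) else 0)"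
    unfolding fsum_inner_left[OF L2_trig] by (intro sum.cong) (auto simp: trig_orthogonal)
  then show ?thesis using assms by (simp add: fcoef_mult)
qed

text \<open>\<open>fsum T M\<close> is the orthogonal projection onto a span that contains
  \<open>fsum T N h\<close>.\<close>

lemma fsum_inner_fsum:
  assumes "g \<in> L2_cube" "h \<in> L2_cube" "N \<le> M"
  shows "L2_inner (fsum T M g) (fsum T N h) = L2_inner g (fsum T N h)"
proof -
  have "L2_inner (fsum T M g) (trig T k) = L2_inner g (trig T k)" if "k \<in> freqs N" for k
    using fsum_inner_trig[OF assms(1), of k M T] freqs_mono[OF assms(3)] that by blast
  then have "(\<Sum>k\<in>freqs N. fcoef T k h * L2_inner (trig T k) (fsum T M g))
      = (\<Sum>k\<in>freqs N. fcoef T k h * L2_inner (trig T k) g)"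
    by (intro sum.cong) (auto simp: L2_inner_commute)
  then have "L2_inner (fsum T N h) (fsum T M g) = L2_inner (fsum T N h) g"
    unfolding fsum_inner_left[OF L2_fsum] fsum_inner_left[OF assms(1)] .
  then show ?thesis by (simp add: L2_inner_commute)
qed

lemma fsum_norm_le:
  assumes "g \<in> L2_cube"
  shows "L2_norm (fsum T N g) \<le> L2_norm g"
proof (cases "L2_norm (fsum T N g) = 0")
  case False
  have "L2_norm (fsum T N g) * L2_norm (fsum T N g) = L2_inner g (fsum T N g)"
    using fsum_inner_fsum[OF assms assms order_refl, of T N] L2_norm_power2[of "fsum T N g"]
    by (simp add: power2_eq_square)
  also have "\<dots> \<le> L2_norm g * L2_norm (fsum T N g)"
    using L2_Cauchy_Schwarz[OF assms L2_fsum, of T N g] by simp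
  finally show ?thesis
    using False L2_norm_nonneg[of "fsum T N g"] by (simp add: mult_le_cancel_right)
qed simp

lemma fsum_norm_diff:
  assumes "g \<in> L2_cube" "N \<le> M"
  shows "(L2_norm (\<lambda>x. fsum T M g x - fsum T N g x))\<^sup>2 = (L2_norm (fsum T M g))\<^sup>2 - (L2_norm (fsum T N g))\<^sup>2"
  using assms fsum_inner_fsum[OF assms(1) assms(1,2), of T]
    fsum_inner_fsum[OF assms(1) assms(1) order_refl, of T N]
  by (simp add: L2_norm_power2 L2_inner_diff_left L2_inner_diff_right L2_fsum L2_diff
      L2_inner_commute[of "fsum T N g" "fsum T M g"])

lemma fsum_norm_power2:
  assumes "g \<in> L2_cube"
  shows "(L2_norm (fsum T N g))\<^sup>2 = (\<Sum>k\<in>freqs N. (fcoef T k g)\<^sup>2 * L2_inner (trig T k) (trig T k))"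
proof -
  have "(L2_norm (fsum T N g))\<^sup>2 = L2_inner (fsum T N g) g"
    unfolding L2_norm_power2 fsum_inner_fsum[OF assms assms order_refl] by (rule L2_inner_commute)
  also have "\<dots> = (\<Sum>k\<in>freqs N. fcoef T k g * (fcoef T k g * L2_inner (trig T k) (trig T k)))"
    unfolding fsum_inner_left[OF assms] fcoef_mult[OF assms] by (simp add: L2_inner_commute)
  finally show ?thesis by (simp add: power2_eq_square mult.assoc)
qed

text \<open>By Bessel's inequality the norms of the partial sums form a bounded monotone sequence,
  so by Pythagoras the sums are Cauchy. Their limit has the same inner products with all modes as
  \<open>g\<close>, and totality identifies the two.\<close>

lemma L2_tendsto_fsum:
  assumes g: "g \<in> L2_cube"
  shows "L2_tendsto (\<lambda>N. fsum T N g) g"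
proof -
  define b where "b N = (L2_norm (fsum T N g))\<^sup>2" for N
  have mono: "b N \<le> b M" if "N \<le> M" for N M
    using fsum_norm_diff[OF g that, of T] zero_le_power2[of "L2_norm (\<lambda>x. fsum T M g x - fsum T N g x)"]
    unfolding b_def by linarith
  have "b N \<le> (L2_norm g)\<^sup>2" for N
    unfolding b_def by (intro power_mono fsum_norm_le g) simp
  then have "convergent b"
    using mono by (intro Bseq_mono_convergent BseqI'[of _ "(L2_norm g)\<^sup>2"]) (auto simp: b_def)
  then have "Cauchy b" by (rule convergent_Cauchy)
  have "\<exists>n. \<forall>m\<ge>n. \<forall>n'\<ge>n. L2_norm (\<lambda>x. fsum T m g x - fsum T n' g x) < e" if "e > 0" for e
  proof -
    have "0 < e\<^sup>2" using that by simp
    from CauchyD[OF \<open>Cauchy b\<close> this]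
    obtain n where n: "\<And>m n'. m \<ge> n \<Longrightarrow> n' \<ge> n \<Longrightarrow> norm (b m - b n') < e\<^sup>2"
      by blast
    have *: "L2_norm (\<lambda>x. fsum T m g x - fsum T n' g x) < e" if "n' \<ge> n" "m \<ge> n'" for m n'
    proof (rule power2_less_imp_less)
      show "(L2_norm (\<lambda>x. fsum T m g x - fsum T n' g x))\<^sup>2 < e\<^sup>2"
        using n[of m n'] that unfolding fsum_norm_diff[OF g that(2)] b_def by simp
    qed (use \<open>e > 0\<close> in simp)
    have "L2_norm (\<lambda>x. fsum T m g x - fsum T n' g x) < e" if "m \<ge> n" "n' \<ge> n" for m n'
    proof (cases "n' \<le> m")
      case True then show ?thesis using * that by blast
    next
      case False
      then show ?thesis using *[of m n'] that L2_norm_diff_commute[of "fsum T m g" "fsum T n' g"] by simp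
    qed
    then show ?thesis by blast
  qed
  from L2_complete[of "\<lambda>N. fsum T N g", OF L2_fsum this]
  obtain h where h: "h \<in> L2_cube" "L2_tendsto (\<lambda>N. fsum T N g) h" by blast
  have "AE x in lebesgue_on cube. h x - g x = 0"
  proof (rule trig_total)
    show "integrable (lebesgue_on cube) (\<lambda>x. h x - g x)"
      by (rule L1_le_L2(1)[OF L2_diff[OF h(1) g]])
    fix k :: "'a \<Rightarrow> nat"
    have "(\<lambda>N. L2_inner (fsum T N g) (trig T k)) \<longlonglongrightarrow> L2_inner h (trig T k)"
      by (rule L2_tendsto_inner[OF h(2) L2_fsum h(1) L2_trig])
    moreover have "\<forall>\<^sub>F N in sequentially. L2_inner (fsum T N g) (trig T k) = L2_inner g (trig T k)"
      unfolding eventually_sequentially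
    proof (intro exI allI impI)
      \<comment> \<open>From here on the frequency \<open>k\<close> takes part in the sum, so the
        inner product with its mode is already exact.\<close>
      fix N assume N: "Max (range k) \<le> N"
      have "k i \<le> N" for i
        using order_trans[OF Max_ge[of "range k" "k i"] N] by simp
      then show "L2_inner (fsum T N g) (trig T k) = L2_inner g (trig T k)"
        by (intro fsum_inner_trig[OF g]) (simp add: freqs_def)
    qed
    ultimately have "L2_inner h (trig T k) = L2_inner g (trig T k)"
      by (rule LIMSEQ_unique[OF _ tendsto_eventually])
    then have "L2_inner (\<lambda>x. h x - g x) (trig T k) = 0"
      by (simp add: L2_inner_diff_left h(1) g L2_trig)
    then show "(LINT x|lebesgue_on cube. (h x - g x) * trig T k x) = 0"
      by (simp add: L2_inner_def)
  qed
  then have "L2_norm (\<lambda>x. fsum T N g x - g x) = L2_norm (\<lambda>x. fsum T N g x - h x)" for N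
    by (intro L2_norm_cong L2D(1)[OF L2_diff] L2_fsum g h(1)) (auto elim: eventually_mono)
  then show ?thesis using h(2) by (simp add: L2_tendsto_def)
qed

text \<open>
  \<open>weak_green j T w g\<close> expresses that \<open>g\<close> is the derivative of \<open>w\<close> in direction \<open>j\<close> tested against the
  system to which differentiation maps the system \<open>T\<close>. If \<open>j \<notin> T\<close>, it encodes a boundary condition.
\<close>

definition weak_green :: "'n \<Rightarrow> 'n set \<Rightarrow> (real^'n \<Rightarrow> real) \<Rightarrow> (real^'n \<Rightarrow> real) \<Rightarrow> bool" where
  "weak_green j T w g \<longleftrightarrow>
     (\<forall>k. L2_inner g (trig (flip j T) k) = - L2_inner w (partial_deriv j (trig (flip j T) k)))"

lemma partial_deriv_trig_sum:
  "partial_deriv j (trig_sum T N a) = trig_sum (flip j T) N (\<lambda>k. tsign j T * (real (k j) * pi) * a k)"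
proof
  fix x
  have "partial_deriv j (trig_sum T N a) x = (\<Sum>k\<in>freqs N. partial_deriv j (\<lambda>x. a k * trig T k x) x)"
    unfolding trig_sum_def[abs_def] by (rule partial_deriv_sum) (intro smooth_mult smooth_const smooth_trig)
  then show "partial_deriv j (trig_sum T N a) x
      = trig_sum (flip j T) N (\<lambda>k. tsign j T * (real (k j) * pi) * a k) x"
    unfolding partial_deriv_cmult[OF smooth_trig] partial_deriv_trig trig_sum_def by (simp add: mult_ac)
qed

lemma partial_deriv_trig_sum_commute:
  "partial_deriv i (partial_deriv j (trig_sum T N a)) = partial_deriv j (partial_deriv i (trig_sum T N a))"
proof (cases "i = j")
  case False
  then have "flip i (flip j T) = flip j (flip i T)" by (auto simp: flip_def)
  moreover have "tsign i (flip j T) = tsign i T" "tsign j (flip i T) = tsign j T"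
    using False by (auto simp: tsign_def)
  ultimately show ?thesis
    by (simp add: partial_deriv_trig_sum mult_ac)
qed simp

lemma trig_sum_face:
  assumes "j \<notin> T" "c \<in> {0, 1}"
  shows "trig_sum T N a (face_proj j c x) = 0"
  unfolding trig_sum_def using trig_face[OF assms] by simp

lemma fcoef_flip:
  assumes "g \<in> L2_cube" "w \<in> L2_cube" "weak_green j T w g"
  shows "fcoef (flip j T) k g = tsign j T * (real (k j) * pi) * fcoef T k w"
proof -
  have "partial_deriv j (trig (flip j T) k) = (\<lambda>x. (- tsign j T * (real (k j) * pi)) * trig T k x)"
    by (rule ext) (simp add: partial_deriv_trig)
  then have eq: "L2_inner g (trig (flip j T) k) = tsign j T * (real (k j) * pi) * L2_inner w (trig T k)"
    using assms(3) unfolding weak_green_def by (simp add: L2_inner_cmult_right L2_inner_minus_right)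
  show ?thesis
  \<comment> \<open>If \<open>k j = 0\<close>, the two modes may have different norms, but both
    sides are 0. Otherwise the norms agree by \<open>trig_parts\<close>.\<close>
  proof (cases "k j = 0")
    case False
    then show ?thesis
      using trig_parts[of k j T k] by (simp add: fcoef_def eq)
  qed (simp add: fcoef_def eq)
qed

lemma partial_deriv_fsum_green:
  assumes "g \<in> L2_cube" "w \<in> L2_cube" "weak_green j T w g"
  shows "partial_deriv j (fsum T N w) = fsum (flip j T) N g"
  unfolding fsum_def partial_deriv_trig_sum fcoef_flip[OF assms] ..

text \<open>The coefficients of \<open>g\<close> are those of \<open>w\<close> times plus or minus
  \<open>k j * pi\<close>. As \<open>T\<close> has sines in direction \<open>j\<close>, modes with
  \<open>k j = 0\<close> vanish and only factors of modulus at least pi remain. This gives the sharp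
  constant, which \<delta>\<open>\<^sub>0\<close> requires.\<close>

lemma weak_green_Poincare:
  assumes g: "g \<in> L2_cube" and w: "w \<in> L2_cube" and "weak_green j T w g" "j \<notin> T"
  shows "pi * L2_norm w \<le> L2_norm g"
proof (rule LIMSEQ_le)
  show "(\<lambda>N. pi * L2_norm (fsum T N w)) \<longlonglongrightarrow> pi * L2_norm w"
    by (intro tendsto_intros L2_tendsto_norm[OF L2_tendsto_fsum L2_fsum] w)
  show "(\<lambda>N. L2_norm (fsum (flip j T) N g)) \<longlonglongrightarrow> L2_norm g"
    by (intro L2_tendsto_norm[OF L2_tendsto_fsum L2_fsum] g)
  have "pi * L2_norm (fsum T N w) \<le> L2_norm (fsum (flip j T) N g)" for N
  proof (rule power2_le_imp_le)
    have "pi\<^sup>2 * ((fcoef T k w)\<^sup>2 * L2_inner (trig T k) (trig T k))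
        \<le> (fcoef (flip j T) k g)\<^sup>2 * L2_inner (trig (flip j T) k) (trig (flip j T) k)" for k
    proof (cases "k j = 0")
      case True
      then have "trig T k = (\<lambda>x. 0)"
        using \<open>j \<notin> T\<close> by (intro ext) (simp add: trig_remove[of T k _ j] trig_factor_def)
      then show ?thesis by (simp add: L2_inner_def[of "\<lambda>x. 0"])
    next
      case False
      then have e: "L2_inner (trig (flip j T) k) (trig (flip j T) k) = L2_inner (trig T k) (trig T k)"
        using trig_parts[of k j T k] by simp
      have "1 \<le> (real (k j))\<^sup>2" using False by (simp add: one_le_power)
      then have "1 * (pi\<^sup>2 * ((fcoef T k w)\<^sup>2 * L2_inner (trig T k) (trig T k)))
          \<le> (real (k j))\<^sup>2 * (pi\<^sup>2 * ((fcoef T k w)\<^sup>2 * L2_inner (trig T k) (trig T k)))"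
        by (intro mult_right_mono) auto
      moreover have "(tsign j T)\<^sup>2 = 1" by (simp add: power2_eq_square)
      ultimately show ?thesis
        unfolding fcoef_flip[OF assms(1-3)] e by (simp add: power_mult_distrib mult_ac)
    qed
    then show "(pi * L2_norm (fsum T N w))\<^sup>2 \<le> (L2_norm (fsum (flip j T) N g))\<^sup>2"
      unfolding power_mult_distrib fsum_norm_power2[OF w] fsum_norm_power2[OF g] sum_distrib_left
      by (intro sum_mono)
  qed simp
  then show "\<exists>N. \<forall>n\<ge>N. pi * L2_norm (fsum T n w) \<le> L2_norm (fsum (flip j T) n g)" by blast
qed

section \<open>Weak derivatives\<close>

lemma test_smooth: "\<psi> \<in> test_functions \<Longrightarrow> smooth \<psi>"
  by (simp add: test_functions_def)

lemma test_outside: "\<psi> \<in> test_functions \<Longrightarrow> x \<notin> cube \<Longrightarrow> \<psi> x = 0"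
  using closure_subset[of "{x. \<psi> x \<noteq> 0}"] by (auto simp: test_functions_def)

lemma L2_test: "\<psi> \<in> test_functions \<Longrightarrow> \<psi> \<in> L2_cube"
  "\<psi> \<in> test_functions \<Longrightarrow> partial_deriv i \<psi> \<in> L2_cube"
  by (auto intro: L2_smooth smooth_partial_deriv test_smooth)

lemma weak_partial_unique:
  assumes "g \<in> L2_cube" "h \<in> L2_cube" "has_weak_partial i v g" "has_weak_partial i v h"
  shows "AE x in lebesgue_on cube. g x = h x"
proof -
  have "AE x in lebesgue_on cube. g x - h x = 0"
    by (rule AE_zero_if_orthogonal_test[OF L2_diff[OF assms(1,2)]])
      (use assms in \<open>simp add: has_weak_partial_def L2_inner_diff_left L2_test\<close>)
  then show ?thesis by simp
qed

lemma wderiv: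
  assumes "g \<in> L2_cube" "has_weak_partial i v g"
  shows "wderiv i v \<in> L2_cube" "has_weak_partial i v (wderiv i v)"
    "AE x in lebesgue_on cube. wderiv i v x = g x"
proof -
  have "wderiv i v \<in> L2_cube \<and> has_weak_partial i v (wderiv i v)"
    unfolding wderiv_def by (rule someI[of _ g]) (use assms in simp)
  then show *: "wderiv i v \<in> L2_cube" "has_weak_partial i v (wderiv i v)" by auto
  from weak_partial_unique[OF *(1) assms(1) *(2) assms(2)]
  show "AE x in lebesgue_on cube. wderiv i v x = g x" .
qed

lemma H1D:
  assumes "v \<in> H1"
  shows "v \<in> L2_cube" "wderiv i v \<in> L2_cube" "has_weak_partial i v (wderiv i v)"
proof -
  from assms show "v \<in> L2_cube" by (simp add: H1_def)
  from assms obtain g where "g \<in> L2_cube" "has_weak_partial i v g" by (auto simp: H1_def)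
  from wderiv[OF this] show "wderiv i v \<in> L2_cube" "has_weak_partial i v (wderiv i v)" by auto
qed

lemma H1I: "v \<in> L2_cube \<Longrightarrow> (\<And>i. g i \<in> L2_cube) \<Longrightarrow> (\<And>i. has_weak_partial i v (g i)) \<Longrightarrow> v \<in> H1"
  by (auto simp: H1_def)

lemma has_weak_partial_add:
  assumes "has_weak_partial i v g" "has_weak_partial i w h"
    "v \<in> L2_cube" "w \<in> L2_cube" "g \<in> L2_cube" "h \<in> L2_cube"
  shows "has_weak_partial i (\<lambda>x. v x + w x) (\<lambda>x. g x + h x)"
  using assms by (auto simp: has_weak_partial_def L2_inner_add_left L2_test)

lemma has_weak_partial_cmult:
  assumes "has_weak_partial i v g"
  shows "has_weak_partial i (\<lambda>x. c * v x) (\<lambda>x. c * g x)"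
  using assms by (auto simp: has_weak_partial_def L2_inner_cmult_left)

lemma has_weak_partial_cong:
  assumes "has_weak_partial i v g" "AE x in lebesgue_on cube. v' x = v x"
    "v \<in> L2_cube" "v' \<in> L2_cube"
  shows "has_weak_partial i v' g"
proof -
  have "L2_inner v' (partial_deriv i \<psi>) = L2_inner v (partial_deriv i \<psi>)" if "\<psi> \<in> test_functions" for \<psi>
    by (rule L2_inner_cong) (use assms L2_test(2)[OF that] in \<open>auto intro: L2D(1)\<close>)
  then show ?thesis using assms(1) by (simp add: has_weak_partial_def)
qed

lemma has_weak_partial_limit:
  assumes "\<And>m. has_weak_partial i (s m) (d m)" "L2_tendsto s v" "L2_tendsto d g"
    "\<And>m. s m \<in> L2_cube" "\<And>m. d m \<in> L2_cube" "v \<in> L2_cube" "g \<in> L2_cube"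
  shows "has_weak_partial i v g"
  unfolding has_weak_partial_def
proof
  fix \<psi> :: "real^'a \<Rightarrow> real" assume psi: "\<psi> \<in> test_functions"
  have "(\<lambda>m. L2_inner (s m) (partial_deriv i \<psi>)) \<longlonglongrightarrow> L2_inner v (partial_deriv i \<psi>)"
    by (rule L2_tendsto_inner) (use assms psi L2_test in auto)
  moreover have "(\<lambda>m. - L2_inner (d m) \<psi>) \<longlonglongrightarrow> - L2_inner g \<psi>"
    by (intro tendsto_minus L2_tendsto_inner) (use assms psi L2_test in auto)
  moreover have "L2_inner (s m) (partial_deriv i \<psi>) = - L2_inner (d m) \<psi>" for m
    using assms(1) psi by (simp add: has_weak_partial_def)
  ultimately show "L2_inner v (partial_deriv i \<psi>) = - L2_inner g \<psi>"
    using LIMSEQ_unique by simp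
qed

lemma has_weak_partial_smooth:
  assumes "smooth v"
  shows "has_weak_partial i v (partial_deriv i v)"
  unfolding has_weak_partial_def
proof
  fix \<psi> :: "real^'a \<Rightarrow> real" assume psi: "\<psi> \<in> test_functions"
  show "L2_inner v (partial_deriv i \<psi>) = - L2_inner (partial_deriv i v) \<psi>"
  proof (rule integration_by_parts[OF assms test_smooth[OF psi]])
    fix c :: real and x :: "real^'a" assume "c \<in> {0, 1}"
    then have "face_proj i c x \<notin> cube"
      by (auto simp: cube_def face_proj_nth intro!: exI[of _ i])
    then show "v (face_proj i c x) * \<psi> (face_proj i c x) = 0"
      using test_outside[OF psi] by simp
  qed
qed

lemma H1_smooth: "smooth v \<Longrightarrow> v \<in> H1"
  by (rule H1I[OF L2_smooth L2_smooth[OF smooth_partial_deriv] has_weak_partial_smooth])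

lemma wderiv_smooth: "smooth v \<Longrightarrow> AE x in lebesgue_on cube. wderiv i v x = partial_deriv i v x"
  by (rule wderiv(3)[OF L2_smooth[OF smooth_partial_deriv] has_weak_partial_smooth])

lemma H1_add:
  assumes "v \<in> H1" "w \<in> H1"
  shows "(\<lambda>x. v x + w x) \<in> H1"
    "AE x in lebesgue_on cube. wderiv i (\<lambda>x. v x + w x) x = wderiv i v x + wderiv i w x"
proof -
  have *: "(\<lambda>x. wderiv i v x + wderiv i w x) \<in> L2_cube"
    "has_weak_partial i (\<lambda>x. v x + w x) (\<lambda>x. wderiv i v x + wderiv i w x)" for i
    by (intro L2_add has_weak_partial_add H1D assms)+
  show "(\<lambda>x. v x + w x) \<in> H1"
    by (rule H1I[OF L2_add[OF H1D(1) H1D(1)] *]) (use assms in auto)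
  show "AE x in lebesgue_on cube. wderiv i (\<lambda>x. v x + w x) x = wderiv i v x + wderiv i w x"
    by (rule wderiv(3)[OF *])
qed

lemma H1_cmult:
  assumes "v \<in> H1"
  shows "(\<lambda>x. c * v x) \<in> H1"
    "AE x in lebesgue_on cube. wderiv i (\<lambda>x. c * v x) x = c * wderiv i v x"
proof -
  have *: "(\<lambda>x. c * wderiv i v x) \<in> L2_cube"
    "has_weak_partial i (\<lambda>x. c * v x) (\<lambda>x. c * wderiv i v x)" for i
    by (intro L2_cmult has_weak_partial_cmult H1D assms)+
  show "(\<lambda>x. c * v x) \<in> H1"
    by (rule H1I[OF L2_cmult[OF H1D(1)] *]) (use assms in auto)
  show "AE x in lebesgue_on cube. wderiv i (\<lambda>x. c * v x) x = c * wderiv i v x"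
    by (rule wderiv(3)[OF *])
qed

lemma H1_diff:
  assumes "v \<in> H1" "w \<in> H1"
  shows "(\<lambda>x. v x - w x) \<in> H1"
    "AE x in lebesgue_on cube. wderiv i (\<lambda>x. v x - w x) x = wderiv i v x - wderiv i w x"
proof -
  have eq: "(\<lambda>x. v x + (-1) * w x) = (\<lambda>x. v x - w x)" by simp
  show "(\<lambda>x. v x - w x) \<in> H1"
    using H1_add(1)[OF assms(1) H1_cmult(1)[OF assms(2), of "-1"]] unfolding eq .
  show "AE x in lebesgue_on cube. wderiv i (\<lambda>x. v x - w x) x = wderiv i v x - wderiv i w x"
    using H1_add(2)[OF assms(1) H1_cmult(1)[OF assms(2), of "-1"], of i] H1_cmult(2)[OF assms(2), of i "-1"]
    unfolding eq by eventually_elim simp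
qed

lemma H1_cong:
  assumes "v \<in> H1" "v' \<in> borel_measurable (lebesgue_on cube)" "AE x in lebesgue_on cube. v' x = v x"
  shows "v' \<in> H1" "AE x in lebesgue_on cube. wderiv i v' x = wderiv i v x"
proof -
  have v': "v' \<in> L2_cube" by (rule L2_cong_AE[OF H1D(1)[OF assms(1)] assms(2,3)])
  have *: "has_weak_partial i v' (wderiv i v)" for i
    by (rule has_weak_partial_cong[OF H1D(3) assms(3) H1D(1) v']) (use assms in auto)
  show "v' \<in> H1"
    by (rule H1I[OF v' H1D(2) *]) (use assms in auto)
  show "AE x in lebesgue_on cube. wderiv i v' x = wderiv i v x"
    by (rule wderiv(3)[OF H1D(2)[OF assms(1)] *])
qed

lemma L2_norm_wderiv_diff:
  assumes "v \<in> H1" "w \<in> H1"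
  shows "L2_norm (wderiv i (\<lambda>x. v x - w x)) = L2_norm (\<lambda>x. wderiv i v x - wderiv i w x)"
  by (rule L2_norm_cong[OF H1_diff(2)[OF assms] L2D(1) L2D(1)])
    (auto intro: H1D(2) H1_diff(1) L2_diff assms)

lemma L2_tendsto_cong:
  assumes "L2_tendsto s v" "\<And>m. s m \<in> L2_cube" "v \<in> L2_cube"
    "\<And>m. AE x in lebesgue_on cube. s' m x = s m x" "AE x in lebesgue_on cube. v' x = v x"
    "\<And>m. s' m \<in> L2_cube" "v' \<in> L2_cube"
  shows "L2_tendsto s' v'"
proof -
  have "L2_norm (\<lambda>x. s' m x - v' x) = L2_norm (\<lambda>x. s m x - v x)" for m
    by (rule L2_norm_cong) (use assms(4)[of m] assms(5) in \<open>auto intro: L2D(1)[OF L2_diff] assms elim: eventually_elim2\<close>)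
  then show ?thesis using assms(1) by (simp add: L2_tendsto_def)
qed

lemma H1_norm_bounds:
  "L2_norm v \<le> H1_norm v" "L2_norm (wderiv i v) \<le> H1_norm v"
  "H1_norm v \<le> L2_norm v + (\<Sum>i\<in>UNIV. L2_norm (wderiv i v))"
proof -
  let ?S = "L2_set (\<lambda>i. L2_norm (wderiv i v)) UNIV"
  have S: "?S\<^sup>2 = (\<Sum>i\<in>UNIV. L2_inner (wderiv i v) (wderiv i v))"
    unfolding L2_set_def by (simp add: L2_norm_power2 sum_nonneg)
  have H: "H1_norm v = sqrt ((L2_norm v)\<^sup>2 + ?S\<^sup>2)"
    unfolding S by (simp add: H1_norm_def L2_norm_power2)
  show "L2_norm v \<le> H1_norm v"
    unfolding H by (rule real_le_rsqrt) simp
  have "?S \<le> H1_norm v"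
    unfolding H by (rule real_le_rsqrt) simp
  moreover have "L2_norm (wderiv i v) \<le> ?S"
    by (rule member_le_L2_set) auto
  ultimately show "L2_norm (wderiv i v) \<le> H1_norm v" by linarith
  have "H1_norm v \<le> L2_norm v + ?S"
    unfolding H by (rule sqrt_sum_squares_le_sum) (auto simp: L2_set_nonneg)
  also have "?S \<le> (\<Sum>i\<in>UNIV. L2_norm (wderiv i v))"
    by (rule L2_set_le_sum) simp
  finally show "H1_norm v \<le> L2_norm v + (\<Sum>i\<in>UNIV. L2_norm (wderiv i v))" by simp
qed

lemma H1_norm_nonneg [simp]: "0 \<le> H1_norm v"
  by (rule order_trans[OF L2_norm_nonneg H1_norm_bounds(1)])

section \<open>Convergence and completeness in H1\<close>

definition H1_tendsto :: "(nat \<Rightarrow> real^'n \<Rightarrow> real) \<Rightarrow> (real^'n \<Rightarrow> real) \<Rightarrow> bool" where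
  "H1_tendsto s v \<longleftrightarrow> (\<lambda>m. H1_norm (\<lambda>x. s m x - v x)) \<longlonglongrightarrow> 0"

lemma H1_tendsto_iff:
  assumes "\<And>m. s m \<in> H1" "v \<in> H1"
  shows "H1_tendsto s v \<longleftrightarrow> L2_tendsto s v \<and> (\<forall>i. L2_tendsto (\<lambda>m. wderiv i (s m)) (wderiv i v))"
proof (intro iffI conjI allI)
  let ?H = "\<lambda>m. H1_norm (\<lambda>x. s m x - v x)"
  assume H: "H1_tendsto s v"
  then have H0: "?H \<longlonglongrightarrow> 0" by (simp add: H1_tendsto_def)
  show "L2_tendsto s v"
    unfolding L2_tendsto_def by (rule Lim_null_comparison[OF _ H0]) (simp add: H1_norm_bounds)
  fix i
  show "L2_tendsto (\<lambda>m. wderiv i (s m)) (wderiv i v)"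
    unfolding L2_tendsto_def
    by (rule Lim_null_comparison[OF _ H0])
      (simp add: H1_norm_bounds L2_norm_wderiv_diff[OF assms, symmetric])
next
  assume R: "L2_tendsto s v \<and> (\<forall>i. L2_tendsto (\<lambda>m. wderiv i (s m)) (wderiv i v))"
  have "(\<lambda>m. L2_norm (\<lambda>x. s m x - v x) + (\<Sum>i\<in>UNIV. L2_norm (\<lambda>x. wderiv i (s m) x - wderiv i v x)))
      \<longlonglongrightarrow> 0 + (\<Sum>i\<in>(UNIV :: 'a set). 0)"
    using R unfolding L2_tendsto_def by (intro tendsto_add tendsto_sum) auto
  then have lim: "(\<lambda>m. L2_norm (\<lambda>x. s m x - v x) + (\<Sum>i\<in>UNIV. L2_norm (\<lambda>x. wderiv i (s m) x - wderiv i v x)))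
      \<longlonglongrightarrow> 0" by simp
  have le: "norm (H1_norm (\<lambda>x. s m x - v x))
      \<le> L2_norm (\<lambda>x. s m x - v x) + (\<Sum>i\<in>UNIV. L2_norm (\<lambda>x. wderiv i (s m) x - wderiv i v x))" for m
    using H1_norm_bounds(3)[of "\<lambda>x. s m x - v x"] by (simp add: L2_norm_wderiv_diff[OF assms])
  show "H1_tendsto s v"
    unfolding H1_tendsto_def by (rule Lim_null_comparison[OF always_eventually[OF allI[OF le]] lim])
qed

text \<open>Closedness of the weak derivative: its defining identity passes to \<open>L2\<close>
  limits of functions and derivatives.\<close>

lemma H1_limit:
  assumes s: "\<And>m. s m \<in> H1" and v: "v \<in> L2_cube" "L2_tendsto s v"
    and g: "\<And>i. g i \<in> L2_cube" "\<And>i. L2_tendsto (\<lambda>m. wderiv i (s m)) (g i)"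
  shows "v \<in> H1" "AE x in lebesgue_on cube. wderiv i v x = g i x" "H1_tendsto s v"
proof -
  have wp: "has_weak_partial i v (g i)" for i
    by (rule has_weak_partial_limit[OF H1D(3)[OF s] v(2) g(2)]) (auto intro: H1D s v g)
  show v1: "v \<in> H1" by (rule H1I[OF v(1) g(1) wp])
  show ae: "AE x in lebesgue_on cube. wderiv i v x = g i x" for i by (rule wderiv(3)[OF g(1) wp])
  have "L2_tendsto (\<lambda>m. wderiv i (s m)) (wderiv i v)" for i
    by (rule L2_tendsto_cong[OF g(2)]) (use ae in \<open>auto intro: H1D s v1 g\<close>)
  then show "H1_tendsto s v"
    using v(2) by (subst H1_tendsto_iff[OF s v1]) auto
qed

lemma H1_complete:
  assumes s: "\<And>m. s m \<in> H1"
    and c0: "\<And>e. e > 0 \<Longrightarrow> \<exists>N. \<forall>m\<ge>N. \<forall>n\<ge>N. L2_norm (\<lambda>x. s m x - s n x) < e"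
    and c1: "\<And>i e. e > 0 \<Longrightarrow> \<exists>N. \<forall>m\<ge>N. \<forall>n\<ge>N. L2_norm (\<lambda>x. wderiv i (s m) x - wderiv i (s n) x) < e"
  obtains v where "v \<in> H1" "H1_tendsto s v"
proof -
  obtain v where v: "v \<in> L2_cube" "L2_tendsto s v"
    using L2_complete[of s, OF H1D(1)[OF s] c0] by blast
  have "\<exists>g. g \<in> L2_cube \<and> L2_tendsto (\<lambda>m. wderiv i (s m)) g" for i
    using L2_complete[of "\<lambda>m. wderiv i (s m)", OF H1D(2)[OF s] c1] by blast
  then obtain g where g: "\<And>i. g i \<in> L2_cube" "\<And>i. L2_tendsto (\<lambda>m. wderiv i (s m)) (g i)"
    by metis
  from H1_limit(1,3)[OF s v g] that show ?thesis by blast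
qed

section \<open>Vanishing boundary values\<close>

lemma L2_tendsto_bounded:
  fixes s :: "nat \<Rightarrow> real^'n \<Rightarrow> real"
  assumes s: "\<And>m. s m \<in> borel_measurable (lebesgue_on cube)" and v: "v \<in> borel_measurable (lebesgue_on cube)"
    and lim: "\<And>x. x \<in> cube \<Longrightarrow> (\<lambda>m. s m x) \<longlonglongrightarrow> v x"
    and bd: "\<And>m x. x \<in> cube \<Longrightarrow> \<bar>s m x - v x\<bar> \<le> B"
  shows "L2_tendsto s v"
proof -
  let ?M = "lebesgue_on (cube :: (real^'n) set)"
  have "(\<lambda>m. LINT x|?M. (s m x - v x)\<^sup>2) \<longlonglongrightarrow> (LINT x|?M. 0)"
  proof (rule integral_dominated_convergence[where w = "\<lambda>x. B\<^sup>2"])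
    show "integrable ?M (\<lambda>x. B\<^sup>2)"
      by (intro integrable_cube_continuous continuous_intros)
    show "AE x in ?M. (\<lambda>m. (s m x - v x)\<^sup>2) \<longlonglongrightarrow> 0"
    proof (rule AE_I2)
      fix x assume "x \<in> space ?M"
      then have "(\<lambda>m. (s m x - v x)\<^sup>2) \<longlonglongrightarrow> (v x - v x)\<^sup>2"
        by (intro tendsto_intros lim) simp
      then show "(\<lambda>m. (s m x - v x)\<^sup>2) \<longlonglongrightarrow> 0" by simp
    qed
    show "AE x in ?M. norm ((s m x - v x)\<^sup>2) \<le> B\<^sup>2" for m
    proof (rule AE_I2)
      fix x assume "x \<in> space ?M"
      then have "\<bar>s m x - v x\<bar>\<^sup>2 \<le> B\<^sup>2" by (intro power_mono bd) auto
      then show "norm ((s m x - v x)\<^sup>2) \<le> B\<^sup>2" by simp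
    qed
  qed (use s v in auto)
  then have "(\<lambda>m. sqrt (LINT x|?M. (s m x - v x)\<^sup>2)) \<longlonglongrightarrow> sqrt 0"
    by (intro tendsto_real_sqrt) simp
  then show ?thesis
    by (simp add: L2_tendsto_def L2_norm_def L2_inner_def power2_eq_square)
qed

lemma H1_tendsto_add:
  assumes "H1_tendsto s v" "H1_tendsto r w" "\<And>m. s m \<in> H1" "v \<in> H1" "\<And>m. r m \<in> H1" "w \<in> H1"
  shows "H1_tendsto (\<lambda>m x. s m x + r m x) (\<lambda>x. v x + w x)"
proof (subst H1_tendsto_iff)
  show "L2_tendsto (\<lambda>m x. s m x + r m x) (\<lambda>x. v x + w x) \<and>
      (\<forall>i. L2_tendsto (\<lambda>m. wderiv i (\<lambda>x. s m x + r m x)) (wderiv i (\<lambda>x. v x + w x)))"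
  proof (intro conjI allI)
    show "L2_tendsto (\<lambda>m x. s m x + r m x) (\<lambda>x. v x + w x)"
      by (rule L2_tendsto_add) (use assms in \<open>auto simp: H1_tendsto_iff intro: H1D\<close>)
    fix i
    show "L2_tendsto (\<lambda>m. wderiv i (\<lambda>x. s m x + r m x)) (wderiv i (\<lambda>x. v x + w x))"
    proof (rule L2_tendsto_cong[OF L2_tendsto_add])
      show "L2_tendsto (\<lambda>m. wderiv i (s m)) (wderiv i v)" "L2_tendsto (\<lambda>m. wderiv i (r m)) (wderiv i w)"
        using assms by (auto simp: H1_tendsto_iff)
    qed (use assms in \<open>auto intro: H1D H1_add L2_add\<close>)
  qed
qed (auto intro: H1_add assms)

lemma H1_tendsto_cmult:
  assumes "H1_tendsto s v" "\<And>m. s m \<in> H1" "v \<in> H1"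
  shows "H1_tendsto (\<lambda>m x. c * s m x) (\<lambda>x. c * v x)"
proof (subst H1_tendsto_iff)
  show "L2_tendsto (\<lambda>m x. c * s m x) (\<lambda>x. c * v x) \<and>
      (\<forall>i. L2_tendsto (\<lambda>m. wderiv i (\<lambda>x. c * s m x)) (wderiv i (\<lambda>x. c * v x)))"
  proof (intro conjI allI)
    show "L2_tendsto (\<lambda>m x. c * s m x) (\<lambda>x. c * v x)"
      using L2_tendsto_scale[of s v c] assms by (simp add: H1_tendsto_iff)
    fix i
    have "L2_tendsto (\<lambda>m x. c * wderiv i (s m) x) (\<lambda>x. c * wderiv i v x)"
      using L2_tendsto_scale[of "\<lambda>m. wderiv i (s m)" "wderiv i v" c] assms by (simp add: H1_tendsto_iff)
    then show "L2_tendsto (\<lambda>m. wderiv i (\<lambda>x. c * s m x)) (wderiv i (\<lambda>x. c * v x))"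
      by (rule L2_tendsto_cong) (use assms in \<open>auto intro: H1D H1_cmult L2_cmult\<close>)
  qed
qed (auto intro: H1_cmult assms)

lemma H1_tendsto_trans:
  assumes "(\<lambda>m. H1_norm (\<lambda>x. r m x - s m x)) \<longlonglongrightarrow> 0" "H1_tendsto s v"
    "\<And>m. r m \<in> H1" "\<And>m. s m \<in> H1" "v \<in> H1"
  shows "H1_tendsto r v"
proof -
  have "H1_tendsto (\<lambda>m x. r m x - s m x) (\<lambda>x. 0)"
    using assms(1) by (simp add: H1_tendsto_def)
  from H1_tendsto_add[OF this assms(2)] have "H1_tendsto (\<lambda>m x. (r m x - s m x) + s m x) (\<lambda>x. 0 + v x)"
    using assms by (simp add: H1_diff H1_smooth)
  then show ?thesis by simp
qed

lemma H10E:
  assumes "v \<in> H10"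
  obtains \<phi> where "\<And>k. \<phi> k \<in> test_functions" "H1_tendsto \<phi> v"
  using assms by (auto simp: H10_def H1_tendsto_def)

lemma H10I: "v \<in> H1 \<Longrightarrow> (\<And>k. \<phi> k \<in> test_functions) \<Longrightarrow> H1_tendsto \<phi> v \<Longrightarrow> v \<in> H10"
  by (auto simp: H10_def H1_tendsto_def)

lemma H10_H1: "v \<in> H10 \<Longrightarrow> v \<in> H1"
  by (simp add: H10_def)

lemma H1_test: "\<psi> \<in> test_functions \<Longrightarrow> \<psi> \<in> H1"
  by (rule H1_smooth[OF test_smooth])

lemma test_add:
  assumes "\<phi> \<in> test_functions" "\<psi> \<in> test_functions"
  shows "(\<lambda>x. \<phi> x + \<psi> x) \<in> test_functions"
proof -
  let ?S = "\<lambda>\<phi>. closure {x. \<phi> x \<noteq> (0 :: real)}"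
  have sub: "?S (\<lambda>x. \<phi> x + \<psi> x) \<subseteq> ?S \<phi> \<union> ?S \<psi>"
    unfolding closure_Un[symmetric] by (rule closure_mono) auto
  have "compact (?S \<phi> \<union> ?S \<psi>)"
    using assms by (intro compact_Un) (auto simp: test_functions_def)
  from compact_Int_closed[OF this closed_closure, of "{x. \<phi> x + \<psi> x \<noteq> 0}"]
  have "compact (?S (\<lambda>x. \<phi> x + \<psi> x))"
    unfolding inf.absorb2[OF sub] .
  with sub assms show ?thesis
    by (auto simp: test_functions_def intro: smooth_add)
qed

lemma test_cmult:
  assumes "\<phi> \<in> test_functions"
  shows "(\<lambda>x. c * \<phi> x) \<in> test_functions"
proof (cases "c = 0")
  case True
  then show ?thesis by (simp add: test_functions_def)
next
  case False
  then show ?thesis using assms by (simp add: test_functions_def smooth_mult)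
qed

lemma H10_add:
  assumes "v \<in> H10" "w \<in> H10"
  shows "(\<lambda>x. v x + w x) \<in> H10"
proof -
  obtain \<phi> where \<phi>: "\<And>k. \<phi> k \<in> test_functions" "H1_tendsto \<phi> v" using H10E[OF assms(1)] by blast
  obtain \<psi> where \<psi>: "\<And>k. \<psi> k \<in> test_functions" "H1_tendsto \<psi> w" using H10E[OF assms(2)] by blast
  have "H1_tendsto (\<lambda>k x. \<phi> k x + \<psi> k x) (\<lambda>x. v x + w x)"
    by (rule H1_tendsto_add[OF \<phi>(2) \<psi>(2)]) (auto intro: H1_test \<phi> \<psi> H10_H1 assms)
  from H10I[OF H1_add(1)[OF H10_H1[OF assms(1)] H10_H1[OF assms(2)]] test_add[OF \<phi>(1) \<psi>(1)] this]
  show ?thesis .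
qed

lemma H10_cmult:
  assumes "v \<in> H10"
  shows "(\<lambda>x. c * v x) \<in> H10"
proof -
  obtain \<phi> where \<phi>: "\<And>k. \<phi> k \<in> test_functions" "H1_tendsto \<phi> v" using H10E[OF assms] by blast
  have "H1_tendsto (\<lambda>k x. c * \<phi> k x) (\<lambda>x. c * v x)"
    by (rule H1_tendsto_cmult[OF \<phi>(2)]) (auto intro: H1_test \<phi> H10_H1 assms)
  from H10I[OF H1_cmult(1)[OF H10_H1[OF assms]] test_cmult[OF \<phi>(1)] this]
  show ?thesis .
qed

text \<open>For a test function in place of \<open>v\<close> this is the definition of the weak
  derivative of \<open>u\<close>, and both sides are continuous in \<open>v\<close> with respect to
  the \<open>H1\<close> norm.\<close>

lemma H10_parts:
  assumes u: "u \<in> H1" and v: "v \<in> H10"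
  shows "L2_inner u (wderiv i v) = - L2_inner (wderiv i u) v"
proof -
  obtain \<phi> where \<phi>: "\<And>k. \<phi> k \<in> test_functions" "H1_tendsto \<phi> v" using H10E[OF v] by blast
  note v1 = H10_H1[OF v]
  have t: "L2_tendsto \<phi> v" "L2_tendsto (\<lambda>k. wderiv i (\<phi> k)) (wderiv i v)"
    using \<phi>(2) unfolding H1_tendsto_iff[OF H1_test[OF \<phi>(1)] v1] by auto
  have "(\<lambda>k. L2_inner (wderiv i (\<phi> k)) u) \<longlonglongrightarrow> L2_inner (wderiv i v) u"
    by (rule L2_tendsto_inner[OF t(2)]) (auto intro: H1D H1_test \<phi> v1 u)
  moreover have "(\<lambda>k. - L2_inner (\<phi> k) (wderiv i u)) \<longlonglongrightarrow> - L2_inner v (wderiv i u)"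
    by (intro tendsto_minus L2_tendsto_inner[OF t(1)]) (auto intro: H1D H1_test \<phi> v1 u)
  moreover have "L2_inner (wderiv i (\<phi> k)) u = - L2_inner (\<phi> k) (wderiv i u)" for k
  proof -
    have "L2_inner u (wderiv i (\<phi> k)) = L2_inner u (partial_deriv i (\<phi> k))"
      by (rule L2_inner_cong) (auto intro: wderiv_smooth test_smooth \<phi> L2D(1) H1D u H1_test L2_test)
    also have "\<dots> = - L2_inner (wderiv i u) (\<phi> k)"
      using H1D(3)[OF u, of i] \<phi>(1) by (simp add: has_weak_partial_def)
    finally show ?thesis by (simp add: L2_inner_commute)
  qed
  ultimately show ?thesis
    using LIMSEQ_unique by (simp add: L2_inner_commute)
qed

lemma L2_inner_wderiv_smooth:
  assumes "u \<in> L2_cube" "smooth v"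
  shows "L2_inner u (wderiv i v) = L2_inner u (partial_deriv i v)"
  by (rule L2_inner_cong[OF _ wderiv_smooth])
    (use assms in \<open>auto intro: L2D(1) H1D(2) H1_smooth L2_smooth smooth_partial_deriv\<close>)

text \<open>The products with cutoffs are test functions. Their derivatives converge although those
  of the cutoffs blow up near the boundary, since the differentiated cutoff is always multiplied by
  the sine in the same direction.\<close>

lemma trig_in_H10: "trig {} k \<in> H10"
proof -
  let ?s = "\<lambda>m x. trig {} k x * cutoff m x"
  have s: "?s m \<in> test_functions" for m by (rule cutoff_mult_test[OF smooth_trig])
  have t1: "\<bar>trig {} k x\<bar> \<le> 1" for x
    unfolding trig_def by (rule prod_rest_le[OF trig_factor_abs_le])
  have bound1: "\<bar>u * cutoff m x - u\<bar> \<le> 2 * B" if "\<bar>u\<bar> \<le> B" for u B m x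
  proof -
    have "\<bar>u * cutoff m x\<bar> \<le> \<bar>u\<bar> * 1"
      unfolding abs_mult by (rule mult_left_mono[OF cutoff_bounds]) simp
    then show ?thesis using that by linarith
  qed
  have L: "L2_tendsto ?s (trig {} k)"
  proof (rule L2_tendsto_bounded[where B = "2 * 1"])
    fix x :: "real^'a" assume "x \<in> cube"
    then have "(\<lambda>m. trig {} k x * cutoff m x) \<longlonglongrightarrow> trig {} k x * 1"
      by (intro tendsto_intros cutoff_tendsto)
    then show "(\<lambda>m. trig {} k x * cutoff m x) \<longlonglongrightarrow> trig {} k x" by simp
  qed (use bound1[OF t1] L2D(1)[OF L2_test(1)[OF s]] L2D(1)[OF L2_trig] in auto)
  have D: "L2_tendsto (\<lambda>m. wderiv i (?s m)) (partial_deriv i (trig {} k))" for i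
  proof (rule L2_tendsto_cong)
    \<comment> \<open>The second summand is the one in which the cutoff is differentiated; the sine
      in direction \<open>i\<close> is split off so that it meets \<open>chi'\<close>, and the
      remaining factors are bounded by 1.\<close>
    have eq: "partial_deriv i (?s m) x
        = partial_deriv i (trig {} k) x * cutoff m x
          + (sin (real (k i) * pi * x $ i) * chi' m (x $ i))
            * ((\<Prod>b\<in>UNIV - {i}. trig_factor False (real (k b)) (x $ b)) * (\<Prod>b\<in>UNIV - {i}. chi m (x $ b)))" for m x
      by (simp add: partial_deriv_mult smooth_differentiable smooth_trig smooth_cutoff partial_deriv_cutoff
          trig_remove[of "{}" k x i] trig_factor_def)
    let ?R = "\<lambda>m x. (\<Prod>b\<in>UNIV - {i}. trig_factor False (real (k b)) (x $ b)) * (\<Prod>b\<in>UNIV - {i}. chi m (x $ b))"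
    have R: "\<bar>?R m x\<bar> \<le> 1" for m x
      unfolding abs_mult using chi_bounds
      by (intro mult_le_one prod_rest_le trig_factor_abs_le) (auto simp: abs_le_iff intro: order_trans)
    have d1: "\<bar>partial_deriv i (trig {} k) x\<bar> \<le> real (k i) * pi" for x
    proof -
      have "\<bar>trig (flip i {}) k x\<bar> \<le> 1"
        unfolding trig_def by (rule prod_rest_le[OF trig_factor_abs_le])
      then have "(real (k i) * pi) * \<bar>trig (flip i {}) k x\<bar> \<le> (real (k i) * pi) * 1"
        by (intro mult_left_mono) auto
      then show ?thesis by (simp add: partial_deriv_trig abs_mult tsign_def)
    qed
    show "L2_tendsto (\<lambda>m. partial_deriv i (?s m)) (partial_deriv i (trig {} k))"
    proof (rule L2_tendsto_bounded[where B = "2 * (real (k i) * pi) + 4 * (real (k i) * pi)"])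
      fix x :: "real^'a" assume x: "x \<in> cube"
      then have xi: "0 < x $ i" "x $ i < 1" by (auto simp: cube_def)
      have "(\<lambda>m. (sin (real (k i) * pi * x $ i) * chi' m (x $ i)) * ?R m x) \<longlonglongrightarrow> 0"
      proof (rule Lim_null_comparison[OF _ tendsto_rabs_zero[OF sin_mult_chi'_tendsto[OF xi, of "k i"]]])
        have "norm ((sin (real (k i) * pi * x $ i) * chi' m (x $ i)) * ?R m x)
            \<le> \<bar>sin (real (k i) * pi * x $ i) * chi' m (x $ i)\<bar> * 1" for m
          unfolding real_norm_def abs_mult[of _ "?R m x"] by (rule mult_left_mono[OF R]) simp
        then show "\<forall>\<^sub>F m in sequentially. norm ((sin (real (k i) * pi * x $ i) * chi' m (x $ i)) * ?R m x)
            \<le> \<bar>sin (real (k i) * pi * x $ i) * chi' m (x $ i)\<bar>" by simp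
      qed
      then have "(\<lambda>m. partial_deriv i (trig {} k) x * cutoff m x
          + (sin (real (k i) * pi * x $ i) * chi' m (x $ i)) * ?R m x)
          \<longlonglongrightarrow> partial_deriv i (trig {} k) x * 1 + 0"
        by (intro tendsto_intros cutoff_tendsto x)
      then show "(\<lambda>m. partial_deriv i (?s m) x) \<longlonglongrightarrow> partial_deriv i (trig {} k) x"
        unfolding eq by simp
      fix m
      have "\<bar>(sin (real (k i) * pi * x $ i) * chi' m (x $ i)) * ?R m x\<bar> \<le> (4 * (real (k i) * pi)) * 1"
        unfolding abs_mult[of _ "?R m x"] by (intro mult_mono sin_mult_chi'_le xi R) auto
      with bound1[OF d1[of x], of m x]
      show "\<bar>partial_deriv i (?s m) x - partial_deriv i (trig {} k) x\<bar>
          \<le> 2 * (real (k i) * pi) + 4 * (real (k i) * pi)"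
        unfolding eq by linarith
    qed (rule L2D(1)[OF L2_test(2)[OF s]], rule L2D(1)[OF L2_smooth[OF smooth_partial_deriv[OF smooth_trig]]])
  qed (auto intro: wderiv_smooth H1D(2) H1_test s L2_smooth smooth_partial_deriv smooth_trig test_smooth)
  have "H1_tendsto ?s (trig {} k)"
    by (rule H1_limit(3)[OF H1_test[OF s] L2_trig L _ D]) (auto intro: L2_smooth smooth_partial_deriv smooth_trig)
  then show ?thesis by (rule H10I[OF H1_smooth[OF smooth_trig] s])
qed

lemma trig_sum_in_H10: "trig_sum {} N a \<in> H10"
proof -
  have "(\<lambda>x. \<Sum>k\<in>S. a k * trig {} k x) \<in> H10" if "finite S" for S
    using that
  proof induction
    case empty
    have "(\<lambda>x. 0 * trig {} (\<lambda>_. 0) x) \<in> (H10 :: (real^'a \<Rightarrow> real) set)"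
      by (rule H10_cmult[OF trig_in_H10])
    then show ?case by simp
  next
    case (insert k S)
    then show ?case by (simp add: H10_add H10_cmult trig_in_H10)
  qed
  then show ?thesis by (simp add: trig_sum_def[abs_def])
qed

text \<open>Here \<open>v\<close> removes the boundary term, so the cosines in direction
  \<open>j\<close> are admissible test functions.\<close>

lemma weak_green_H10:
  assumes "v \<in> H10"
  shows "weak_green j {} v (wderiv j v)"
  unfolding weak_green_def
proof
  fix k :: "'a \<Rightarrow> nat"
  let ?\<psi> = "trig (flip j {}) k"
  have "L2_inner ?\<psi> (wderiv j v) = - L2_inner (wderiv j ?\<psi>) v"
    by (rule H10_parts[OF H1_smooth[OF smooth_trig] assms])
  also have "L2_inner (wderiv j ?\<psi>) v = L2_inner v (partial_deriv j ?\<psi>)"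
    using L2_inner_wderiv_smooth[OF H1D(1)[OF H10_H1[OF assms]] smooth_trig, of j "flip j {}" k]
    by (simp add: L2_inner_commute)
  finally show "L2_inner (wderiv j v) ?\<psi> = - L2_inner v (partial_deriv j ?\<psi>)"
    by (simp add: L2_inner_commute)
qed

section \<open>Vanishing traces on pairs of faces\<close>

definition zero_trace :: "'n \<Rightarrow> (real^'n \<Rightarrow> real) \<Rightarrow> bool" where
  "zero_trace j v \<longleftrightarrow> (\<forall>c\<in>{0, 1}. has_face_trace j c v (\<lambda>_. 0))"

definition face_int :: "'n \<Rightarrow> real \<Rightarrow> (real^'n \<Rightarrow> real) \<Rightarrow> real" where
  "face_int j c \<phi> = (LINT x|face_measure j c. (\<phi> x)\<^sup>2)"

lemma H1_t_iff: "w \<in> H1_t \<longleftrightarrow> (\<forall>i. (\<lambda>x. w x $ i) \<in> H1) \<and> (\<forall>i j. i \<noteq> j \<longrightarrow> zero_trace j (\<lambda>x. w x $ i))"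
  unfolding H1_t_def H1_vec_def zero_trace_def by blast

lemma has_face_trace_zero_iff:
  "has_face_trace j c v (\<lambda>_. 0) \<longleftrightarrow> v \<in> H1 \<and>
     (\<exists>\<phi>. (\<forall>k. smooth (\<phi> k)) \<and> H1_tendsto \<phi> v \<and> (\<lambda>k. face_int j c (\<phi> k)) \<longlonglongrightarrow> 0)"
  by (simp add: has_face_trace_def H1_tendsto_def face_int_def)

lemma has_face_trace_zeroI:
  assumes "v \<in> H1" "\<And>k. smooth (\<phi> k)" "H1_tendsto \<phi> v" "(\<lambda>k. face_int j c (\<phi> k)) \<longlonglongrightarrow> 0"
  shows "has_face_trace j c v (\<lambda>_. 0)"
  using assms unfolding has_face_trace_zero_iff by blast

lemma face_int_eq:
  assumes "smooth \<phi>"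
  shows "face_int j c \<phi> = (L2_norm (\<lambda>x. \<phi> (face_proj j c x)))\<^sup>2"
proof -
  have "continuous_on UNIV (\<lambda>x. (\<phi> x)\<^sup>2)"
    by (intro continuous_intros smooth_continuous assms)
  from integral_face_measure[OF this] show ?thesis
    unfolding face_int_def L2_norm_power2 L2_inner_def by (simp add: power2_eq_square)
qed

lemma L2_face: "smooth \<phi> \<Longrightarrow> (\<lambda>x. \<phi> (face_proj j c x)) \<in> L2_cube"
  by (intro L2_continuous continuous_on_compose2[OF smooth_continuous] continuous_face_proj continuous_intros) auto

lemma face_int_tendsto_iff:
  assumes "\<And>k. smooth (\<phi> k)"
  shows "(\<lambda>k. face_int j c (\<phi> k)) \<longlonglongrightarrow> 0 \<longleftrightarrow> (\<lambda>k. L2_norm (\<lambda>x. \<phi> k (face_proj j c x))) \<longlonglongrightarrow> 0"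
proof
  assume "(\<lambda>k. face_int j c (\<phi> k)) \<longlonglongrightarrow> 0"
  from tendsto_real_sqrt[OF this] show "(\<lambda>k. L2_norm (\<lambda>x. \<phi> k (face_proj j c x))) \<longlonglongrightarrow> 0"
    by (simp add: face_int_eq assms)
next
  assume "(\<lambda>k. L2_norm (\<lambda>x. \<phi> k (face_proj j c x))) \<longlonglongrightarrow> 0"
  from tendsto_power[OF this, of 2] show "(\<lambda>k. face_int j c (\<phi> k)) \<longlonglongrightarrow> 0"
    by (simp add: face_int_eq assms)
qed

lemma has_face_trace_add:
  assumes "has_face_trace j c v (\<lambda>_. 0)" "has_face_trace j c w (\<lambda>_. 0)"
  shows "has_face_trace j c (\<lambda>x. v x + w x) (\<lambda>_. 0)"
proof -
  obtain \<phi> where \<phi>: "\<And>k. smooth (\<phi> k)" "H1_tendsto \<phi> v" "(\<lambda>k. face_int j c (\<phi> k)) \<longlonglongrightarrow> 0"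
    and v: "v \<in> H1" using assms(1) unfolding has_face_trace_zero_iff by blast
  obtain \<psi> where \<psi>: "\<And>k. smooth (\<psi> k)" "H1_tendsto \<psi> w" "(\<lambda>k. face_int j c (\<psi> k)) \<longlonglongrightarrow> 0"
    and w: "w \<in> H1" using assms(2) unfolding has_face_trace_zero_iff by blast
  have sm: "smooth (\<lambda>x. \<phi> k x + \<psi> k x)" for k by (rule smooth_add[OF \<phi>(1) \<psi>(1)])
  have "(\<lambda>k. L2_norm (\<lambda>x. \<phi> k (face_proj j c x) + \<psi> k (face_proj j c x))) \<longlonglongrightarrow> 0"
  proof (rule Lim_null_comparison)
    show "(\<lambda>k. L2_norm (\<lambda>x. \<phi> k (face_proj j c x)) + L2_norm (\<lambda>x. \<psi> k (face_proj j c x))) \<longlonglongrightarrow> 0"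
      using tendsto_add[OF \<phi>(3)[unfolded face_int_tendsto_iff[OF \<phi>(1)]] \<psi>(3)[unfolded face_int_tendsto_iff[OF \<psi>(1)]]]
      by simp
  qed (use L2_norm_triangle[OF L2_face[OF \<phi>(1)] L2_face[OF \<psi>(1)]] in auto)
  then have f: "(\<lambda>k. face_int j c (\<lambda>x. \<phi> k x + \<psi> k x)) \<longlonglongrightarrow> 0"
    unfolding face_int_tendsto_iff[OF sm] .
  have h: "H1_tendsto (\<lambda>k x. \<phi> k x + \<psi> k x) (\<lambda>x. v x + w x)"
    by (rule H1_tendsto_add[OF \<phi>(2) \<psi>(2)]) (auto intro: H1_smooth \<phi> \<psi> v w)
  show ?thesis by (rule has_face_trace_zeroI[OF H1_add(1)[OF v w] sm h f])
qed

lemma has_face_trace_cmult: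
  assumes "has_face_trace j c v (\<lambda>_. 0)"
  shows "has_face_trace j c (\<lambda>x. a * v x) (\<lambda>_. 0)"
proof -
  obtain \<phi> where \<phi>: "\<And>k. smooth (\<phi> k)" "H1_tendsto \<phi> v" "(\<lambda>k. face_int j c (\<phi> k)) \<longlonglongrightarrow> 0"
    and v: "v \<in> H1" using assms(1) unfolding has_face_trace_zero_iff by blast
  have sm: "smooth (\<lambda>x. a * \<phi> k x)" for k by (rule smooth_mult[OF smooth_const \<phi>(1)])
  have f: "(\<lambda>k. face_int j c (\<lambda>x. a * \<phi> k x)) \<longlonglongrightarrow> 0"
    using tendsto_mult_right_zero[OF \<phi>(3), of "a\<^sup>2"] by (simp add: face_int_def power_mult_distrib)
  have h: "H1_tendsto (\<lambda>k x. a * \<phi> k x) (\<lambda>x. a * v x)"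
    by (rule H1_tendsto_cmult[OF \<phi>(2)]) (auto intro: H1_smooth \<phi> v)
  show ?thesis by (rule has_face_trace_zeroI[OF H1_cmult(1)[OF v] sm h f])
qed

text \<open>A diagonal sequence: for each \<open>m\<close> a smooth function is picked that is close
  to \<open>s m\<close> in \<open>H1\<close> and small on the face.\<close>

lemma has_face_trace_limit:
  assumes s: "\<And>m. has_face_trace j c (s m) (\<lambda>_. 0)" and v: "v \<in> H1" and lim: "H1_tendsto s v"
  shows "has_face_trace j c v (\<lambda>_. 0)"
proof -
  have s1: "s m \<in> H1" for m using s by (simp add: has_face_trace_zero_iff)
  have "\<exists>\<phi>. smooth \<phi> \<and> H1_norm (\<lambda>x. \<phi> x - s m x) < inverse (real (Suc m)) \<and> face_int j c \<phi> < inverse (real (Suc m))" for m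
  proof -
    obtain \<phi> where \<phi>: "\<And>k. smooth (\<phi> k)" "H1_tendsto \<phi> (s m)" "(\<lambda>k. face_int j c (\<phi> k)) \<longlonglongrightarrow> 0"
      using s[of m] unfolding has_face_trace_zero_iff by blast
    have "\<forall>\<^sub>F k in sequentially. H1_norm (\<lambda>x. \<phi> k x - s m x) < inverse (real (Suc m))"
      using \<phi>(2) unfolding H1_tendsto_def by (rule order_tendstoD) simp
    moreover have "\<forall>\<^sub>F k in sequentially. face_int j c (\<phi> k) < inverse (real (Suc m))"
      using \<phi>(3) by (rule order_tendstoD) simp
    ultimately have "\<forall>\<^sub>F k in sequentially. H1_norm (\<lambda>x. \<phi> k x - s m x) < inverse (real (Suc m)) \<and>
        face_int j c (\<phi> k) < inverse (real (Suc m))"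
      by eventually_elim simp
    then show ?thesis using \<phi>(1) eventually_happens'[OF sequentially_bot] by blast
  qed
  then obtain \<phi> where \<phi>: "\<And>m. smooth (\<phi> m)" "\<And>m. H1_norm (\<lambda>x. \<phi> m x - s m x) < inverse (real (Suc m))"
    "\<And>m. face_int j c (\<phi> m) < inverse (real (Suc m))" by metis
  have "(\<lambda>m. H1_norm (\<lambda>x. \<phi> m x - s m x)) \<longlonglongrightarrow> 0"
    by (rule Lim_null_comparison[OF _ LIMSEQ_inverse_real_of_nat])
      (use \<phi>(2) in \<open>auto intro!: always_eventually less_imp_le\<close>)
  then have "H1_tendsto \<phi> v"
    by (rule H1_tendsto_trans[OF _ lim]) (auto intro: H1_smooth \<phi> s1 v)
  moreover have "(\<lambda>m. face_int j c (\<phi> m)) \<longlonglongrightarrow> 0"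
    by (rule Lim_null_comparison[OF _ LIMSEQ_inverse_real_of_nat])
      (use \<phi>(3) in \<open>auto intro!: always_eventually less_imp_le simp: face_int_def\<close>)
  ultimately show ?thesis
    unfolding has_face_trace_zero_iff using \<phi>(1) v by blast
qed

lemma has_face_trace_smooth:
  fixes \<phi> :: "real^'n \<Rightarrow> real"
  assumes "smooth \<phi>" "\<And>x. \<phi> (face_proj j c x) = 0"
  shows "has_face_trace j c \<phi> (\<lambda>_. 0)"
proof -
  \<comment> \<open>The constant sequence approximates \<phi> because zero has norm 0. This needs an
    argument, since \<open>wderiv\<close> picks a representative that is determined only almost
    everywhere.\<close>
  define z :: "real^'n \<Rightarrow> real" where "z = (\<lambda>x. 0)"
  have "H1_norm z = 0"
  proof -
    have z: "smooth z" "partial_deriv i z = z" for i by (simp_all add: z_def)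
    have "L2_norm z = 0" by (simp add: L2_norm_def L2_inner_def z_def)
    moreover have "L2_norm (wderiv i z) = L2_norm z" for i
      by (rule L2_norm_cong) (use wderiv_smooth[OF z(1), of i] z in \<open>auto intro: L2D(1) H1D H1_smooth\<close>)
    ultimately show ?thesis using H1_norm_bounds(3)[of z] H1_norm_nonneg[of z] by simp
  qed
  then have "H1_norm (\<lambda>x. \<phi> x - \<phi> x) = 0"
    by (simp add: z_def)
  moreover have "face_int j c \<phi> = 0"
    by (simp add: face_int_eq[OF assms(1)] assms(2) L2_norm_def L2_inner_def)
  ultimately show ?thesis
    unfolding has_face_trace_zero_iff H1_tendsto_def
    using assms(1) by (intro conjI H1_smooth exI[of _ "\<lambda>k. \<phi>"]) auto
qed

text \<open>Integration by parts for the approximating sequence leaves two boundary terms. The one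
  on the face at \<open>c\<close> tends to 0 with the trace of the sequence, the one on the opposite
  face is killed by \<psi>.\<close>

lemma has_face_trace_parts:
  assumes w: "has_face_trace j c w (\<lambda>_. 0)" and \<psi>: "smooth \<psi>"
    and c: "c \<in> {0, 1}" and other: "\<And>x. \<psi> (face_proj j (1 - c) x) = 0"
  shows "L2_inner (wderiv j w) \<psi> = - L2_inner w (partial_deriv j \<psi>)"
proof -
  obtain \<phi> where \<phi>: "\<And>k. smooth (\<phi> k)" "H1_tendsto \<phi> w" "(\<lambda>k. face_int j c (\<phi> k)) \<longlonglongrightarrow> 0"
    and w1: "w \<in> H1" using w unfolding has_face_trace_zero_iff by blast
  have t: "L2_tendsto \<phi> w" "L2_tendsto (\<lambda>k. wderiv j (\<phi> k)) (wderiv j w)"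
    using \<phi>(2) unfolding H1_tendsto_iff[OF H1_smooth[OF \<phi>(1)] w1] by auto
  define F where "F k c = L2_inner (\<lambda>x. \<phi> k (face_proj j c x)) (\<lambda>x. \<psi> (face_proj j c x))" for k c
  have id: "L2_inner (wderiv j (\<phi> k)) \<psi> + L2_inner (\<phi> k) (partial_deriv j \<psi>) = F k 1 - F k 0" for k
  proof -
    have sm: "smooth (\<lambda>x. \<phi> k x * \<psi> x)" by (rule smooth_mult[OF \<phi>(1) \<psi>])
    have "F k 1 - F k 0 = (LINT x|lebesgue_on cube. partial_deriv j (\<lambda>x. \<phi> k x * \<psi> x) x)"
      unfolding cube_Gauss[OF sm] integral_face_measure[OF smooth_continuous[OF sm]] F_def L2_inner_def by simp
    also have "\<dots> = (LINT x|lebesgue_on cube. partial_deriv j (\<phi> k) x * \<psi> x + \<phi> k x * partial_deriv j \<psi> x)"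
      by (simp add: partial_deriv_mult smooth_differentiable \<phi>(1) \<psi>)
    also have "\<dots> = L2_inner (partial_deriv j (\<phi> k)) \<psi> + L2_inner (\<phi> k) (partial_deriv j \<psi>)"
      unfolding L2_inner_def inner_real_def
      by (intro Bochner_Integration.integral_add integrable_cube_continuous smooth_continuous smooth_mult
          smooth_partial_deriv \<phi> \<psi>)
    also have "L2_inner (partial_deriv j (\<phi> k)) \<psi> = L2_inner (wderiv j (\<phi> k)) \<psi>"
      using L2_inner_wderiv_smooth[OF L2_smooth[OF \<psi>] \<phi>(1)[of k], of j] by (simp add: L2_inner_commute)
    finally show ?thesis by simp
  qed
  have F0: "F k (1 - c) = 0" for k
    by (simp add: F_def other L2_inner_def)
  have "(\<lambda>k. F k c) \<longlonglongrightarrow> 0"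
  proof (rule Lim_null_comparison)
    show "(\<lambda>k. L2_norm (\<lambda>x. \<phi> k (face_proj j c x)) * L2_norm (\<lambda>x. \<psi> (face_proj j c x))) \<longlonglongrightarrow> 0"
      using \<phi>(3) unfolding face_int_tendsto_iff[OF \<phi>(1)] by (rule tendsto_mult_left_zero)
    show "\<forall>\<^sub>F k in sequentially. norm (F k c)
        \<le> L2_norm (\<lambda>x. \<phi> k (face_proj j c x)) * L2_norm (\<lambda>x. \<psi> (face_proj j c x))"
      unfolding F_def using L2_Cauchy_Schwarz[OF L2_face[OF \<phi>(1)] L2_face[OF \<psi>]] by simp
  qed
  then have "(\<lambda>k. F k 1 - F k 0) \<longlonglongrightarrow> 0"
    using c F0 tendsto_minus[of "\<lambda>k. F k c" 0 sequentially] by auto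
  moreover have "(\<lambda>k. L2_inner (wderiv j (\<phi> k)) \<psi> + L2_inner (\<phi> k) (partial_deriv j \<psi>))
      \<longlonglongrightarrow> L2_inner (wderiv j w) \<psi> + L2_inner w (partial_deriv j \<psi>)"
    by (intro tendsto_add L2_tendsto_inner t)
      (auto intro: H1D H1_smooth \<phi> w1 L2_smooth \<psi> smooth_partial_deriv)
  ultimately have "0 = L2_inner (wderiv j w) \<psi> + L2_inner w (partial_deriv j \<psi>)"
    unfolding id by (rule LIMSEQ_unique)
  then show ?thesis by simp
qed

text \<open>
  The approximating sequences for the two opposite faces may differ, so \<open>\<psi>\<close> is split into two parts, each
  of which vanishes on one of the faces.
\<close>

lemma zero_trace_parts:
  assumes w: "zero_trace j w" and \<psi>: "smooth \<psi>"
  shows "L2_inner (wderiv j w) \<psi> = - L2_inner w (partial_deriv j \<psi>)"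
proof -
  let ?a = "\<lambda>x. x $ j * \<psi> x" and ?b = "\<lambda>x. (1 - x $ j) * \<psi> x"
  have sa: "smooth ?a" and sb: "smooth ?b"
    by (intro smooth_mult smooth_diff smooth_nth smooth_const \<psi>)+
  have t: "has_face_trace j 0 w (\<lambda>_. 0)" "has_face_trace j 1 w (\<lambda>_. 0)"
    using w by (auto simp: zero_trace_def)
  have w1: "w \<in> H1" using t by (simp add: has_face_trace_zero_iff)
  have eq: "(\<lambda>x. ?a x + ?b x) = \<psi>" by (simp add: algebra_simps)
  have eq': "(\<lambda>x. partial_deriv j ?a x + partial_deriv j ?b x) = partial_deriv j \<psi>"
    using partial_deriv_add[OF smooth_differentiable[OF sa] smooth_differentiable[OF sb], of j] unfolding eq by auto
  have "L2_inner (wderiv j w) ?a = - L2_inner w (partial_deriv j ?a)"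
    by (rule has_face_trace_parts[OF t(2) sa]) (auto simp: face_proj_nth)
  moreover have "L2_inner (wderiv j w) ?b = - L2_inner w (partial_deriv j ?b)"
    by (rule has_face_trace_parts[OF t(1) sb]) (auto simp: face_proj_nth)
  moreover have "L2_inner (wderiv j w) \<psi> = L2_inner (wderiv j w) ?a + L2_inner (wderiv j w) ?b"
    using L2_inner_add_right[OF L2_smooth[OF sa] L2_smooth[OF sb] H1D(2)[OF w1], of j] unfolding eq .
  moreover have "L2_inner w (partial_deriv j \<psi>) = L2_inner w (partial_deriv j ?a) + L2_inner w (partial_deriv j ?b)"
    using L2_inner_add_right[OF L2_smooth[OF smooth_partial_deriv[OF sa]] L2_smooth[OF smooth_partial_deriv[OF sb]]
        H1D(1)[OF w1], of j j] unfolding eq' .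
  ultimately show ?thesis by simp
qed

text \<open>Here the test function carries the boundary condition in direction \<open>j\<close>.
  Approximability by globally smooth functions is a hypothesis instead of a density theorem: a
  vanishing trace of \<open>w\<close> on any face supplies such a sequence.\<close>

lemma smooth_approx_parts:
  assumes \<phi>: "\<And>k. smooth (\<phi> k)" "H1_tendsto \<phi> w" and w: "w \<in> H1" and \<psi>: "smooth \<psi>"
    and vanish: "\<And>c x. c \<in> {0, 1} \<Longrightarrow> \<psi> (face_proj j c x) = 0"
  shows "L2_inner (wderiv j w) \<psi> = - L2_inner w (partial_deriv j \<psi>)"
proof -
  have t: "L2_tendsto \<phi> w" "L2_tendsto (\<lambda>k. wderiv j (\<phi> k)) (wderiv j w)"
    using \<phi>(2) unfolding H1_tendsto_iff[OF H1_smooth[OF \<phi>(1)] w] by auto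
  have "(\<lambda>k. L2_inner (wderiv j (\<phi> k)) \<psi>) \<longlonglongrightarrow> L2_inner (wderiv j w) \<psi>"
    by (rule L2_tendsto_inner[OF t(2)]) (auto intro: H1D H1_smooth \<phi> w L2_smooth \<psi>)
  moreover have "(\<lambda>k. - L2_inner (\<phi> k) (partial_deriv j \<psi>)) \<longlonglongrightarrow> - L2_inner w (partial_deriv j \<psi>)"
    by (intro tendsto_minus L2_tendsto_inner[OF t(1)]) (auto intro: H1D H1_smooth \<phi> w L2_smooth \<psi> smooth_partial_deriv)
  moreover have "L2_inner (wderiv j (\<phi> k)) \<psi> = - L2_inner (\<phi> k) (partial_deriv j \<psi>)" for k
    using integration_by_parts[OF \<phi>(1)[of k] \<psi>, of j] vanish
      L2_inner_wderiv_smooth[OF L2_smooth[OF \<psi>] \<phi>(1)[of k], of j] by (simp add: L2_inner_commute)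
  ultimately show ?thesis using LIMSEQ_unique by simp
qed

section \<open>Tangentially vanishing fields\<close>

lemma H1_t_H1: "w \<in> H1_t \<Longrightarrow> (\<lambda>x. w x $ i) \<in> H1"
  by (simp add: H1_t_iff)

lemma H1_t_zero_trace: "w \<in> H1_t \<Longrightarrow> i \<noteq> j \<Longrightarrow> zero_trace j (\<lambda>x. w x $ i)"
  by (simp add: H1_t_iff)

lemma other_index:
  fixes i :: "'n::finite"
  assumes "2 \<le> CARD('n)"
  obtains j where "j \<noteq> i"
proof -
  have "\<exists>j. j \<noteq> i"
  proof (rule ccontr)
    assume "\<nexists>j. j \<noteq> i"
    then have "(UNIV :: 'n set) = {i}" by auto
    then have "CARD('n) = card {i}" by (rule arg_cong)
    with assms show False by simp
  qed
  with that show ?thesis by blast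
qed

text \<open>For \<open>j\<close> different from \<open>i\<close> the trace of the component
  vanishes. For \<open>j = i\<close> nothing is known on those faces, but the toggled system
  consists of sine products, which vanish there; the smooth approximations then come from a trace
  condition in another direction, which exists in dimension at least 2.\<close>

lemma H1_t_weak_green:
  fixes w :: "real^'n \<Rightarrow> real^'n"
  assumes w: "w \<in> H1_t" and n: "2 \<le> CARD('n)"
  shows "weak_green j {i} (\<lambda>x. w x $ i) (wderiv j (\<lambda>x. w x $ i))"
proof (cases "j = i")
  case False
  then show ?thesis
    unfolding weak_green_def using zero_trace_parts[OF H1_t_zero_trace[OF w, of i j] smooth_trig] by blast
next
  case True
  obtain j' where "j' \<noteq> i" using other_index[OF n] by blast
  then have "has_face_trace j' 0 (\<lambda>x. w x $ i) (\<lambda>_. 0)"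
    using H1_t_zero_trace[OF w, of i j'] by (auto simp: zero_trace_def)
  then obtain \<phi> where \<phi>: "\<And>k. smooth (\<phi> k)" "H1_tendsto \<phi> (\<lambda>x. w x $ i)"
    unfolding has_face_trace_zero_iff by blast
  have "flip j {i} = {}" using True by (simp add: flip_def)
  then show ?thesis
    unfolding weak_green_def
    using smooth_approx_parts[OF \<phi> H1_t_H1[OF w] smooth_trig] by (simp add: trig_face)
qed

lemma H1_t_Poincare:
  fixes w :: "real^'n \<Rightarrow> real^'n"
  assumes w: "w \<in> H1_t" and n: "2 \<le> CARD('n)" and "j \<noteq> i"
  shows "pi * L2_norm (\<lambda>x. w x $ i) \<le> L2_norm (wderiv j (\<lambda>x. w x $ i))"
  by (rule weak_green_Poincare[OF H1D(2) H1D(1) H1_t_weak_green[OF w n]])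
    (use assms in \<open>auto intro: H1_t_H1\<close>)

text \<open>Two integrations by parts exchange the derivatives if second derivatives of the
  \<open>j\<close>-th component of \<open>w\<close> exist, so this component is replaced by its
  partial sums \<open>P N\<close>. No boundary terms occur: the \<open>i\<close>-th component of
  \<open>r\<close> has zero trace on the faces normal to \<open>j\<close>, and the derivative of
  \<open>P N\<close> in direction \<open>j\<close> is a sum of sine products, zero on the faces
  normal to \<open>i\<close>.\<close>

lemma H1_t_Maxwell:
  fixes r w :: "real^'n \<Rightarrow> real^'n"
  assumes r: "r \<in> H1_t" and w: "w \<in> H1_t" and n: "2 \<le> CARD('n)"
  shows "L2_inner (wderiv i (\<lambda>x. r x $ i)) (wderiv j (\<lambda>x. w x $ j))
    = L2_inner (wderiv j (\<lambda>x. r x $ i)) (wderiv i (\<lambda>x. w x $ j))"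
proof (cases "i = j")
  case False
  let ?r = "\<lambda>x. r x $ i" and ?w = "\<lambda>x. w x $ j"
  define P where "P N = fsum {j} N ?w" for N
  have r1: "?r \<in> H1" and w1: "?w \<in> H1" using r w by (auto intro: H1_t_H1)
  have P: "smooth (P N)" for N unfolding P_def by (rule smooth_fsum)
  have dP: "partial_deriv a (P N) = fsum (flip a {j}) N (wderiv a ?w)" for a N
    unfolding P_def by (rule partial_deriv_fsum_green[OF H1D(2)[OF w1] H1D(1)[OF w1] H1_t_weak_green[OF w n]])
  have lim: "L2_tendsto (\<lambda>N. partial_deriv a (P N)) (wderiv a ?w)" for a
    unfolding dP by (rule L2_tendsto_fsum[OF H1D(2)[OF w1]])
  have L2P: "partial_deriv a (P N) \<in> L2_cube" for a N
    by (intro L2_smooth smooth_partial_deriv P)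
  obtain \<phi> where \<phi>: "\<And>k. smooth (\<phi> k)" "H1_tendsto \<phi> ?r"
    using H1_t_zero_trace[OF r False] by (auto simp: zero_trace_def has_face_trace_zero_iff)
  have "L2_inner (partial_deriv j (P N)) (wderiv i ?r) = L2_inner (partial_deriv i (P N)) (wderiv j ?r)" for N
  proof -
    have "L2_inner (wderiv j ?r) (partial_deriv i (P N)) = - L2_inner ?r (partial_deriv j (partial_deriv i (P N)))"
      by (intro zero_trace_parts H1_t_zero_trace r False smooth_partial_deriv P)
    also have "partial_deriv j (partial_deriv i (P N)) = partial_deriv i (partial_deriv j (P N))"
      unfolding P_def fsum_def by (rule partial_deriv_trig_sum_commute)
    also have "- L2_inner ?r (partial_deriv i (partial_deriv j (P N))) = L2_inner (wderiv i ?r) (partial_deriv j (P N))"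
    proof (rule smooth_approx_parts[OF \<phi> r1 smooth_partial_deriv[OF P], symmetric])
      fix c :: real and x :: "real^'n" assume "c \<in> {0, 1}"
      moreover have "flip j {j} = {}" by (simp add: flip_def)
      ultimately show "partial_deriv j (P N) (face_proj i c x) = 0"
        unfolding dP fsum_def using trig_sum_face[of i "{}" c] by simp
    qed
    finally show ?thesis by (simp add: L2_inner_commute)
  qed
  moreover have "(\<lambda>N. L2_inner (partial_deriv j (P N)) (wderiv i ?r)) \<longlonglongrightarrow> L2_inner (wderiv j ?w) (wderiv i ?r)"
    "(\<lambda>N. L2_inner (partial_deriv i (P N)) (wderiv j ?r)) \<longlonglongrightarrow> L2_inner (wderiv i ?w) (wderiv j ?r)"
    by (intro L2_tendsto_inner lim L2P H1D r1 w1)+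
  ultimately show ?thesis
    using LIMSEQ_unique by (simp add: L2_inner_commute)
qed simp

lemma H1_t_add:
  assumes "v \<in> H1_t" "w \<in> H1_t"
  shows "(\<lambda>x. v x + w x) \<in> H1_t"
  using assms by (auto simp: H1_t_iff zero_trace_def intro: H1_add has_face_trace_add)

lemma H1_t_scale:
  assumes "v \<in> H1_t"
  shows "(\<lambda>x. c *\<^sub>R v x) \<in> H1_t"
  using assms by (auto simp: H1_t_iff zero_trace_def intro: H1_cmult has_face_trace_cmult)

lemma H1_t_limit:
  assumes "\<And>m. s m \<in> H1_t" "\<And>i. (\<lambda>x. v x $ i) \<in> H1" "\<And>i. H1_tendsto (\<lambda>m x. s m x $ i) (\<lambda>x. v x $ i)"
  shows "v \<in> H1_t"
  unfolding H1_t_iff zero_trace_def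
proof (intro conjI allI impI ballI)
  fix i j :: 'a and c :: real assume "i \<noteq> j" "c \<in> {0, 1}"
  then have "has_face_trace j c (\<lambda>x. s m x $ i) (\<lambda>_. 0)" for m
    using H1_t_zero_trace[OF assms(1), of i j m] by (auto simp: zero_trace_def)
  then show "has_face_trace j c (\<lambda>x. v x $ i) (\<lambda>_. 0)"
    by (rule has_face_trace_limit[OF _ assms(2,3)])
qed (rule assms)

lemma H1_t_smooth:
  assumes "\<And>i. smooth (\<lambda>x. w x $ i)"
    and "\<And>i j c x. i \<noteq> j \<Longrightarrow> c \<in> {0, 1} \<Longrightarrow> w (face_proj j c x) $ i = 0"
  shows "w \<in> H1_t"
  unfolding H1_t_iff zero_trace_def
  using assms by (auto intro!: H1_smooth has_face_trace_smooth)

section \<open>Vector fields\<close>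

lemma borel_measurable_vecI:
  fixes v :: "'a \<Rightarrow> 'b::euclidean_space^'m"
  assumes "\<And>i. (\<lambda>x. v x $ i) \<in> borel_measurable M"
  shows "v \<in> borel_measurable M"
proof (subst borel_measurable_euclidean_space, intro ballI)
  fix b :: "'b^'m" assume "b \<in> Basis"
  then obtain i u where "u \<in> Basis" and b: "b = axis i u" by (auto simp: Basis_vec_def)
  have "(\<lambda>x. v x $ i \<bullet> u) \<in> borel_measurable M"
    by (intro borel_measurable_inner assms borel_measurable_const)
  then show "(\<lambda>x. v x \<bullet> b) \<in> borel_measurable M"
    by (simp add: b inner_axis)
qed

lemma norm_vec_power2: "(norm (v :: 'b::euclidean_space^'m))\<^sup>2 = (\<Sum>i\<in>UNIV. (norm (v $ i))\<^sup>2)"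
  by (simp add: power2_norm_eq_inner inner_vec_def)

lemma L2_vecI:
  fixes v :: "'a \<Rightarrow> 'b::euclidean_space^'m"
  assumes "\<And>i. (\<lambda>x. v x $ i) \<in> L2 M"
  shows "v \<in> L2 M"
proof -
  have "v \<in> borel_measurable M"
    by (intro borel_measurable_vecI L2D(1) assms)
  moreover have "integrable M (\<lambda>x. \<Sum>i\<in>UNIV. (norm (v x $ i))\<^sup>2)"
    by (intro Bochner_Integration.integrable_sum L2D(2) assms)
  ultimately show ?thesis by (simp add: L2_def norm_vec_power2)
qed

lemma L2_nth:
  fixes v :: "'a \<Rightarrow> 'b::euclidean_space^'m"
  assumes "v \<in> L2 M"
  shows "(\<lambda>x. v x $ i) \<in> L2 M"
proof (rule L2_bound[OF assms, of _ 1])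
  have "(\<lambda>y :: 'b^'m. y $ i) \<in> borel_measurable borel"
    by (intro borel_measurable_continuous_onI continuous_intros)
  from measurable_compose[OF L2D(1)[OF assms] this]
  show "(\<lambda>x. v x $ i) \<in> borel_measurable M" .
qed (simp add: Finite_Cartesian_Product.norm_nth_le)

lemma L2_inner_vec:
  fixes v w :: "real^'n \<Rightarrow> 'b::euclidean_space^'m"
  assumes "v \<in> L2_cube" "w \<in> L2_cube"
  shows "L2_inner v w = (\<Sum>i\<in>UNIV. L2_inner (\<lambda>x. v x $ i) (\<lambda>x. w x $ i))"
  unfolding L2_inner_def inner_vec_def
  by (intro Bochner_Integration.integral_sum L2_inner_integrable L2_nth assms)

lemma L2_norm_vec:
  fixes v :: "real^'n \<Rightarrow> 'b::euclidean_space^'m"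
  assumes "v \<in> L2_cube"
  shows "L2_norm v = L2_set (\<lambda>i. L2_norm (\<lambda>x. v x $ i)) UNIV"
  unfolding L2_norm_def[of v] L2_set_def L2_norm_power2 L2_inner_vec[OF assms assms] ..

lemma L2_norm_nth_le:
  fixes v :: "real^'n \<Rightarrow> 'b::euclidean_space^'m"
  assumes "v \<in> L2_cube"
  shows "L2_norm (\<lambda>x. v x $ i) \<le> L2_norm v"
  unfolding L2_norm_vec[OF assms] by (rule member_le_L2_set) auto

lemma L2_norm_vec_le_sum:
  fixes v :: "real^'n \<Rightarrow> 'b::euclidean_space^'m"
  assumes "v \<in> L2_cube"
  shows "L2_norm v \<le> (\<Sum>i\<in>UNIV. L2_norm (\<lambda>x. v x $ i))"
  unfolding L2_norm_vec[OF assms] by (rule L2_set_le_sum) simp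

lemma H1_vec_nth: "w \<in> H1_vec \<Longrightarrow> (\<lambda>x. w x $ i) \<in> H1"
  by (simp add: H1_vec_def)

lemma H1_t_H1_vec: "w \<in> H1_t \<Longrightarrow> w \<in> H1_vec"
  by (simp add: H1_t_def)

lemma L2_H1_vec: "w \<in> H1_vec \<Longrightarrow> w \<in> L2_cube"
  by (intro L2_vecI H1D H1_vec_nth)

lemma wjac_nth: "wjac w x $ i $ j = wderiv j (\<lambda>y. w y $ i) x"
  by (simp add: wjac_def)

lemma L2_wjac: "w \<in> H1_vec \<Longrightarrow> wjac w \<in> L2_cube"
  by (intro L2_vecI) (simp add: wjac_nth H1D H1_vec_nth)

lemma wdiv_eq_trace: "wdiv w x = trace (wjac w x)"
  by (simp add: wdiv_def trace_def wjac_nth)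

lemma L2_wdiv: "w \<in> H1_vec \<Longrightarrow> wdiv w \<in> L2_cube"
  unfolding wdiv_def[abs_def] by (intro L2_sum H1D H1_vec_nth)

lemma L2_transpose:
  fixes M :: "real^'n \<Rightarrow> real^'m^'k"
  assumes "M \<in> L2_cube"
  shows "(\<lambda>x. transpose (M x)) \<in> L2_cube"
  by (intro L2_vecI) (simp add: transpose_def L2_nth[OF L2_nth[OF assms]])

lemma H1_vec_add: "v \<in> H1_vec \<Longrightarrow> w \<in> H1_vec \<Longrightarrow> (\<lambda>x. v x + w x) \<in> H1_vec"
  by (simp add: H1_vec_def H1_add)

lemma H1_vec_scale: "v \<in> H1_vec \<Longrightarrow> (\<lambda>x. c *\<^sub>R v x) \<in> H1_vec"
  by (simp add: H1_vec_def H1_cmult)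

lemma AE_matrix_eqI:
  fixes M N :: "'a \<Rightarrow> real^'m^'k"
  assumes "\<And>i j. AE x in \<mu>. M x $ i $ j = N x $ i $ j"
  shows "AE x in \<mu>. M x = N x"
proof -
  have "AE x in \<mu>. \<forall>i\<in>UNIV. \<forall>j\<in>UNIV. M x $ i $ j = N x $ i $ j"
    by (intro AE_finite_allI assms finite_class.finite_UNIV)
  then show ?thesis by (simp add: vec_eq_iff)
qed

lemma wjac_add:
  assumes "v \<in> H1_vec" "w \<in> H1_vec"
  shows "AE x in lebesgue_on cube. wjac (\<lambda>x. v x + w x) x = wjac v x + wjac w x"
  by (rule AE_matrix_eqI) (use H1_add(2)[OF H1_vec_nth[OF assms(1)] H1_vec_nth[OF assms(2)]] in \<open>simp add: wjac_nth\<close>)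

lemma wjac_scale:
  assumes "v \<in> H1_vec"
  shows "AE x in lebesgue_on cube. wjac (\<lambda>x. c *\<^sub>R v x) x = c *\<^sub>R wjac v x"
  by (rule AE_matrix_eqI) (use H1_cmult(2)[OF H1_vec_nth[OF assms]] in \<open>simp add: wjac_nth\<close>)

lemma wjac_diff:
  assumes "v \<in> H1_vec" "w \<in> H1_vec"
  shows "AE x in lebesgue_on cube. wjac (\<lambda>x. v x - w x) x = wjac v x - wjac w x"
  by (rule AE_matrix_eqI) (use H1_diff(2)[OF H1_vec_nth[OF assms(1)] H1_vec_nth[OF assms(2)]] in \<open>simp add: wjac_nth\<close>)

lemma H1_t_diff:
  assumes "v \<in> H1_t" "w \<in> H1_t"
  shows "(\<lambda>x. v x - w x) \<in> H1_t"
  using H1_t_add[OF assms(1) H1_t_scale[OF assms(2), of "-1"]] by simp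

lemma H1_t_zero: "(\<lambda>x. 0) \<in> H1_t"
  by (rule H1_t_smooth) auto

text \<open>Each component is bounded by a single off-diagonal entry of its row of the Jacobian, so
  the constant pi survives the summation.\<close>

lemma H1_t_Poincare_vec:
  fixes w :: "real^'n \<Rightarrow> real^'n"
  assumes w: "w \<in> H1_t" and n: "2 \<le> CARD('n)"
  shows "pi * L2_norm w \<le> L2_norm (wjac w)"
proof -
  have J: "wjac w \<in> L2_cube" by (rule L2_wjac[OF H1_t_H1_vec[OF w]])
  have le: "pi * L2_norm (\<lambda>x. w x $ i) \<le> L2_norm (\<lambda>x. wjac w x $ i)" for i
  proof -
    obtain j where j: "j \<noteq> i" using other_index[OF n] by blast
    have "pi * L2_norm (\<lambda>x. w x $ i) \<le> L2_norm (\<lambda>x. wjac w x $ i $ j)"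
      unfolding wjac_nth by (rule H1_t_Poincare[OF w n j])
    also have "\<dots> \<le> L2_norm (\<lambda>x. wjac w x $ i)"
      by (rule L2_norm_nth_le[OF L2_nth[OF J]])
    finally show ?thesis .
  qed
  have "pi * L2_norm w = L2_set (\<lambda>i. pi * L2_norm (\<lambda>x. w x $ i)) UNIV"
    unfolding L2_norm_vec[OF L2_H1_vec[OF H1_t_H1_vec[OF w]]] by (rule L2_set_right_distrib) simp
  also have "\<dots> \<le> L2_norm (wjac w)"
    unfolding L2_norm_vec[OF J] by (rule L2_set_mono) (use le in auto)
  finally show ?thesis .
qed

text \<open>\<open>H1_t_Maxwell\<close> summed over all pairs of directions.\<close>

lemma H1_t_div_transpose:
  fixes r w :: "real^'n \<Rightarrow> real^'n"
  assumes r: "r \<in> H1_t" and w: "w \<in> H1_t" and n: "2 \<le> CARD('n)"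
  shows "L2_inner (wdiv r) (wdiv w) = L2_inner (wjac r) (\<lambda>x. transpose (wjac w x))"
proof -
  note v = H1_t_H1_vec[OF r] H1_t_H1_vec[OF w]
  have d: "wderiv i (\<lambda>x. r x $ j) \<in> L2_cube" "wderiv i (\<lambda>x. w x $ j) \<in> L2_cube" for i j
    by (intro H1D H1_vec_nth v)+
  have "L2_inner (wdiv r) (wdiv w)
      = (\<Sum>i\<in>UNIV. \<Sum>j\<in>UNIV. L2_inner (wderiv i (\<lambda>x. r x $ i)) (wderiv j (\<lambda>x. w x $ j)))"
    unfolding wdiv_def[abs_def]
    by (subst L2_inner_sum_left) (auto intro!: L2_sum d sum.cong L2_inner_sum_right)
  also have "\<dots> = (\<Sum>i\<in>UNIV. \<Sum>j\<in>UNIV. L2_inner (wderiv j (\<lambda>x. r x $ i)) (wderiv i (\<lambda>x. w x $ j)))"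
    by (intro sum.cong refl H1_t_Maxwell r w n)
  also have "\<dots> = L2_inner (wjac r) (\<lambda>x. transpose (wjac w x))"
  proof -
    note J = L2_wjac[OF v(1)] L2_transpose[OF L2_wjac[OF v(2)]]
    show ?thesis
      unfolding L2_inner_vec[OF J] L2_inner_vec[OF L2_nth[OF J(1)] L2_nth[OF J(2)]]
      by (simp add: transpose_def wjac_nth)
  qed
  finally show ?thesis .
qed

text \<open>A common treatment of both dimensions: the rotation is a linear function of the
  Jacobian, and only its Gram form enters, which is half the inner product of M - M^T and N -
  N^T.\<close>

locale rot_operator =
  fixes R :: "real^'n^'n \<Rightarrow> 'r::euclidean_space"
  assumes two_le_dim: "2 \<le> CARD('n)"
    and linear_R: "linear R"
    and R_inner: "R M \<bullet> R N = M \<bullet> N - M \<bullet> transpose N"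
begin

definition rot :: "(real^'n \<Rightarrow> real^'n) \<Rightarrow> real^'n \<Rightarrow> 'r" where
  "rot w x = R (wjac w x)"

lemma L2_R:
  assumes "M \<in> L2_cube"
  shows "(\<lambda>x. R (M x)) \<in> L2_cube"
proof -
  obtain C where C: "\<And>M. norm (R M) \<le> C * norm M"
    using linear_bounded[OF linear_R] by blast
  have "continuous_on UNIV R"
    by (intro linear_continuous_on linear_conv_bounded_linear[THEN iffD1] linear_R)
  from measurable_compose[OF L2D(1)[OF assms] borel_measurable_continuous_onI[OF this]]
  show ?thesis by (rule L2_bound[OF assms]) (use C in auto)
qed

lemma L2_rot: "w \<in> H1_vec \<Longrightarrow> rot w \<in> L2_cube"
  unfolding rot_def[abs_def] by (intro L2_R L2_wjac)

text \<open>The product of the rotations contributes minus the pairing of one Jacobian with the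
  transpose of the other, and this is the product of the divergences. The polarised form is required
  because it turns the bilinear form of the problem for \<rho> into the Dirichlet form.\<close>

lemma rot_div_identity:
  assumes r: "r \<in> H1_t" and w: "w \<in> H1_t"
  shows "L2_inner (wdiv r) (wdiv w) + L2_inner (rot r) (rot w) = L2_inner (wjac r) (wjac w)"
proof -
  note v = H1_t_H1_vec[OF r] H1_t_H1_vec[OF w]
  have "L2_inner (rot r) (rot w)
      = (LINT x|lebesgue_on cube. wjac r x \<bullet> wjac w x - wjac r x \<bullet> transpose (wjac w x))"
    unfolding L2_inner_def rot_def R_inner ..
  also have "\<dots> = L2_inner (wjac r) (wjac w) - L2_inner (wjac r) (\<lambda>x. transpose (wjac w x))"
    unfolding L2_inner_def
    by (intro Bochner_Integration.integral_diff L2_inner_integrable L2_wjac L2_transpose v)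
  finally show ?thesis
    unfolding H1_t_div_transpose[OF r w two_le_dim] by simp
qed

lemma wdiv_norm_le:
  fixes w :: "real^'n \<Rightarrow> real^'n"
  assumes "w \<in> H1_t"
  shows "L2_norm (wdiv w) \<le> L2_norm (wjac w)"
proof (rule power2_le_imp_le)
  show "(L2_norm (wdiv w))\<^sup>2 \<le> (L2_norm (wjac w))\<^sup>2"
    using rot_div_identity[OF assms assms] L2_inner_nonneg[of "rot w"] unfolding L2_norm_power2 by linarith
qed simp

end

text \<open>By the Poincare inequality the norm of the Jacobian controls the field itself, so each
  component converges in \<open>H1\<close>; vanishing traces survive the limit.\<close>

lemma H1_t_complete:
  fixes s :: "nat \<Rightarrow> real^'n \<Rightarrow> real^'n"
  assumes n: "2 \<le> CARD('n)" and s: "\<And>m. s m \<in> H1_t"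
    and cauchy: "\<And>e. e > 0 \<Longrightarrow> \<exists>N. \<forall>m\<ge>N. \<forall>k\<ge>N. L2_norm (wjac (\<lambda>x. s m x - s k x)) < e"
  obtains v where "v \<in> H1_t" "(\<lambda>m. L2_norm (wjac (\<lambda>x. s m x - v x))) \<longlonglongrightarrow> 0"
proof -
  have s1: "(\<lambda>x. s m x $ i) \<in> H1" for m i by (rule H1_t_H1[OF s])
  have d1: "L2_norm (\<lambda>x. wderiv j (\<lambda>x. s m x $ i) x - wderiv j (\<lambda>x. s k x $ i) x)
      \<le> L2_norm (wjac (\<lambda>x. s m x - s k x))" for i j m k
  proof -
    note J = L2_wjac[OF H1_t_H1_vec[OF H1_t_diff[OF s s]]]
    have "L2_norm (\<lambda>x. wderiv j (\<lambda>x. s m x $ i) x - wderiv j (\<lambda>x. s k x $ i) x)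
        = L2_norm (\<lambda>x. wjac (\<lambda>x. s m x - s k x) x $ i $ j)"
      using L2_norm_wderiv_diff[OF s1 s1, of j m i k i] by (simp add: wjac_nth)
    also have "\<dots> \<le> L2_norm (\<lambda>x. wjac (\<lambda>x. s m x - s k x) x $ i)"
      by (rule L2_norm_nth_le[OF L2_nth[OF J]])
    also have "\<dots> \<le> L2_norm (wjac (\<lambda>x. s m x - s k x))"
      by (rule L2_norm_nth_le[OF J])
    finally show ?thesis .
  qed
  have d0: "L2_norm (\<lambda>x. s m x $ i - s k x $ i) \<le> L2_norm (wjac (\<lambda>x. s m x - s k x))" for i m k
  proof -
    note D = H1_t_diff[OF s s, of m k]
    have "L2_norm (\<lambda>x. s m x $ i - s k x $ i) \<le> L2_norm (\<lambda>x. s m x - s k x)"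
      using L2_norm_nth_le[OF L2_H1_vec[OF H1_t_H1_vec[OF D]], of i] by simp
    also have "\<dots> = 1 * \<dots>" by simp
    also have "\<dots> \<le> pi * L2_norm (\<lambda>x. s m x - s k x)"
      using pi_ge_two by (intro mult_right_mono) auto
    also have "\<dots> \<le> L2_norm (wjac (\<lambda>x. s m x - s k x))"
      by (rule H1_t_Poincare_vec[OF D n])
    finally show ?thesis .
  qed
  have "\<exists>v. v \<in> H1 \<and> H1_tendsto (\<lambda>m x. s m x $ i) v" for i
  proof -
    have c0: "\<exists>N. \<forall>m\<ge>N. \<forall>k\<ge>N. L2_norm (\<lambda>x. s m x $ i - s k x $ i) < e" if "e > 0" for e
      using cauchy[OF that] le_less_trans[OF d0] by blast
    have c1: "\<exists>N. \<forall>m\<ge>N. \<forall>k\<ge>N. L2_norm (\<lambda>x. wderiv j (\<lambda>x. s m x $ i) x - wderiv j (\<lambda>x. s k x $ i) x) < e"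
      if "e > 0" for j e
      using cauchy[OF that] le_less_trans[OF d1] by blast
    obtain v where "v \<in> H1" "H1_tendsto (\<lambda>m x. s m x $ i) v"
      by (rule H1_complete[of "\<lambda>m x. s m x $ i", OF s1 c0 c1])
    then show ?thesis by blast
  qed
  then obtain v where v: "\<And>i. v i \<in> H1" "\<And>i. H1_tendsto (\<lambda>m x. s m x $ i) (v i)" by metis
  define u :: "real^'n \<Rightarrow> real^'n" where "u x = (\<chi> i. v i x)" for x
  have u1: "(\<lambda>x. u x $ i) \<in> H1" and u2: "H1_tendsto (\<lambda>m x. s m x $ i) (\<lambda>x. u x $ i)" for i
    using v by (simp_all add: u_def)
  have u: "u \<in> H1_t" by (rule H1_t_limit[OF s u1 u2])
  have "(\<lambda>m. L2_norm (wjac (\<lambda>x. s m x - u x))) \<longlonglongrightarrow> 0"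
  proof (rule Lim_null_comparison)
    have "(\<lambda>m. L2_norm (\<lambda>x. wderiv j (\<lambda>x. s m x $ i) x - wderiv j (\<lambda>x. u x $ i) x)) \<longlonglongrightarrow> 0" for i j
      using u2 unfolding H1_tendsto_iff[OF s1 u1] L2_tendsto_def by blast
    then have "(\<lambda>m. \<Sum>i\<in>UNIV. \<Sum>j\<in>UNIV. L2_norm (\<lambda>x. wderiv j (\<lambda>x. s m x $ i) x - wderiv j (\<lambda>x. u x $ i) x))
        \<longlonglongrightarrow> (\<Sum>i\<in>(UNIV :: 'n set). \<Sum>j\<in>(UNIV :: 'n set). 0)"
      by (intro tendsto_sum)
    then show "(\<lambda>m. \<Sum>i\<in>UNIV. \<Sum>j\<in>UNIV. L2_norm (\<lambda>x. wderiv j (\<lambda>x. s m x $ i) x - wderiv j (\<lambda>x. u x $ i) x))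
        \<longlonglongrightarrow> 0" by simp
    have "L2_norm (wjac (\<lambda>x. s m x - u x))
        \<le> (\<Sum>i\<in>UNIV. \<Sum>j\<in>UNIV. L2_norm (\<lambda>x. wderiv j (\<lambda>x. s m x $ i) x - wderiv j (\<lambda>x. u x $ i) x))" for m
    proof -
      note J = L2_wjac[OF H1_t_H1_vec[OF H1_t_diff[OF s u]]]
      have "L2_norm (wjac (\<lambda>x. s m x - u x)) \<le> (\<Sum>i\<in>UNIV. L2_norm (\<lambda>x. wjac (\<lambda>x. s m x - u x) x $ i))"
        by (rule L2_norm_vec_le_sum[OF J])
      also have "\<dots> \<le> (\<Sum>i\<in>UNIV. \<Sum>j\<in>UNIV. L2_norm (\<lambda>x. wjac (\<lambda>x. s m x - u x) x $ i $ j))"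
        by (intro sum_mono L2_norm_vec_le_sum L2_nth J)
      finally show ?thesis
        by (simp add: wjac_nth L2_norm_wderiv_diff[OF s1 u1])
    qed
    then show "\<forall>\<^sub>F m in sequentially. norm (L2_norm (wjac (\<lambda>x. s m x - u x)))
        \<le> (\<Sum>i\<in>UNIV. \<Sum>j\<in>UNIV. L2_norm (\<lambda>x. wderiv j (\<lambda>x. s m x $ i) x - wderiv j (\<lambda>x. u x $ i) x))"
      by simp
  qed
  with u that show ?thesis by blast
qed

section \<open>Gradients\<close>

text \<open>
  The second derivatives of the sine expansion \<open>S\<^sub>N\<close> of \<open>\<phi>\<close> converge: the pure ones are the sine expansions of
  those of \<open>\<phi>\<close>, and by the Maxwell identity they control the mixed ones.
\<close>

lemma H2_H10_gradient:
  fixes \<phi> :: "real^'n \<Rightarrow> real"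
  assumes \<phi>2: "\<phi> \<in> H2" and \<phi>0: "\<phi> \<in> H10" and n: "2 \<le> CARD('n)"
  shows "wgrad \<phi> \<in> H1_t"
    "AE x in lebesgue_on cube. transpose (whess \<phi> x) = whess \<phi> x"
proof -
  have \<phi>1: "\<phi> \<in> H1" and d1: "wderiv i \<phi> \<in> H1" for i using \<phi>2 by (auto simp: H2_def)
  define S where "S N = fsum {} N \<phi>" for N
  define G where "G N i = partial_deriv i (S N)" for N i
  have S: "smooth (S N)" and sG: "smooth (G N i)" for N i
    by (simp_all add: S_def G_def smooth_fsum smooth_partial_deriv)
  have flip0: "flip i {} = {i}" "flip i {i} = {}" for i :: 'n by (auto simp: flip_def)
  have G: "G N i = fsum {i} N (wderiv i \<phi>)" for N i
    unfolding G_def S_def using partial_deriv_fsum_green[OF H1D(2)[OF \<phi>1] H1D(1)[OF \<phi>1] weak_green_H10[OF \<phi>0]]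
    by (simp add: flip0)
  \<comment> \<open>The sine products lie in \<open>H10\<close>, so they can be used as test
    functions without any boundary information on the derivatives of \<phi>.\<close>
  have green: "weak_green i {i} (wderiv i \<phi>) (wderiv i (wderiv i \<phi>))" for i
    unfolding weak_green_def flip0
  proof
    fix k
    have "L2_inner (wderiv i \<phi>) (partial_deriv i (trig {} k)) = L2_inner (wderiv i \<phi>) (wderiv i (trig {} k))"
      by (rule L2_inner_wderiv_smooth[OF H1D(1)[OF d1] smooth_trig, symmetric])
    also have "\<dots> = - L2_inner (wderiv i (wderiv i \<phi>)) (trig {} k)"
      by (rule H10_parts[OF d1 trig_in_H10])
    finally show "L2_inner (wderiv i (wderiv i \<phi>)) (trig {} k)
        = - L2_inner (wderiv i \<phi>) (partial_deriv i (trig {} k))" by simp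
  qed
  have GD: "partial_deriv i (G N i) = fsum {} N (wderiv i (wderiv i \<phi>))" for N i
    unfolding G partial_deriv_fsum_green[OF H1D(2)[OF d1] H1D(1)[OF d1] green] by (simp add: flip0)
  have sym: "partial_deriv i (G N j) = partial_deriv j (G N i)" for i j N
    unfolding G_def S_def fsum_def by (rule partial_deriv_trig_sum_commute)
  have L2G: "partial_deriv j (G N i) \<in> L2_cube" for i j N
    by (intro L2_smooth smooth_partial_deriv sG)
  define \<Gamma> :: "nat \<Rightarrow> real^'n \<Rightarrow> real^'n" where "\<Gamma> N x = (\<chi> i. G N i x)" for N x
  have \<Gamma>: "\<Gamma> N \<in> H1_t" for N
  proof (rule H1_t_smooth)
    show "smooth (\<lambda>x. \<Gamma> N x $ i)" for i using sG by (simp add: \<Gamma>_def)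
    show "\<Gamma> N (face_proj j c x) $ i = 0" if "i \<noteq> j" "c \<in> {0, 1}" for i j c x
      using that trig_sum_face[of j "{i}" c] by (simp add: \<Gamma>_def G fsum_def)
  qed
  have conv: "\<exists>h. h \<in> L2_cube \<and> L2_tendsto (\<lambda>N. partial_deriv j (G N i)) h" for i j
  proof -
    define d where "d a N M = L2_norm (\<lambda>x. partial_deriv a (G N a) x - partial_deriv a (G M a) x)" for a N M
    have le: "(L2_norm (\<lambda>x. partial_deriv j (G N i) x - partial_deriv j (G M i) x))\<^sup>2 \<le> d i N M * d j N M" for N M
    proof -
      define D where "D = (\<lambda>x. \<Gamma> N x - \<Gamma> M x)"
      have D: "D \<in> H1_t" unfolding D_def by (rule H1_t_diff[OF \<Gamma> \<Gamma>])
      have ae: "AE x in lebesgue_on cube. wderiv a (\<lambda>x. D x $ b) x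
          = partial_deriv a (G N b) x - partial_deriv a (G M b) x" for a b
        using wderiv_smooth[OF smooth_diff[OF sG sG], of a N b M b]
        by (simp add: D_def \<Gamma>_def partial_deriv_diff[OF sG sG])
      have m: "wderiv a (\<lambda>x. D x $ b) \<in> borel_measurable (lebesgue_on cube)"
        "(\<lambda>x. partial_deriv a (G N b) x - partial_deriv a (G M b) x) \<in> borel_measurable (lebesgue_on cube)" for a b
        by (rule L2D(1), intro H1D H1_t_H1 D) (rule L2D(1), intro L2_diff L2G)
      have cg: "L2_inner (wderiv a (\<lambda>x. D x $ b)) (wderiv a' (\<lambda>x. D x $ b'))
          = L2_inner (\<lambda>x. partial_deriv a (G N b) x - partial_deriv a (G M b) x)
              (\<lambda>x. partial_deriv a' (G N b') x - partial_deriv a' (G M b') x)" for a b a' b'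
        by (rule L2_inner_cong[OF ae ae m m])
      \<comment> \<open>The derivatives of the gradient field \<open>D\<close> are symmetric, so the
        square of a mixed one is the product of entry (i, j) with entry (j, i), and the Maxwell
        identity trades this for a product of pure derivatives.\<close>
      have "(L2_norm (\<lambda>x. partial_deriv j (G N i) x - partial_deriv j (G M i) x))\<^sup>2
          = L2_inner (wderiv j (\<lambda>x. D x $ i)) (wderiv i (\<lambda>x. D x $ j))"
        unfolding cg L2_norm_power2 sym[of i _ j] ..
      also have "\<dots> = L2_inner (wderiv i (\<lambda>x. D x $ i)) (wderiv j (\<lambda>x. D x $ j))"
        by (rule H1_t_Maxwell[OF D D n, symmetric])
      also have "\<dots> \<le> d i N M * d j N M"
        unfolding cg d_def using L2_Cauchy_Schwarz[OF L2_diff[OF L2G L2G] L2_diff[OF L2G L2G]] abs_le_D1 by blast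
      finally show ?thesis .
    qed
    have dc: "\<exists>n. \<forall>m\<ge>n. \<forall>k\<ge>n. d a m k < e" if "e > 0" for a e
    proof -
      have "(\<lambda>N. L2_norm (\<lambda>x. partial_deriv a (G N a) x - wderiv a (wderiv a \<phi>) x)) \<longlonglongrightarrow> 0"
        using L2_tendsto_fsum[OF H1D(2)[OF d1, of a], of "{}" a] unfolding L2_tendsto_def GD .
      moreover have "0 < e / 2" using that by simp
      ultimately have "\<forall>\<^sub>F N in sequentially. L2_norm (\<lambda>x. partial_deriv a (G N a) x - wderiv a (wderiv a \<phi>) x) < e / 2"
        by (rule order_tendstoD)
      then obtain n where n: "\<And>N. N \<ge> n \<Longrightarrow> L2_norm (\<lambda>x. partial_deriv a (G N a) x - wderiv a (wderiv a \<phi>) x) < e / 2"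
        unfolding eventually_sequentially by blast
      have "d a m k < e" if "m \<ge> n" "k \<ge> n" for m k
        using L2_norm_triangle_diff[OF L2G[of a m a] H1D(2)[OF d1[of a], of a] L2G[of a k a]] n[OF that(1)] n[OF that(2)]
        by (simp add: d_def L2_norm_diff_commute[of "wderiv a (wderiv a \<phi>)"])
      then show ?thesis by blast
    qed
    have "\<exists>n. \<forall>m\<ge>n. \<forall>k\<ge>n. L2_norm (\<lambda>x. partial_deriv j (G m i) x - partial_deriv j (G k i) x) < e" if "e > 0" for e
    proof -
      obtain n1 where n1: "\<forall>m\<ge>n1. \<forall>k\<ge>n1. d i m k < e" using dc[OF \<open>e > 0\<close>] by blast
      obtain n2 where n2: "\<forall>m\<ge>n2. \<forall>k\<ge>n2. d j m k < e" using dc[OF \<open>e > 0\<close>] by blast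
      have "L2_norm (\<lambda>x. partial_deriv j (G m i) x - partial_deriv j (G k i) x) < e" if "m \<ge> n1 + n2" "k \<ge> n1 + n2" for m k
      proof (rule power2_less_imp_less)
        have "d i m k < e" "d j m k < e" using n1 n2 that by auto
        then have "d i m k * d j m k < e * e"
          using \<open>e > 0\<close> by (intro mult_strict_mono) (auto simp: d_def)
        with le[of m k] show "(L2_norm (\<lambda>x. partial_deriv j (G m i) x - partial_deriv j (G k i) x))\<^sup>2 < e\<^sup>2"
          by (simp add: power2_eq_square)
      qed (use \<open>e > 0\<close> in simp)
      then show ?thesis by blast
    qed
    from L2_complete[of "\<lambda>N. partial_deriv j (G N i)", OF L2G this] show ?thesis by blast
  qed
  define h where "h i j = (SOME h. h \<in> L2_cube \<and> L2_tendsto (\<lambda>N. partial_deriv j (G N i)) h)" for i j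
  have h: "h i j \<in> L2_cube" "L2_tendsto (\<lambda>N. partial_deriv j (G N i)) (h i j)" for i j
    using someI_ex[OF conv[of j i]] unfolding h_def by auto
  have hw: "L2_tendsto (\<lambda>N. wderiv j (G N i)) (h i j)" for i j
    by (rule L2_tendsto_cong[OF h(2) L2G h(1)]) (auto intro: wderiv_smooth sG H1D H1_smooth h)
  have GL: "L2_tendsto (\<lambda>N. G N i) (wderiv i \<phi>)" for i
    unfolding G by (rule L2_tendsto_fsum[OF H1D(2)[OF \<phi>1]])
  note lim = H1_limit[OF H1_smooth[OF sG] H1D(2)[OF \<phi>1] GL h(1) hw]
  show "wgrad \<phi> \<in> H1_t"
    by (rule H1_t_limit[OF \<Gamma>]) (use d1 lim(3) in \<open>simp_all add: wgrad_def \<Gamma>_def\<close>)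
  have hs: "AE x in lebesgue_on cube. h i j x = h j i x" for i j
    by (rule L2_tendsto_unique[OF h(2) _ L2G h(1) h(1)]) (use h(2)[of i j] in \<open>simp add: sym[of i _ j]\<close>)
  have wh: "whess \<phi> x $ i $ j = wderiv j (wderiv i \<phi>) x" for i j x
    by (simp add: whess_def wjac_nth wgrad_def)
  show "AE x in lebesgue_on cube. transpose (whess \<phi> x) = whess \<phi> x"
  proof (rule AE_matrix_eqI)
    fix i j
    show "AE x in lebesgue_on cube. transpose (whess \<phi> x) $ i $ j = whess \<phi> x $ i $ j"
      using hs[of i j] lim(2)[of i j] lim(2)[of j i]
      by eventually_elim (simp add: transpose_def wh)
  qed
qed

section \<open>Representation of functionals\<close>

text \<open>A complete space of functions in which functions that agree almost everywhere are not
  identified. Therefore \<open>B\<close> is only semidefinite, limits are not unique, and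
  completeness merely provides some limit.\<close>

locale form_space =
  fixes V :: "('a \<Rightarrow> 'b::real_vector) set" and B :: "('a \<Rightarrow> 'b) \<Rightarrow> ('a \<Rightarrow> 'b) \<Rightarrow> real"
  assumes V_zero: "(\<lambda>x. 0) \<in> V"
    and V_add: "u \<in> V \<Longrightarrow> v \<in> V \<Longrightarrow> (\<lambda>x. u x + v x) \<in> V"
    and V_scale: "u \<in> V \<Longrightarrow> (\<lambda>x. c *\<^sub>R u x) \<in> V"
    and B_add: "u \<in> V \<Longrightarrow> v \<in> V \<Longrightarrow> w \<in> V \<Longrightarrow> B (\<lambda>x. u x + v x) w = B u w + B v w"
    and B_scale: "u \<in> V \<Longrightarrow> w \<in> V \<Longrightarrow> B (\<lambda>x. c *\<^sub>R u x) w = c * B u w"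
    and B_sym: "B u w = B w u"
    and B_nonneg: "0 \<le> B u u"
    and complete: "(\<And>m. s m \<in> V) \<Longrightarrow>
      (\<And>e. e > 0 \<Longrightarrow> \<exists>N. \<forall>m\<ge>N. \<forall>k\<ge>N. sqrt (B (\<lambda>x. s m x - s k x) (\<lambda>x. s m x - s k x)) < e) \<Longrightarrow>
      \<exists>v\<in>V. (\<lambda>m. sqrt (B (\<lambda>x. s m x - v x) (\<lambda>x. s m x - v x))) \<longlonglongrightarrow> 0"
begin

definition N :: "('a \<Rightarrow> 'b) \<Rightarrow> real" where "N u = sqrt (B u u)"

lemma N_nonneg: "0 \<le> N u"
  by (simp add: N_def B_nonneg)

lemma N_power2: "(N u)\<^sup>2 = B u u"
  by (simp add: N_def B_nonneg)

lemma V_diff: "u \<in> V \<Longrightarrow> v \<in> V \<Longrightarrow> (\<lambda>x. u x - v x) \<in> V"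
  using V_add[OF _ V_scale[of v "-1"], of u] by simp

lemma B_diff: "u \<in> V \<Longrightarrow> v \<in> V \<Longrightarrow> w \<in> V \<Longrightarrow> B (\<lambda>x. u x - v x) w = B u w - B v w"
  using B_add[OF _ V_scale[of v "-1"], of u w] B_scale[of v w "-1"] by simp

lemma N_add_scale_power2:
  assumes "u \<in> V" "v \<in> V"
  shows "(N (\<lambda>x. u x + t *\<^sub>R v x))\<^sup>2 = B u u + 2 * t * B u v + t\<^sup>2 * B v v"
proof -
  note sv = V_scale[OF assms(2), of t]
  have "B (\<lambda>x. u x + t *\<^sub>R v x) (\<lambda>x. u x + t *\<^sub>R v x)
      = B u (\<lambda>x. u x + t *\<^sub>R v x) + t * B v (\<lambda>x. u x + t *\<^sub>R v x)"
    using B_add[OF assms(1) sv V_add[OF assms(1) sv]] B_scale[OF assms(2) V_add[OF assms(1) sv]] by simp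
  also have "B u (\<lambda>x. u x + t *\<^sub>R v x) = B u u + t * B v u"
    using B_add[OF assms(1) sv assms(1)] B_scale[OF assms(2,1)] by (simp add: B_sym[of u "\<lambda>x. u x + t *\<^sub>R v x"])
  also have "B v (\<lambda>x. u x + t *\<^sub>R v x) = B u v + t * B v v"
    using B_add[OF assms(1) sv assms(2)] B_scale[OF assms(2,2)] by (simp add: B_sym[of v "\<lambda>x. u x + t *\<^sub>R v x"])
  finally show ?thesis
    unfolding N_power2 by (simp add: B_sym[of v u] algebra_simps power2_eq_square)
qed

lemma Cauchy_Schwarz: "u \<in> V \<Longrightarrow> v \<in> V \<Longrightarrow> \<bar>B u v\<bar> \<le> N u * N v"
  unfolding N_def by (rule quadratic_discriminant)
    (use N_add_scale_power2 in \<open>auto simp: B_nonneg simp flip: N_add_scale_power2\<close>)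

lemma N_triangle:
  assumes "u \<in> V" "v \<in> V"
  shows "N (\<lambda>x. u x + v x) \<le> N u + N v"
proof (rule power2_le_imp_le)
  show "(N (\<lambda>x. u x + v x))\<^sup>2 \<le> (N u + N v)\<^sup>2"
    using N_add_scale_power2[OF assms, of 1] Cauchy_Schwarz[OF assms]
    by (simp add: power2_sum N_power2)
qed (simp add: N_nonneg)

lemma N_diff_commute:
  assumes "u \<in> V" "v \<in> V"
  shows "N (\<lambda>x. u x - v x) = N (\<lambda>x. v x - u x)"
proof -
  have "B (\<lambda>x. v x - u x) (\<lambda>x. v x - u x) = (N (\<lambda>x. 0 + (-1) *\<^sub>R (u x - v x)))\<^sup>2"
    by (simp add: N_power2)
  also have "\<dots> = B (\<lambda>x. u x - v x) (\<lambda>x. u x - v x)"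
    using N_add_scale_power2[OF V_zero V_diff[OF assms], of "-1"] B_scale[OF V_zero V_zero, of 0]
      B_scale[OF V_zero V_diff[OF assms], of 0] by simp
  finally show ?thesis by (simp add: N_def)
qed

lemma tendsto_B:
  assumes "\<And>m. s m \<in> V" "v \<in> V" "w \<in> V" "(\<lambda>m. N (\<lambda>x. s m x - v x)) \<longlonglongrightarrow> 0"
  shows "(\<lambda>m. B (s m) w) \<longlonglongrightarrow> B v w"
proof (rule Lim_null[THEN iffD2], rule Lim_null_comparison)
  show "\<forall>\<^sub>F m in sequentially. norm (B (s m) w - B v w) \<le> N (\<lambda>x. s m x - v x) * N w"
    using Cauchy_Schwarz[OF V_diff[OF assms(1,2)] assms(3)] assms by (simp add: B_diff)
  show "(\<lambda>m. N (\<lambda>x. s m x - v x) * N w) \<longlonglongrightarrow> 0"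
    by (rule tendsto_mult_left_zero[OF assms(4)])
qed

text \<open>Minimisation of the energy \<open>J\<close>, which is bounded below by
  \<open>- C\<^sup>2\<close>. A minimising sequence is Cauchy by the parallelogram argument, and its
  limit satisfies the Euler equation.\<close>

lemma Riesz:
  assumes l_add: "\<And>u v. u \<in> V \<Longrightarrow> v \<in> V \<Longrightarrow> l (\<lambda>x. u x + v x) = l u + l v"
    and l_scale: "\<And>c u. u \<in> V \<Longrightarrow> l (\<lambda>x. c *\<^sub>R u x) = c * l u"
    and l_bound: "\<And>u. u \<in> V \<Longrightarrow> \<bar>l u\<bar> \<le> C * N u"
  obtains u where "u \<in> V" "\<And>w. w \<in> V \<Longrightarrow> B u w = l w"
proof -
  define J where "J w = (N w)\<^sup>2 - 2 * l w" for w
  define m where "m = Inf (J ` V)"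
  have J_ge: "- C\<^sup>2 \<le> J w" if "w \<in> V" for w
  proof -
    have "l w \<le> C * N w" using l_bound[OF that] by linarith
    moreover have "0 \<le> (N w - C)\<^sup>2" by simp
    ultimately show ?thesis unfolding J_def power2_diff by (simp add: mult.commute)
  qed
  then have bdd: "bdd_below (J ` V)" by (auto intro!: bdd_belowI)
  have m_le: "m \<le> J w" if "w \<in> V" for w
    unfolding m_def using that by (intro cInf_lower bdd) auto
  have "\<exists>w\<in>V. J w < m + inverse (real (Suc k))" for k
    using cInf_lessD[of "J ` V" "m + inverse (real (Suc k))"] V_zero by (auto simp: m_def)
  then obtain s where s: "\<And>k. s k \<in> V" "\<And>k. J (s k) < m + inverse (real (Suc k))" by metis
  have J_line: "J (\<lambda>x. u x + t *\<^sub>R w x) = J u + 2 * t * (B u w - l w) + t\<^sup>2 * B w w"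
    if "u \<in> V" "w \<in> V" for u w t
    unfolding J_def N_add_scale_power2[OF that] N_power2 l_add[OF that(1) V_scale[OF that(2)]] l_scale[OF that(2)]
    by (simp add: algebra_simps)
  have para: "(N (\<lambda>x. s k x - s n x))\<^sup>2 \<le> 2 * inverse (real (Suc k)) + 2 * inverse (real (Suc n))" for k n
  proof -
    define d where "d = (\<lambda>x. s k x - s n x)"
    have d: "d \<in> V" unfolding d_def by (rule V_diff[OF s(1) s(1)])
    have "(\<lambda>x. s n x + 1 *\<^sub>R d x) = s k" by (simp add: d_def)
    then have "J (s k) = J (s n) + 2 * (B (s n) d - l d) + B d d"
      using J_line[OF s(1) d, of n 1] by simp
    \<comment> \<open>The value t = 1/2 is the midpoint of \<open>s n\<close> and
      \<open>s k\<close>, where the energy is at least its infimum.\<close>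
    moreover have "m \<le> J (s n) + 2 * (1/2) * (B (s n) d - l d) + (1/2)\<^sup>2 * B d d"
      using m_le[OF V_add[OF s(1) V_scale[OF d]], of n "1/2"] unfolding J_line[OF s(1) d] .
    ultimately show ?thesis
      using s(2)[of k] s(2)[of n] unfolding d_def[symmetric] N_power2 by (simp add: power2_eq_square)
  qed
  have "\<exists>n. \<forall>k\<ge>n. \<forall>j\<ge>n. sqrt (B (\<lambda>x. s k x - s j x) (\<lambda>x. s k x - s j x)) < e" if "e > 0" for e
  proof -
    have "0 < e\<^sup>2 / 4" using that by simp
    from reals_Archimedean[OF this] obtain n where n: "inverse (real (Suc n)) < e\<^sup>2 / 4" by blast
    have "N (\<lambda>x. s k x - s j x) < e" if "k \<ge> n" "j \<ge> n" for k j
    proof (rule power2_less_imp_less)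
      have "inverse (real (Suc k)) \<le> inverse (real (Suc n))" "inverse (real (Suc j)) \<le> inverse (real (Suc n))"
        using that by (auto intro!: le_imp_inverse_le)
      with para[of k j] n show "(N (\<lambda>x. s k x - s j x))\<^sup>2 < e\<^sup>2" by linarith
    qed (use \<open>e > 0\<close> in simp)
    then show ?thesis unfolding N_def by blast
  qed
  from complete[of s, OF s(1) this] obtain u where
    u: "u \<in> V" "(\<lambda>k. N (\<lambda>x. s k x - u x)) \<longlonglongrightarrow> 0" unfolding N_def by blast
  have "B u w = l w" if w: "w \<in> V" for w
  proof -
    \<comment> \<open>Along the line through \<open>s k\<close> in direction \<open>w\<close> the
      energy stays above the infimum, hence above its value at \<open>s k\<close> minus 1/(k+1). The
      discriminant of this quadratic in \<open>t\<close> bounds the defect in the Euler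
      equation.\<close>
    have le: "\<bar>B (s k) w - l w\<bar> \<le> sqrt (inverse (real (Suc k))) * sqrt (B w w)" for k
    proof (rule quadratic_discriminant)
      fix t
      show "0 \<le> inverse (real (Suc k)) + 2 * t * (B (s k) w - l w) + t\<^sup>2 * B w w"
        using m_le[OF V_add[OF s(1) V_scale[OF w]], of k t] s(2)[of k] unfolding J_line[OF s(1) w] by linarith
    qed (auto simp: B_nonneg)
    have "(\<lambda>k. sqrt (inverse (real (Suc k))) * sqrt (B w w)) \<longlonglongrightarrow> sqrt 0 * sqrt (B w w)"
      by (intro tendsto_mult tendsto_real_sqrt tendsto_const LIMSEQ_inverse_real_of_nat)
    then have lim: "(\<lambda>k. sqrt (inverse (real (Suc k))) * sqrt (B w w)) \<longlonglongrightarrow> 0" by simp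
    have "(\<lambda>k. B (s k) w - l w) \<longlonglongrightarrow> 0"
      by (rule Lim_null_comparison[OF always_eventually lim]) (use le in simp)
    then have "(\<lambda>k. B (s k) w) \<longlonglongrightarrow> l w" by (rule LIM_zero_cancel)
    with tendsto_B[OF s(1) u(1) w u(2)] show ?thesis by (rule LIMSEQ_unique)
  qed
  with u(1) that show ?thesis by blast
qed

text \<open>Banach's fixed point iteration for the map \<open>S\<close> that sends \<open>r\<close>
  to a representative of the functional \<open>l + K r\<close>. Contraction only has to be checked
  on successive iterates, so \<open>S\<close> may be an arbitrary choice among the
  representatives.\<close>

lemma perturbed_Riesz:
  assumes l_add: "\<And>u v. u \<in> V \<Longrightarrow> v \<in> V \<Longrightarrow> l (\<lambda>x. u x + v x) = l u + l v"
    and l_scale: "\<And>c u. u \<in> V \<Longrightarrow> l (\<lambda>x. c *\<^sub>R u x) = c * l u"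
    and l_bound: "\<And>u. u \<in> V \<Longrightarrow> \<bar>l u\<bar> \<le> C * N u"
    and K_add: "\<And>r u v. r \<in> V \<Longrightarrow> u \<in> V \<Longrightarrow> v \<in> V \<Longrightarrow> K r (\<lambda>x. u x + v x) = K r u + K r v"
    and K_scale: "\<And>r c u. r \<in> V \<Longrightarrow> u \<in> V \<Longrightarrow> K r (\<lambda>x. c *\<^sub>R u x) = c * K r u"
    and K_diff: "\<And>r s u. r \<in> V \<Longrightarrow> s \<in> V \<Longrightarrow> u \<in> V \<Longrightarrow> K (\<lambda>x. r x - s x) u = K r u - K s u"
    and K_bound: "\<And>r u. r \<in> V \<Longrightarrow> u \<in> V \<Longrightarrow> \<bar>K r u\<bar> \<le> q * N r * N u"
    and q: "0 \<le> q" "q < 1"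
  obtains u where "u \<in> V" "\<And>w. w \<in> V \<Longrightarrow> B u w = l w + K u w"
proof -
  have "\<exists>u\<in>V. \<forall>w\<in>V. B u w = l w + K r w" if r: "r \<in> V" for r
  proof -
    have "\<bar>l u + K r u\<bar> \<le> (C + q * N r) * N u" if "u \<in> V" for u
      using l_bound[OF that] K_bound[OF r that] by (simp add: algebra_simps)
    then obtain u where "u \<in> V" "\<And>w. w \<in> V \<Longrightarrow> B u w = l w + K r w"
      by (rule Riesz[of "\<lambda>w. l w + K r w" "C + q * N r", rotated 2])
        (simp_all add: l_add l_scale K_add[OF r] K_scale[OF r] algebra_simps)
    then show ?thesis by blast
  qed
  then obtain S where S: "\<And>r. r \<in> V \<Longrightarrow> S r \<in> V" "\<And>r w. r \<in> V \<Longrightarrow> w \<in> V \<Longrightarrow> B (S r) w = l w + K r w"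
    by metis
  define s where "s k = (S ^^ k) (\<lambda>x. 0)" for k
  have s: "s k \<in> V" for k
    by (induction k) (auto simp: s_def V_zero S)
  have sS: "B (s (Suc k)) w = l w + K (s k) w" if "w \<in> V" for k w
    using S(2)[OF s that, of k] by (simp add: s_def)
  define d where "d k = N (\<lambda>x. s (Suc k) x - s k x)" for k
  have d0: "0 \<le> d k" for k by (simp add: d_def N_nonneg)
  have dS: "d (Suc k) \<le> q * d k" for k
  proof -
    \<comment> \<open>The difference of two consecutive equations is tested with the increment
      \<delta> itself; one factor of its norm then cancels.\<close>
    define \<delta> where "\<delta> = (\<lambda>x. s (Suc (Suc k)) x - s (Suc k) x)"
    have \<delta>: "\<delta> \<in> V" unfolding \<delta>_def by (rule V_diff[OF s s])
    have "d (Suc k) * d (Suc k) = B \<delta> \<delta>"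
      using N_power2[of \<delta>] by (simp add: d_def \<delta>_def power2_eq_square)
    also have "\<dots> = B (s (Suc (Suc k))) \<delta> - B (s (Suc k)) \<delta>"
      using B_diff[OF s s \<delta>, of "Suc (Suc k)" "Suc k"] by (simp add: \<delta>_def)
    also have "\<dots> = K (\<lambda>x. s (Suc k) x - s k x) \<delta>"
      unfolding sS[OF \<delta>] K_diff[OF s s \<delta>] by simp
    also have "\<dots> \<le> q * d k * d (Suc k)"
      using K_bound[OF V_diff[OF s s] \<delta>, of "Suc k" k] by (simp add: d_def \<delta>_def)
    finally show ?thesis
      using d0[of "Suc k"] d0[of k] q by (cases "d (Suc k) = 0") (auto simp: mult_le_cancel_right)
  qed
  have dk: "d k \<le> q ^ k * d 0" for k
  proof (induction k)
    case (Suc k)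
    have "d (Suc k) \<le> q * d k" by (rule dS)
    also have "\<dots> \<le> q * (q ^ k * d 0)" using Suc q by (intro mult_left_mono) auto
    finally show ?case by simp
  qed simp
  \<comment> \<open>Telescoping bounds the distance by a geometric series.\<close>
  have tail: "N (\<lambda>x. s (n + p) x - s n x) \<le> q ^ n * (d 0 / (1 - q))" for n p
  proof -
    have "N (\<lambda>x. s (n + p) x - s n x) \<le> q ^ n * d 0 * (\<Sum>i<p. q ^ i)"
    proof (induction p)
      case 0
      have "B (\<lambda>x. 0) (\<lambda>x. 0) = 0" using B_scale[OF V_zero V_zero, of 0] by simp
      then show ?case by (simp add: N_def)
    next
      case (Suc p)
      have "N (\<lambda>x. s (n + Suc p) x - s n x)
          = N (\<lambda>x. (s (Suc (n + p)) x - s (n + p) x) + (s (n + p) x - s n x))" by simp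
      also have "\<dots> \<le> d (n + p) + N (\<lambda>x. s (n + p) x - s n x)"
        unfolding d_def by (rule N_triangle[OF V_diff[OF s s] V_diff[OF s s]])
      also have "\<dots> \<le> q ^ (n + p) * d 0 + q ^ n * d 0 * (\<Sum>i<p. q ^ i)"
        using dk Suc by (rule add_mono)
      finally show ?case by (simp add: algebra_simps power_add)
    qed
    also have "(\<Sum>i<p. q ^ i) \<le> 1 / (1 - q)"
      using q by (simp add: sum_gp_strict divide_right_mono)
    then have "q ^ n * d 0 * (\<Sum>i<p. q ^ i) \<le> q ^ n * d 0 * (1 / (1 - q))"
      using q d0 by (intro mult_left_mono) auto
    finally show ?thesis by simp
  qed
  have "\<exists>n. \<forall>k\<ge>n. \<forall>j\<ge>n. sqrt (B (\<lambda>x. s k x - s j x) (\<lambda>x. s k x - s j x)) < e" if "e > 0" for e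
  proof -
    have "(\<lambda>n. q ^ n * (d 0 / (1 - q))) \<longlonglongrightarrow> 0"
      using q by (intro tendsto_mult_left_zero LIMSEQ_realpow_zero)
    then have "\<forall>\<^sub>F n in sequentially. q ^ n * (d 0 / (1 - q)) < e"
      by (rule order_tendstoD) (rule that)
    then obtain n where n: "\<And>k. k \<ge> n \<Longrightarrow> q ^ k * (d 0 / (1 - q)) < e"
      by (auto simp: eventually_sequentially)
    have *: "N (\<lambda>x. s k x - s j x) < e" if "j \<ge> n" "k \<ge> j" for k j
      using tail[of j "k - j"] n[OF that(1)] that(2) by simp
    have "N (\<lambda>x. s k x - s j x) < e" if "k \<ge> n" "j \<ge> n" for k j
      using *[of j k] *[of k j] that N_diff_commute[OF s s, of k j] by (cases "k \<ge> j") auto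
    then show ?thesis unfolding N_def by blast
  qed
  from complete[of s, OF s this] obtain u where
    u: "u \<in> V" "(\<lambda>k. N (\<lambda>x. s k x - u x)) \<longlonglongrightarrow> 0" unfolding N_def by blast
  have "B u w = l w + K u w" if w: "w \<in> V" for w
  proof -
    have "(\<lambda>k. B (s (Suc k)) w) \<longlonglongrightarrow> B u w"
      by (rule LIMSEQ_Suc[OF tendsto_B[OF s u(1) w u(2)]])
    moreover have "(\<lambda>k. K (s k) w - K u w) \<longlonglongrightarrow> 0"
    proof (rule Lim_null_comparison)
      show "\<forall>\<^sub>F k in sequentially. norm (K (s k) w - K u w) \<le> q * N w * N (\<lambda>x. s k x - u x)"
        using K_bound[OF V_diff[OF s u(1)] w] K_diff[OF s u(1) w] by (simp add: mult_ac)
      show "(\<lambda>k. q * N w * N (\<lambda>x. s k x - u x)) \<longlonglongrightarrow> 0"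
        by (rule tendsto_mult_right_zero[OF u(2)])
    qed
    then have "(\<lambda>k. l w + K (s k) w) \<longlonglongrightarrow> l w + K u w"
      by (rule tendsto_add[OF tendsto_const LIM_zero_cancel])
    ultimately show ?thesis
      unfolding sS[OF w] by (rule LIMSEQ_unique)
  qed
  with u(1) that show ?thesis by blast
qed

end

section \<open>The Cordes condition\<close>

text \<open>The function \<open>wderiv i \<phi>\<close> is merely a representative of the classical
  derivative, so its regularity and its own derivatives are transported by
  \<open>H1_cong\<close>.\<close>

lemma H2_smooth:
  fixes \<phi> :: "real^'n \<Rightarrow> real"
  assumes "smooth \<phi>"
  shows "\<phi> \<in> H2" "AE x in lebesgue_on cube. whess \<phi> x $ i $ j = partial_deriv j (partial_deriv i \<phi>) x"
proof -
  have m: "wderiv i \<phi> \<in> borel_measurable (lebesgue_on cube)" for i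
    by (rule L2D(1)[OF H1D(2)[OF H1_smooth[OF assms]]])
  note c = H1_cong[OF H1_smooth[OF smooth_partial_deriv[OF assms]] m wderiv_smooth[OF assms]]
  show "\<phi> \<in> H2"
    using H1_smooth[OF assms] c(1) by (simp add: H2_def)
  show "AE x in lebesgue_on cube. whess \<phi> x $ i $ j = partial_deriv j (partial_deriv i \<phi>) x"
    using c(2)[of j i] wderiv_smooth[OF smooth_partial_deriv[OF assms], of j i]
    by eventually_elim (simp add: whess_def wjac_nth wgrad_def)
qed

text \<open>The solution of the Dirichlet problem for the negative Laplacian with the sine sum of
  \<open>v\<close> as right-hand side. The denominator is zero only for the zero frequency, whose
  mode vanishes.\<close>

definition sine_inv_laplace :: "nat \<Rightarrow> (real^'n \<Rightarrow> real) \<Rightarrow> real^'n \<Rightarrow> real" where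
  "sine_inv_laplace N v = trig_sum {} N (\<lambda>k. fcoef {} k v / (\<Sum>i\<in>UNIV. (real (k i) * pi)\<^sup>2))"

lemma sine_inv_laplace_in: "sine_inv_laplace N v \<in> H2 \<inter> H10"
  unfolding sine_inv_laplace_def using H2_smooth(1)[OF smooth_trig_sum] trig_sum_in_H10 by blast

lemma trace_whess_sine_inv_laplace:
  fixes v :: "real^'n \<Rightarrow> real"
  shows "AE x in lebesgue_on cube. trace (whess (sine_inv_laplace N v) x) = - fsum {} N v x"
proof -
  let ?\<phi> = "sine_inv_laplace N v"
  let ?q = "\<lambda>k :: 'n \<Rightarrow> nat. \<Sum>i\<in>UNIV. (real (k i) * pi)\<^sup>2"
  let ?c = "\<lambda>k. fcoef {} k v"
  have flip0: "flip i {i} = {}" "flip i {} = {i}" for i :: 'n by (auto simp: flip_def)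
  have pd: "partial_deriv i (partial_deriv i ?\<phi>) x
      = (\<Sum>k\<in>freqs N. - ((real (k i) * pi)\<^sup>2 * (?c k / ?q k * trig {} k x)))" for i x
    unfolding sine_inv_laplace_def partial_deriv_trig_sum flip0 trig_sum_def
    by (intro sum.cong refl) (simp add: tsign_def power2_eq_square)
  have cancel: "?q k * (?c k / ?q k * trig {} k x) = ?c k * trig {} k x" for k x
  proof (cases "?q k = 0")
    case True
    then have "real (k i) * pi = 0" for i
      using sum_nonneg_eq_0_iff[of UNIV "\<lambda>i. (real (k i) * pi)\<^sup>2"] by simp
    \<comment> \<open>Here \<open>undefined\<close> is an arbitrary direction: all frequencies are
      zero, so the sine factor in any direction vanishes.\<close>
    then have "trig {} k x = 0"
      unfolding trig_remove[of "{}" k x undefined] by (simp add: trig_factor_def)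
    then show ?thesis by simp
  qed simp
  have "(\<Sum>i\<in>UNIV. partial_deriv i (partial_deriv i ?\<phi>) x) = - fsum {} N v x" for x
  proof -
    have "(\<Sum>i\<in>UNIV. partial_deriv i (partial_deriv i ?\<phi>) x)
        = (\<Sum>k\<in>freqs N. - (?q k * (?c k / ?q k * trig {} k x)))"
      unfolding pd by (subst sum.swap) (simp only: sum_negf sum_distrib_right)
    then show ?thesis
      unfolding cancel fsum_def trig_sum_def by (simp add: sum_negf)
  qed
  moreover have "AE x in lebesgue_on cube. \<forall>i\<in>UNIV. whess ?\<phi> x $ i $ i = partial_deriv i (partial_deriv i ?\<phi>) x"
    by (intro AE_finite_allI H2_smooth(2)) (simp_all add: sine_inv_laplace_def smooth_trig_sum)
  ultimately show ?thesis
    by (auto simp: trace_def elim!: eventually_mono)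
qed

lemma trace_eq_inner: "trace (M :: real^'n^'n) = M \<bullet> mat 1"
  by (simp add: trace_def matrix_inner mat_def if_distrib cong: if_cong)

lemma norm_mat_1_power2: "(norm (mat 1 :: real^'n^'n))\<^sup>2 = real CARD('n)"
  using trace_eq_inner[of "mat 1 :: real^'n^'n"] by (simp add: power2_norm_eq_inner trace_def mat_def)

lemma Linf_bound:
  assumes "v \<in> Linf"
  obtains C where "AE x in lebesgue_on cube. norm (v x) \<le> C"
proof -
  define L where "L = Linf_norm v"
  have "AE x in lebesgue_on cube. ereal (norm (v x)) \<le> L"
    unfolding L_def Linf_norm_def by (rule esssup_AE)
  moreover have "r \<le> real_of_ereal L" if "ereal r \<le> L" for r
    using that assms by (cases L) (auto simp: Linf_def L_def[symmetric])
  ultimately have "AE x in lebesgue_on cube. norm (v x) \<le> real_of_ereal L"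
    by (auto elim: eventually_mono)
  with that show ?thesis .
qed

lemma inner_sum_le:
  fixes a c :: "'a::real_inner" and b d :: "'b::real_inner"
  shows "(a \<bullet> c + b \<bullet> d)\<^sup>2 \<le> ((norm a)\<^sup>2 + (norm b)\<^sup>2) * ((norm c)\<^sup>2 + (norm d)\<^sup>2)"
  using Cauchy_Schwarz_ineq[of "(a, b)" "(c, d)"] by (simp add: inner_prod_def power2_norm_eq_inner)

locale cordes = rot_operator R
  for R :: "real^'n^'n \<Rightarrow> 'r::euclidean_space" +
  fixes A :: "real^'n \<Rightarrow> real^'n^'n" and b :: "real^'n \<Rightarrow> real^'n"
    and f :: "real^'n \<Rightarrow> real" and F :: "real^'n \<Rightarrow> real^'n" and \<delta> :: real
  assumes A_Linf: "A \<in> Linf" and elliptic: "uniformly_elliptic A" and b_Linf: "b \<in> Linf"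
    and f_L2: "f \<in> L2_cube" and F_H1: "F \<in> H1_vec"
    and f_eq: "AE x in lebesgue_on cube. f x = - wdiv F x"
    and \<delta>_gt: "delta0 b < \<delta>" and \<delta>_le: "\<delta> \<le> 1"
    and cordes: "AE x in lebesgue_on cube.
      ((norm (A x))\<^sup>2 + (norm (b x))\<^sup>2) / (trace (A x))\<^sup>2 \<le> 1 / (real CARD('n) - 1 + \<delta>)"
begin

abbreviation "Q \<equiv> lebesgue_on (cube :: (real^'n) set)"

text \<open>The renormalization factor \<gamma>.\<close>

definition g :: "real^'n \<Rightarrow> real" where "g = renorm A b"

lemma A_measurable: "A \<in> borel_measurable Q"
  using A_Linf by (simp add: Linf_def)

lemma b_measurable: "b \<in> borel_measurable Q"
  using b_Linf by (simp add: Linf_def)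

lemma trace_measurable: "M \<in> borel_measurable Q \<Longrightarrow> (\<lambda>x. trace (M x :: real^'n^'n)) \<in> borel_measurable Q"
  unfolding trace_eq_inner by simp

lemma g_measurable: "g \<in> borel_measurable Q"
  unfolding g_def renorm_def[abs_def]
  using A_measurable b_measurable trace_measurable[OF A_measurable] by measurable

lemma \<delta>_pos: "0 < \<delta>"
proof -
  have "0 \<le> delta0 b" by (auto simp: delta0_def)
  then show ?thesis using \<delta>_gt by linarith
qed

lemma trace_lower:
  obtains t where "0 < t" "AE x in Q. t \<le> trace (A x)"
proof -
  obtain lo up where lo: "lo > 0" and ell: "AE x in Q. \<forall>\<xi>. lo * (\<xi> \<bullet> \<xi>) \<le> \<xi> \<bullet> (A x *v \<xi>)
      \<and> \<xi> \<bullet> (A x *v \<xi>) \<le> up * (\<xi> \<bullet> \<xi>)"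
    using elliptic unfolding uniformly_elliptic_def by blast
  from ell have "AE x in Q. real CARD('n) * lo \<le> trace (A x)"
  proof (rule eventually_mono)
    fix x assume "\<forall>\<xi>. lo * (\<xi> \<bullet> \<xi>) \<le> \<xi> \<bullet> (A x *v \<xi>) \<and> \<xi> \<bullet> (A x *v \<xi>) \<le> up * (\<xi> \<bullet> \<xi>)"
    then have *: "\<forall>\<xi>. lo * (\<xi> \<bullet> \<xi>) \<le> \<xi> \<bullet> (A x *v \<xi>)" by blast
    have "lo \<le> A x $ i $ i" for i
      using *[rule_format, of "axis i 1"]
      by (simp add: inner_axis inner_axis' matrix_vector_mult_basis column_def)
    then have "(\<Sum>i\<in>(UNIV :: 'n set). lo) \<le> trace (A x)"
      unfolding trace_def by (intro sum_mono)
    then show "real CARD('n) * lo \<le> trace (A x)" by simp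
  qed
  moreover have "0 < real CARD('n) * lo" using lo by simp
  ultimately show ?thesis using that by blast
qed

lemma trace_power2_le: "(trace (M :: real^'n^'n))\<^sup>2 \<le> real CARD('n) * (norm M)\<^sup>2"
  using Cauchy_Schwarz_ineq[of M "mat 1"] norm_mat_1_power2[where 'n = 'n]
  by (simp add: trace_eq_inner power2_norm_eq_inner mult.commute)

text \<open>From below, ellipticity bounds the trace and boundedness of the coefficients bounds the
  denominator. From above, the squared trace is at most n |A|^2, so the factor is at most n divided
  by the trace.\<close>

lemma g_bounds:
  obtains l u where "0 < l" "AE x in Q. l \<le> g x \<and> g x \<le> u"
proof -
  obtain t where t: "0 < t" "AE x in Q. t \<le> trace (A x)" by (rule trace_lower)
  obtain a where a: "AE x in Q. norm (A x) \<le> a" by (rule Linf_bound[OF A_Linf])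
  obtain c where c: "AE x in Q. norm (b x) \<le> c" by (rule Linf_bound[OF b_Linf])
  have "AE x in Q. t / (a\<^sup>2 + c\<^sup>2 + 1) \<le> g x \<and> g x \<le> real CARD('n) / t"
    using t(2) a c
  proof eventually_elim
    case (elim x)
    define S where "S = (norm (A x))\<^sup>2 + (norm (b x))\<^sup>2"
    have tr: "0 < trace (A x)" using t(1) elim by linarith
    have "A x \<noteq> 0" using tr by (auto simp: trace_def)
    then have S: "0 < S" by (simp add: S_def add_pos_nonneg)
    have "(norm (A x))\<^sup>2 \<le> a\<^sup>2" "(norm (b x))\<^sup>2 \<le> c\<^sup>2"
      using elim by (auto intro!: power_mono)
    then have "S \<le> a\<^sup>2 + c\<^sup>2 + 1" unfolding S_def by linarith
    moreover have "0 < a\<^sup>2 + c\<^sup>2 + 1" by (simp add: add_nonneg_pos)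
    ultimately have "t / (a\<^sup>2 + c\<^sup>2 + 1) \<le> trace (A x) / S"
      using t(1) S elim(1) by (intro frac_le) auto
    moreover have "trace (A x) * t \<le> real CARD('n) * S"
    proof -
      have "trace (A x) * t \<le> (trace (A x))\<^sup>2"
        unfolding power2_eq_square using tr elim(1) by (intro mult_left_mono) auto
      also have "\<dots> \<le> real CARD('n) * (norm (A x))\<^sup>2" by (rule trace_power2_le)
      also have "\<dots> \<le> real CARD('n) * S" by (intro mult_left_mono) (auto simp: S_def)
      finally show ?thesis .
    qed
    then have "trace (A x) / S \<le> real CARD('n) / t"
      using t(1) S by (simp add: field_simps)
    ultimately show ?case by (simp add: g_def renorm_def S_def)
  qed
  moreover have "0 < t / (a\<^sup>2 + c\<^sup>2 + 1)"
    using t(1) by (intro divide_pos_pos) (auto simp: add_nonneg_pos)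
  ultimately show ?thesis using that by blast
qed

text \<open>The number \<gamma> minimises s -> |I - s A|^2 + |s b|^2. The minimum is n - tr(A)^2 /
  (|A|^2 + |b|^2), and the Cordes condition bounds exactly this by 1 - \<delta>.\<close>

lemma cordes_pointwise:
  "AE x in Q. (norm (mat 1 - g x *\<^sub>R A x))\<^sup>2 + (norm (g x *\<^sub>R b x))\<^sup>2 \<le> 1 - \<delta>"
proof -
  obtain t where t: "0 < t" "AE x in Q. t \<le> trace (A x)" by (rule trace_lower)
  show ?thesis
    using t(2) cordes
  proof eventually_elim
    case (elim x)
    define S where "S = (norm (A x))\<^sup>2 + (norm (b x))\<^sup>2"
    define n where "n = real CARD('n)"
    have tr: "0 < trace (A x)" using t(1) elim by linarith
    have "A x \<noteq> 0" using tr by (auto simp: trace_def)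
    then have S: "0 < S" by (simp add: S_def add_pos_nonneg)
    have gS: "g x * S = trace (A x)" using S by (simp add: g_def renorm_def flip: S_def)
    have n: "0 < n - 1 + \<delta>" using \<delta>_pos two_le_dim by (simp add: n_def)
    have "S / (trace (A x))\<^sup>2 \<le> 1 / (n - 1 + \<delta>)" using elim(2) by (simp add: S_def n_def)
    then have "(n - 1 + \<delta>) * S \<le> (trace (A x))\<^sup>2" using tr n by (simp add: field_simps)
    also have "\<dots> = (g x * trace (A x)) * S" unfolding gS[symmetric] by (simp add: power2_eq_square mult_ac)
    finally have "n - 1 + \<delta> \<le> g x * trace (A x)" using S by simp
    moreover have "(norm (mat 1 - g x *\<^sub>R A x))\<^sup>2 + (norm (g x *\<^sub>R b x))\<^sup>2
        = n - 2 * g x * trace (A x) + g x * (g x * S)"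
      using norm_mat_1_power2[where 'n = 'n]
      unfolding power2_norm_eq_inner S_def n_def trace_eq_inner
      by (simp add: inner_diff inner_commute algebra_simps)
    moreover have "\<dots> = n - g x * trace (A x)" unfolding gS by simp
    ultimately show ?case by linarith
  qed
qed

text \<open>The deviation of the renormalized operator from the divergence. The matrix field is an
  argument independent of \<open>w\<close>, so that \<open>w\<close> can be exchanged for zero when
  \<open>b\<close> vanishes.\<close>

definition residual :: "(real^'n \<Rightarrow> real^'n^'n) \<Rightarrow> (real^'n \<Rightarrow> real^'n) \<Rightarrow> real^'n \<Rightarrow> real" where
  "residual M w x = trace (M x) - g x * (A x \<bullet> M x + b x \<bullet> w x)"

lemma residual_eq: "residual M w x = (mat 1 - g x *\<^sub>R A x) \<bullet> M x + (- (g x *\<^sub>R b x)) \<bullet> w x"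
  by (simp add: residual_def trace_eq_inner inner_diff inner_commute algebra_simps)

lemma residual_measurable:
  assumes "M \<in> borel_measurable Q" "w \<in> borel_measurable Q"
  shows "residual M w \<in> borel_measurable Q"
  unfolding residual_def[abs_def]
  using assms A_measurable b_measurable g_measurable trace_measurable[OF assms(1)] by measurable

lemma residual_pointwise:
  "AE x in Q. (residual M w x)\<^sup>2 \<le> (1 - \<delta>) * ((norm (M x))\<^sup>2 + (norm (w x))\<^sup>2)"
  using cordes_pointwise
proof eventually_elim
  case (elim x)
  have "(residual M w x)\<^sup>2 \<le> ((norm (mat 1 - g x *\<^sub>R A x))\<^sup>2 + (norm (- (g x *\<^sub>R b x)))\<^sup>2)
      * ((norm (M x))\<^sup>2 + (norm (w x))\<^sup>2)"
    unfolding residual_eq by (rule inner_sum_le)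
  also have "\<dots> \<le> (1 - \<delta>) * ((norm (M x))\<^sup>2 + (norm (w x))\<^sup>2)"
    using elim by (intro mult_right_mono) auto
  finally show ?case .
qed

text \<open>The square of the contraction constant. A nonzero drift costs the factor from the
  Poincare inequality that absorbs the term without derivatives; with zero drift this cost
  disappears and any positive \<delta> suffices.\<close>

definition \<kappa> :: real where
  "\<kappa> = (if Linf_norm b \<noteq> 0 then (1 - \<delta>) * (1 + 1 / pi\<^sup>2) else 1 - \<delta>)"

lemma \<kappa>_nonneg: "0 \<le> \<kappa>"
  using \<delta>_le by (auto simp: \<kappa>_def intro!: mult_nonneg_nonneg add_nonneg_nonneg)

lemma \<kappa>_less_1: "\<kappa> < 1"
proof (cases "Linf_norm b \<noteq> 0")
  case True
  have p: "0 < pi\<^sup>2" by simp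
  have "inverse (1 + pi\<^sup>2) < \<delta>" using \<delta>_gt True by (simp add: delta0_def)
  moreover have "1 - inverse (1 + pi\<^sup>2) = pi\<^sup>2 / (1 + pi\<^sup>2)"
  proof -
    have "1 + pi\<^sup>2 \<noteq> 0" using p by linarith
    then show ?thesis by (simp add: field_simps)
  qed
  ultimately have "1 - \<delta> < pi\<^sup>2 / (1 + pi\<^sup>2)" by linarith
  then have "(1 - \<delta>) * (1 + 1 / pi\<^sup>2) < pi\<^sup>2 / (1 + pi\<^sup>2) * (1 + 1 / pi\<^sup>2)"
    by (intro mult_strict_right_mono) (auto intro: add_pos_nonneg)
  also have "\<dots> = 1"
  proof -
    have "1 + 1 / pi\<^sup>2 = (1 + pi\<^sup>2) / pi\<^sup>2" by (simp add: field_simps)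
    moreover have "1 + pi\<^sup>2 \<noteq> 0" using p by linarith
    ultimately show ?thesis by simp
  qed
  finally show ?thesis using True by (simp add: \<kappa>_def)
next
  case False
  then show ?thesis using \<delta>_pos by (simp add: \<kappa>_def)
qed

lemma residual_L2:
  assumes M: "M \<in> L2_cube" and w: "w \<in> L2_cube"
  shows "residual M w \<in> L2_cube"
    "(L2_norm (residual M w))\<^sup>2 \<le> (1 - \<delta>) * ((L2_norm M)\<^sup>2 + (L2_norm w)\<^sup>2)"
proof -
  note m = residual_measurable[OF L2D(1)[OF M] L2D(1)[OF w]]
  have int: "integrable Q (\<lambda>x. (1 - \<delta>) * ((norm (M x))\<^sup>2 + (norm (w x))\<^sup>2))"
    by (intro integrable_mult_right Bochner_Integration.integrable_add L2D(2) M w)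
  have "integrable Q (\<lambda>x. (residual M w x)\<^sup>2)"
  proof (rule Bochner_Integration.integrable_bound[OF int])
    show "(\<lambda>x. (residual M w x)\<^sup>2) \<in> borel_measurable Q" using m by measurable
    show "AE x in Q. norm ((residual M w x)\<^sup>2) \<le> norm ((1 - \<delta>) * ((norm (M x))\<^sup>2 + (norm (w x))\<^sup>2))"
      using residual_pointwise[of M w] by (auto elim!: eventually_mono)
  qed
  then show r: "residual M w \<in> L2_cube" using m by (simp add: L2_def)
  have "(L2_norm (residual M w))\<^sup>2 = (LINT x|Q. (residual M w x)\<^sup>2)"
    unfolding L2_norm_power2 L2_inner_def by (simp add: power2_eq_square)
  also have "\<dots> \<le> (LINT x|Q. (1 - \<delta>) * ((norm (M x))\<^sup>2 + (norm (w x))\<^sup>2))"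
    by (rule integral_mono_AE[OF \<open>integrable Q (\<lambda>x. (residual M w x)\<^sup>2)\<close> int residual_pointwise])
  also have "\<dots> = (1 - \<delta>) * ((L2_norm M)\<^sup>2 + (L2_norm w)\<^sup>2)"
    using L2D(2)[OF M] L2D(2)[OF w]
    unfolding L2_norm_power2 L2_inner_def by (simp add: power2_norm_eq_inner)
  finally show "(L2_norm (residual M w))\<^sup>2 \<le> (1 - \<delta>) * ((L2_norm M)\<^sup>2 + (L2_norm w)\<^sup>2)" .
qed

lemma residual_bound:
  assumes M: "M \<in> L2_cube" and w: "w \<in> L2_cube" and le: "pi * L2_norm w \<le> L2_norm M"
  shows "L2_norm (residual M w) \<le> sqrt \<kappa> * L2_norm M"
proof (rule power2_le_imp_le)
  have "(L2_norm (residual M w))\<^sup>2 \<le> \<kappa> * (L2_norm M)\<^sup>2"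
  proof (cases "Linf_norm b \<noteq> 0")
    case True
    have "(pi * L2_norm w)\<^sup>2 \<le> (L2_norm M)\<^sup>2" using le by (intro power_mono) auto
    then have "(L2_norm w)\<^sup>2 \<le> (L2_norm M)\<^sup>2 / pi\<^sup>2"
      by (simp add: power_mult_distrib field_simps)
    then have "(1 - \<delta>) * ((L2_norm M)\<^sup>2 + (L2_norm w)\<^sup>2) \<le> (1 - \<delta>) * ((L2_norm M)\<^sup>2 + (L2_norm M)\<^sup>2 / pi\<^sup>2)"
      using \<delta>_le by (intro mult_left_mono add_left_mono) auto
    with residual_L2(2)[OF M w] True show ?thesis
      by (simp add: \<kappa>_def algebra_simps)
  next
    case False
    have "AE x in Q. ereal (norm (b x)) \<le> Linf_norm b"
      unfolding Linf_norm_def by (rule esssup_AE)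
    then have b0: "AE x in Q. b x = 0" using False by (auto elim: eventually_mono)
    \<comment> \<open>The field \<open>w\<close> enters only through its product with
      \<open>b\<close>, so it may be replaced by zero before the general estimate is
      applied.\<close>
    have "L2_norm (residual M w) = L2_norm (residual M (\<lambda>x. 0))"
      by (rule L2_norm_cong)
        (use b0 in \<open>auto simp: residual_def elim: eventually_mono intro!: residual_measurable L2D(1)[OF M] L2D(1)[OF w]\<close>)
    then show ?thesis
      using residual_L2(2)[OF M L2_zero] False by (simp add: \<kappa>_def L2_norm_def[of "\<lambda>x. 0"] L2_inner_def[of "\<lambda>x. 0"])
  qed
  then show "(L2_norm (residual M w))\<^sup>2 \<le> (sqrt \<kappa> * L2_norm M)\<^sup>2"
    using \<kappa>_nonneg by (simp add: power_mult_distrib)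
qed (use \<kappa>_nonneg in simp)

section \<open>The contraction and the problem for the field \<rho>\<close>

definition T :: "(real^'n \<Rightarrow> real^'n) \<Rightarrow> real^'n \<Rightarrow> real" where
  "T w = residual (wjac w) w"

lemma L2_T: "w \<in> H1_t \<Longrightarrow> T w \<in> L2_cube"
  unfolding T_def by (intro residual_L2(1) L2_wjac L2_H1_vec H1_t_H1_vec)

lemma T_bound: "w \<in> H1_t \<Longrightarrow> L2_norm (T w) \<le> sqrt \<kappa> * L2_norm (wjac w)"
  unfolding T_def by (intro residual_bound L2_wjac L2_H1_vec H1_t_H1_vec H1_t_Poincare_vec two_le_dim)

lemma renorm_L_tilde: "renorm A b x * L_tilde A b w x = T w x - wdiv w x"
  by (simp add: T_def residual_def L_tilde_def wdiv_eq_trace g_def algebra_simps)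

lemma renorm_L_op: "renorm A b x * L_op A b \<phi> x = T (wgrad \<phi>) x - wdiv (wgrad \<phi>) x"
  unfolding renorm_L_tilde[symmetric] by (simp add: L_op_def L_tilde_def whess_def)

definition B :: "(real^'n \<Rightarrow> real^'n) \<Rightarrow> (real^'n \<Rightarrow> real^'n) \<Rightarrow> real" where
  "B u w = L2_inner (wjac u) (wjac w)"

lemma L2_inner_cong_left:
  assumes "AE x in Q. M x = M' x" "M \<in> L2_cube" "M' \<in> L2_cube" "w \<in> L2_cube"
  shows "L2_inner M w = L2_inner M' w"
  by (rule L2_inner_cong[OF assms(1)]) (use assms in \<open>auto intro: L2D(1)\<close>)

sublocale form_space H1_t B
proof
  show "(\<lambda>x. 0) \<in> (H1_t :: (real^'n \<Rightarrow> real^'n) set)" by (rule H1_t_zero)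
  show "(\<lambda>x. u x + v x) \<in> H1_t" if "u \<in> H1_t" "v \<in> H1_t" for u v :: "real^'n \<Rightarrow> real^'n"
    by (rule H1_t_add[OF that])
  show "(\<lambda>x. c *\<^sub>R u x) \<in> H1_t" if "u \<in> H1_t" for u :: "real^'n \<Rightarrow> real^'n" and c
    by (rule H1_t_scale[OF that])
  show "B u w = B w u" for u w by (simp add: B_def L2_inner_commute)
  show "0 \<le> B u u" for u by (simp add: B_def)
  show "B (\<lambda>x. u x + v x) w = B u w + B v w" if "u \<in> H1_t" "v \<in> H1_t" "w \<in> H1_t" for u v w
  proof -
    note h = that[THEN H1_t_H1_vec]
    have "B (\<lambda>x. u x + v x) w = L2_inner (\<lambda>x. wjac u x + wjac v x) (wjac w)"
      unfolding B_def by (rule L2_inner_cong_left[OF wjac_add[OF h(1,2)]]) (intro L2_wjac H1_vec_add L2_add h)+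
    then show ?thesis
      unfolding B_def by (simp add: L2_inner_add_left L2_wjac h)
  qed
  show "B (\<lambda>x. c *\<^sub>R u x) w = c * B u w" if "u \<in> H1_t" "w \<in> H1_t" for u w c
  proof -
    note h = that[THEN H1_t_H1_vec]
    have "B (\<lambda>x. c *\<^sub>R u x) w = L2_inner (\<lambda>x. c *\<^sub>R wjac u x) (wjac w)"
      unfolding B_def by (rule L2_inner_cong_left[OF wjac_scale[OF h(1)]]) (intro L2_wjac H1_vec_scale L2_scale h)+
    then show ?thesis
      unfolding B_def by (simp add: L2_inner_scale_left)
  qed
  fix s :: "nat \<Rightarrow> real^'n \<Rightarrow> real^'n"
  assume "\<And>m. s m \<in> H1_t"
    and "\<And>e. e > 0 \<Longrightarrow> \<exists>N. \<forall>m\<ge>N. \<forall>k\<ge>N. sqrt (B (\<lambda>x. s m x - s k x) (\<lambda>x. s m x - s k x)) < e"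
  from H1_t_complete[OF two_le_dim this[unfolded B_def L2_norm_def[symmetric]]]
  show "\<exists>v\<in>H1_t. (\<lambda>m. sqrt (B (\<lambda>x. s m x - v x) (\<lambda>x. s m x - v x))) \<longlonglongrightarrow> 0"
    unfolding B_def L2_norm_def[symmetric] by blast
qed

lemma N_eq: "N w = L2_norm (wjac w)"
  by (simp add: N_def B_def L2_norm_def)

text \<open>The renormalized operator is \<open>T w\<close> minus the divergence of
  \<open>w\<close>; the latter contributes the product of the divergences, which the rotations
  complete to the Dirichlet form \<open>B\<close>.\<close>

lemma rho_form:
  assumes r: "r \<in> H1_t" and w: "w \<in> H1_t"
  shows "L2_inner (\<lambda>x. - wdiv r x) (\<lambda>x. renorm A b x * L_tilde A b w x) + L2_inner (rot r) (rot w)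
    = B r w - L2_inner (wdiv r) (T w)"
proof -
  note h = H1_t_H1_vec[OF r] H1_t_H1_vec[OF w]
  have "L2_inner (\<lambda>x. - wdiv r x) (\<lambda>x. renorm A b x * L_tilde A b w x)
      = - (L2_inner (wdiv r) (T w) - L2_inner (wdiv r) (wdiv w))"
    unfolding renorm_L_tilde L2_inner_minus_left
    by (simp add: L2_inner_diff_right L2_wdiv h L2_T w)
  then show ?thesis
    using rot_div_identity[OF r w] by (simp add: B_def)
qed

lemma rho_solution_iff:
  "rho_solution rot A b F \<rho> \<longleftrightarrow>
    \<rho> \<in> H1_t \<and> (\<forall>w\<in>H1_t. B \<rho> w = L2_inner F w + L2_inner (wdiv \<rho>) (T w))"
proof -
  have "(a = c) \<longleftrightarrow> (B \<rho> w = c + e)" if "a = B \<rho> w - e" for a c e w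
    using that by auto
  from this[OF rho_form] show ?thesis unfolding rho_solution_def by blast
qed

lemma wdiv_diff_inner:
  fixes r s :: "real^'n \<Rightarrow> real^'n"
  assumes "r \<in> H1_t" "s \<in> H1_t" "v \<in> L2_cube"
  shows "L2_inner (wdiv (\<lambda>x. r x - s x)) v = L2_inner (wdiv r) v - L2_inner (wdiv s) v"
proof -
  note h = assms(1,2)[THEN H1_t_H1_vec] H1_t_H1_vec[OF H1_t_diff[OF assms(1,2)]]
  have "AE x in Q. wdiv (\<lambda>x. r x - s x) x = wdiv r x - wdiv s x"
    using wjac_diff[OF h(1,2)] by eventually_elim (simp add: wdiv_eq_trace trace_eq_inner inner_diff_left)
  then have "L2_inner (wdiv (\<lambda>x. r x - s x)) v = L2_inner (\<lambda>x. wdiv r x - wdiv s x) v"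
    by (rule L2_inner_cong_left) (intro L2_wdiv L2_diff h assms)+
  then show ?thesis
    by (simp add: L2_inner_diff_left L2_wdiv h assms)
qed

lemma T_add_inner:
  assumes "u \<in> H1_t" "w \<in> H1_t" "v \<in> L2_cube"
  shows "L2_inner v (T (\<lambda>x. u x + w x)) = L2_inner v (T u) + L2_inner v (T w)"
proof -
  note h = assms(1,2)[THEN H1_t_H1_vec]
  have "AE x in Q. T (\<lambda>x. u x + w x) x = T u x + T w x"
    using wjac_add[OF h] unfolding T_def residual_eq by eventually_elim (simp add: inner_add_right)
  then have "L2_inner (T (\<lambda>x. u x + w x)) v = L2_inner (\<lambda>x. T u x + T w x) v"
    by (rule L2_inner_cong_left) (intro L2_T L2_add H1_t_add assms)+
  then show ?thesis
    by (simp add: L2_inner_add_left L2_T assms L2_inner_commute[of v])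
qed

lemma T_scale_inner:
  assumes "u \<in> H1_t" "v \<in> L2_cube"
  shows "L2_inner v (T (\<lambda>x. c *\<^sub>R u x)) = c * L2_inner v (T u)"
proof -
  note h = H1_t_H1_vec[OF assms(1)]
  have "AE x in Q. T (\<lambda>x. c *\<^sub>R u x) x = c * T u x"
    using wjac_scale[OF h, of c] unfolding T_def residual_eq by eventually_elim (simp add: algebra_simps)
  then have "L2_inner (T (\<lambda>x. c *\<^sub>R u x)) v = L2_inner (\<lambda>x. c * T u x) v"
    by (rule L2_inner_cong_left) (intro L2_T L2_cmult H1_t_scale assms)+
  then show ?thesis
    by (simp add: L2_inner_cmult_left L2_inner_commute[of v])
qed

lemma sqrt_\<kappa>: "0 \<le> sqrt \<kappa>" "sqrt \<kappa> < 1"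
  using \<kappa>_nonneg \<kappa>_less_1 by (auto simp: real_sqrt_lt_1_iff)

lemma wdiv_T_bound:
  assumes "r \<in> H1_t" "u \<in> H1_t"
  shows "\<bar>L2_inner (wdiv r) (T u)\<bar> \<le> sqrt \<kappa> * N r * N u"
proof -
  have "\<bar>L2_inner (wdiv r) (T u)\<bar> \<le> L2_norm (wdiv r) * L2_norm (T u)"
    by (intro L2_Cauchy_Schwarz L2_wdiv L2_T H1_t_H1_vec assms)
  also have "\<dots> \<le> N r * (sqrt \<kappa> * N u)"
    unfolding N_eq by (intro mult_mono wdiv_norm_le T_bound assms) auto
  finally show ?thesis by (simp add: mult_ac)
qed

lemma rho_exists: "\<exists>\<rho>. rho_solution rot A b F \<rho>"
proof -
  note F2 = L2_H1_vec[OF F_H1]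
  have L: "w \<in> L2_cube" if "w \<in> H1_t" for w :: "real^'n \<Rightarrow> real^'n"
    by (rule L2_H1_vec[OF H1_t_H1_vec[OF that]])
  have W: "wdiv w \<in> L2_cube" if "w \<in> H1_t" for w :: "real^'n \<Rightarrow> real^'n"
    by (rule L2_wdiv[OF H1_t_H1_vec[OF that]])
  obtain \<rho> where "\<rho> \<in> H1_t" "\<And>w. w \<in> H1_t \<Longrightarrow> B \<rho> w = L2_inner F w + L2_inner (wdiv \<rho>) (T w)"
  proof (rule perturbed_Riesz[of "L2_inner F" "L2_norm F" "\<lambda>r w. L2_inner (wdiv r) (T w)" "sqrt \<kappa>"])
    show "\<bar>L2_inner F u\<bar> \<le> L2_norm F * N u" if "u \<in> H1_t" for u
    proof -
      have "L2_norm u \<le> pi * L2_norm u"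
        using pi_ge_two mult_right_mono[of 1 pi "L2_norm u"] by simp
      also have "\<dots> \<le> N u"
        unfolding N_eq by (rule H1_t_Poincare_vec[OF that two_le_dim])
      finally have "L2_norm F * L2_norm u \<le> L2_norm F * N u" by (rule mult_left_mono) simp
      with L2_Cauchy_Schwarz[OF F2 L[OF that]] show ?thesis by linarith
    qed
  qed (auto simp: L2_inner_add_right L2_inner_scale_right F2 L W T_add_inner T_scale_inner
      wdiv_diff_inner L2_T wdiv_T_bound \<kappa>_nonneg \<kappa>_less_1 H1_t_diff)
  then show ?thesis unfolding rho_solution_iff by blast
qed

lemma rho_unique:
  assumes "rho_solution rot A b F \<rho>" "rho_solution rot A b F \<rho>'"
  shows "AE x in Q. \<rho>' x = \<rho> x"
proof -
  define d where "d = (\<lambda>x. \<rho>' x - \<rho> x)"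
  have r: "\<rho> \<in> H1_t" "\<rho>' \<in> H1_t" using assms by (auto simp: rho_solution_iff)
  have d: "d \<in> H1_t" unfolding d_def by (rule H1_t_diff[OF r(2,1)])
  have "B d d = B \<rho>' d - B \<rho> d"
    using B_diff[OF r(2,1) d] by (simp add: d_def)
  also have "\<dots> = L2_inner (wdiv d) (T d)"
    using assms d wdiv_diff_inner[OF r(2,1) L2_T[OF d]] by (simp add: rho_solution_iff d_def)
  also have "\<dots> \<le> sqrt \<kappa> * N d * N d"
    using wdiv_T_bound[OF d d] by linarith
  finally have "(1 - sqrt \<kappa>) * (N d)\<^sup>2 \<le> 0"
    unfolding N_power2[symmetric] by (simp add: algebra_simps power2_eq_square)
  then have "N d = 0"
    using sqrt_\<kappa>(2) by (simp add: mult_le_0_iff)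
  then have "pi * L2_norm d \<le> 0"
    using H1_t_Poincare_vec[OF d two_le_dim] by (simp add: N_eq)
  then have "L2_norm d = 0"
    using L2_norm_nonneg[of d] pi_gt_zero by (simp add: mult_le_0_iff)
  from L2_norm_eq_0_imp[OF L2_H1_vec[OF H1_t_H1_vec[OF d]] this]
  show ?thesis by (simp add: d_def)
qed

section \<open>The two very weak problems\<close>

lemma gradient_facts:
  fixes \<phi> :: "real^'n \<Rightarrow> real"
  assumes "\<phi> \<in> H2 \<inter> H10"
  shows "wgrad \<phi> \<in> H1_t" "AE x in Q. rot (wgrad \<phi>) x = 0"
proof -
  have \<phi>: "\<phi> \<in> H2" "\<phi> \<in> H10" using assms by auto
  show "wgrad \<phi> \<in> H1_t" by (rule H2_H10_gradient(1)[OF \<phi> two_le_dim])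
  show "AE x in Q. rot (wgrad \<phi>) x = 0"
    using H2_H10_gradient(2)[OF \<phi> two_le_dim]
  proof eventually_elim
    case (elim x)
    then have "R (whess \<phi> x) \<bullet> R (whess \<phi> x) = 0" by (simp add: R_inner)
    then show ?case by (simp add: rot_def whess_def)
  qed
qed

lemma rot_gradient_inner:
  assumes "\<phi> \<in> H2 \<inter> H10" "v \<in> L2_cube"
  shows "L2_inner v (rot (wgrad \<phi>)) = 0"
proof -
  have "L2_inner (rot (wgrad \<phi>)) v = L2_inner (\<lambda>x. 0) v"
    by (rule L2_inner_cong_left[OF gradient_facts(2)[OF assms(1)]])
      (intro L2_rot H1_t_H1_vec gradient_facts(1) assms L2_zero)+
  then show ?thesis by (simp add: L2_inner_commute[of v]) (simp add: L2_inner_def)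
qed

text \<open>Integration by parts in each component; \<phi> has zero boundary values, so
  \<open>F\<close> may be arbitrary on the boundary.\<close>

lemma F_gradient:
  assumes "\<phi> \<in> H2 \<inter> H10"
  shows "L2_inner F (wgrad \<phi>) = L2_inner f \<phi>"
proof -
  have \<phi>: "\<phi> \<in> H10" "\<phi> \<in> H1" using assms H10_H1 by auto
  note g1 = L2_H1_vec[OF H1_t_H1_vec[OF gradient_facts(1)[OF assms]]]
  have "L2_inner F (wgrad \<phi>) = (\<Sum>i\<in>UNIV. L2_inner (\<lambda>x. F x $ i) (wderiv i \<phi>))"
    unfolding L2_inner_vec[OF L2_H1_vec[OF F_H1] g1] by (simp add: wgrad_def)
  also have "\<dots> = (\<Sum>i\<in>UNIV. - L2_inner (wderiv i (\<lambda>x. F x $ i)) \<phi>)"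
    by (intro sum.cong refl H10_parts H1_vec_nth F_H1 \<phi>)
  also have "\<dots> = - L2_inner (wdiv F) \<phi>"
    unfolding wdiv_def[abs_def] sum_negf
    by (subst L2_inner_sum_left) (auto intro: H1D H1_vec_nth F_H1 \<phi>)
  also have "\<dots> = L2_inner (\<lambda>x. - wdiv F x) \<phi>"
    by (simp add: L2_inner_minus_left)
  also have "\<dots> = L2_inner f \<phi>"
    by (rule L2_inner_cong_left)
      (use f_eq in \<open>auto elim: eventually_mono intro: L2_minus L2_wdiv F_H1 f_L2 H1D \<phi>\<close>)
  finally show ?thesis .
qed

lemma renorm_solution:
  assumes "rho_solution rot A b F \<rho>"
  shows "renorm_very_weak_solution A b f (\<lambda>x. - wdiv \<rho> x)"
  unfolding renorm_very_weak_solution_def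
proof (intro conjI ballI)
  have \<rho>: "\<rho> \<in> H1_t" using assms by (simp add: rho_solution_def)
  show "(\<lambda>x. - wdiv \<rho> x) \<in> L2_cube"
    by (intro L2_minus L2_wdiv H1_t_H1_vec \<rho>)
  fix \<phi> :: "real^'n \<Rightarrow> real" assume \<phi>: "\<phi> \<in> H2 \<inter> H10"
  note w = gradient_facts(1)[OF \<phi>]
  have "L2_inner (\<lambda>x. - wdiv \<rho> x) (\<lambda>x. renorm A b x * L_tilde A b (wgrad \<phi>) x)
      + L2_inner (rot \<rho>) (rot (wgrad \<phi>)) = L2_inner F (wgrad \<phi>)"
    using assms w by (simp add: rho_solution_def)
  then show "L2_inner (\<lambda>x. - wdiv \<rho> x) (\<lambda>x. renorm A b x * L_op A b \<phi> x) = L2_inner f \<phi>"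
    unfolding renorm_L_op renorm_L_tilde F_gradient[OF \<phi>]
      rot_gradient_inner[OF \<phi> L2_rot[OF H1_t_H1_vec[OF \<rho>]]] by simp
qed

lemma L2_renorm_L_op:
  assumes "\<phi> \<in> H2 \<inter> H10"
  shows "(\<lambda>x. renorm A b x * L_op A b \<phi> x) \<in> L2_cube"
  unfolding renorm_L_op
  by (intro L2_diff L2_T L2_wdiv H1_t_H1_vec gradient_facts(1) assms)

text \<open>The Miranda-Talenti estimate, on the cube with equality: the Hessian and the Laplacian
  have the same norm, since the rotation of a gradient vanishes.\<close>

lemma gradient_norm:
  fixes \<phi> :: "real^'n \<Rightarrow> real"
  assumes "\<phi> \<in> H2 \<inter> H10"
  shows "L2_norm (wjac (wgrad \<phi>)) = L2_norm (wdiv (wgrad \<phi>))"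
proof -
  note w = gradient_facts(1)[OF assms]
  have "L2_inner (wjac (wgrad \<phi>)) (wjac (wgrad \<phi>)) = L2_inner (wdiv (wgrad \<phi>)) (wdiv (wgrad \<phi>))"
    using rot_div_identity[OF w w] rot_gradient_inner[OF assms L2_rot[OF H1_t_H1_vec[OF w]]] by simp
  then show ?thesis by (simp add: L2_norm_def)
qed

text \<open>
  Testing with the functions \<open>\<phi>\<^sub>N\<close> whose negative Laplacian is the sine expansion \<open>S\<^sub>N\<close> of \<open>v\<close> gives
  \<open>|S\<^sub>N|\<^sup>2 \<le> q |v| |S\<^sub>N|\<close> with \<open>q < 1\<close>.
\<close>

lemma renorm_homogeneous:
  assumes v: "v \<in> L2_cube"
    and orth: "\<And>\<phi>. \<phi> \<in> H2 \<inter> H10 \<Longrightarrow> L2_inner v (\<lambda>x. renorm A b x * L_op A b \<phi> x) = 0"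
  shows "AE x in Q. v x = 0"
proof -
  have le: "(L2_norm (fsum {} N v))\<^sup>2 \<le> sqrt \<kappa> * L2_norm v * L2_norm (fsum {} N v)" for N
  proof -
    define w where "w = wgrad (sine_inv_laplace N v)"
    have w: "w \<in> H1_t" unfolding w_def by (rule gradient_facts(1)[OF sine_inv_laplace_in])
    note w2 = L2_wdiv[OF H1_t_H1_vec[OF w]]
    have ae: "AE x in Q. wdiv w x = - fsum {} N v x"
      using trace_whess_sine_inv_laplace[of N v] by (simp add: w_def wdiv_eq_trace whess_def)
    note S2 = L2_fsum[of "{}" N v]
    have nrm: "L2_norm (wjac w) = L2_norm (fsum {} N v)"
    proof -
      have "L2_norm (wdiv w) = L2_norm (\<lambda>x. - fsum {} N v x)"
        by (rule L2_norm_cong[OF ae L2D(1)[OF w2] L2D(1)[OF L2_minus[OF S2]]])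
      then show ?thesis
        using gradient_norm[OF sine_inv_laplace_in, of N v] by (simp add: w_def L2_norm_minus)
    qed
    have "0 = L2_inner v (T w) - L2_inner v (wdiv w)"
      using orth[OF sine_inv_laplace_in, of N v] unfolding renorm_L_op
      by (simp add: w_def[symmetric] L2_inner_diff_right v L2_T w w2)
    also have "L2_inner v (wdiv w) = L2_inner v (\<lambda>x. - fsum {} N v x)"
      unfolding L2_inner_commute[of v] by (rule L2_inner_cong_left[OF ae w2 L2_minus[OF S2] v])
    \<comment> \<open>The sine sum is the orthogonal projection of \<open>v\<close>, so pairing it
      with \<open>v\<close> gives its squared norm.\<close>
    also have "\<dots> = - (L2_norm (fsum {} N v))\<^sup>2"
      unfolding L2_inner_minus_right L2_norm_power2 fsum_inner_fsum[OF v v order_refl] ..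
    finally have "(L2_norm (fsum {} N v))\<^sup>2 = - L2_inner v (T w)" by simp
    also have "\<dots> \<le> L2_norm v * L2_norm (T w)"
      using L2_Cauchy_Schwarz[OF v L2_T[OF w]] by linarith
    also have "\<dots> \<le> L2_norm v * (sqrt \<kappa> * L2_norm (wjac w))"
      by (intro mult_left_mono T_bound w) simp
    finally show ?thesis unfolding nrm by (simp add: mult_ac)
  qed
  have lim: "(\<lambda>N. L2_norm (fsum {} N v)) \<longlonglongrightarrow> L2_norm v"
    by (rule L2_tendsto_norm[OF L2_tendsto_fsum[OF v] L2_fsum v])
  have "(L2_norm v)\<^sup>2 \<le> sqrt \<kappa> * L2_norm v * L2_norm v"
  proof (rule LIMSEQ_le)
    show "(\<lambda>N. (L2_norm (fsum {} N v))\<^sup>2) \<longlonglongrightarrow> (L2_norm v)\<^sup>2" by (intro tendsto_power lim)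
    show "(\<lambda>N. sqrt \<kappa> * L2_norm v * L2_norm (fsum {} N v)) \<longlonglongrightarrow> sqrt \<kappa> * L2_norm v * L2_norm v"
      by (intro tendsto_mult tendsto_const lim)
  qed (use le in blast)
  then have "(1 - sqrt \<kappa>) * (L2_norm v)\<^sup>2 \<le> 0"
    by (simp add: algebra_simps power2_eq_square)
  then have "L2_norm v = 0"
    using sqrt_\<kappa>(2) by (simp add: mult_le_0_iff)
  then show ?thesis by (rule L2_norm_eq_0_imp[OF v])
qed

lemma renorm_unique:
  assumes "renorm_very_weak_solution A b f u" "renorm_very_weak_solution A b f u'"
  shows "AE x in Q. u' x = u x"
proof -
  have u: "u \<in> L2_cube" "u' \<in> L2_cube"
    using assms by (auto simp: renorm_very_weak_solution_def)
  have "AE x in Q. u' x - u x = 0"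
    by (rule renorm_homogeneous[OF L2_diff[OF u(2,1)]])
      (use assms in \<open>simp add: renorm_very_weak_solution_def L2_inner_diff_left u L2_renorm_L_op\<close>)
  then show ?thesis by simp
qed

text \<open>The factor \<gamma> moves from the test side to the solution; its upper bound keeps the
  product in \<open>L2\<close>.\<close>

lemma very_weak_solution_mult:
  assumes "renorm_very_weak_solution A b f ut"
  shows "very_weak_solution A b f (\<lambda>x. renorm A b x * ut x)"
proof -
  obtain l u where lu: "0 < l" "AE x in Q. l \<le> g x \<and> g x \<le> u" by (rule g_bounds)
  have ut: "ut \<in> L2_cube" using assms by (simp add: renorm_very_weak_solution_def)
  have "(\<lambda>x. g x * ut x) \<in> L2_cube"
  proof (rule L2_bound[OF ut, of _ u])
    show "(\<lambda>x. g x * ut x) \<in> borel_measurable Q" using g_measurable L2D(1)[OF ut] by measurable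
    show "AE x in Q. norm (g x * ut x) \<le> u * norm (ut x)"
      using lu(2)
    proof eventually_elim
      case (elim x)
      then have "\<bar>g x\<bar> * \<bar>ut x\<bar> \<le> u * \<bar>ut x\<bar>" using lu(1) by (intro mult_right_mono) auto
      then show ?case by (simp add: abs_mult)
    qed
  qed
  with assms show ?thesis
    by (simp add: very_weak_solution_def renorm_very_weak_solution_def g_def L2_inner_def mult_ac)
qed

text \<open>The converse translation, by which the original problem inherits uniqueness. The
  quotient stays in \<open>L2\<close> by the positive lower bound for \<gamma>.\<close>

lemma very_weak_solution_divide:
  assumes "very_weak_solution A b f u"
  shows "renorm_very_weak_solution A b f (\<lambda>x. u x / renorm A b x)"
proof -
  obtain l c where lc: "0 < l" "AE x in Q. l \<le> g x \<and> g x \<le> c" by (rule g_bounds)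
  have u: "u \<in> L2_cube" using assms by (simp add: very_weak_solution_def)
  have m: "(\<lambda>x. u x / g x) \<in> borel_measurable Q" using g_measurable L2D(1)[OF u] by measurable
  have "(\<lambda>x. u x / g x) \<in> L2_cube"
  proof (rule L2_bound[OF u m])
    show "AE x in Q. norm (u x / g x) \<le> (1 / l) * norm (u x)"
      using lc(2)
    proof eventually_elim
      case (elim x)
      then have "\<bar>u x\<bar> / \<bar>g x\<bar> \<le> \<bar>u x\<bar> / l" using lc(1) by (intro frac_le) auto
      then show ?case by (simp add: abs_divide)
    qed
  qed
  moreover have "L2_inner (\<lambda>x. u x / g x) (\<lambda>x. renorm A b x * L_op A b \<phi> x) = L2_inner u (L_op A b \<phi>)"
    if \<phi>: "\<phi> \<in> H2 \<inter> H10" for \<phi>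
    unfolding L2_inner_def
  proof (rule integral_cong_AE)
    note w = H1_t_H1_vec[OF gradient_facts(1)[OF \<phi>]]
    have L: "L_op A b \<phi> \<in> borel_measurable Q"
      unfolding L_op_def[abs_def] whess_def
      using A_measurable b_measurable L2D(1)[OF L2_wjac[OF w]] L2D(1)[OF L2_H1_vec[OF w]] by measurable
    show "(\<lambda>x. u x \<bullet> L_op A b \<phi> x) \<in> borel_measurable Q"
      using L L2D(1)[OF u] by measurable
    show "(\<lambda>x. (u x / g x) \<bullet> (renorm A b x * L_op A b \<phi> x)) \<in> borel_measurable Q"
      using m L2D(1)[OF L2_renorm_L_op[OF \<phi>]] by measurable
    show "AE x in Q. (u x / g x) \<bullet> (renorm A b x * L_op A b \<phi> x) = u x \<bullet> L_op A b \<phi> x"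
      using lc(2)
    proof eventually_elim
      case (elim x)
      then show ?case using lc(1) by (simp add: g_def)
    qed
  qed
  ultimately show ?thesis
    using assms by (simp add: renorm_very_weak_solution_def very_weak_solution_def g_def)
qed

lemma unique_solutions:
  "\<exists>u ut \<rho>.
     unique_AE (very_weak_solution A b f) u \<and>
     unique_AE (renorm_very_weak_solution A b f) ut \<and>
     unique_AE (rho_solution rot A b F) \<rho> \<and>
     (AE x in Q. u x = renorm A b x * ut x) \<and>
     (AE x in Q. u x = trace (A x) / ((norm (A x))\<^sup>2 + (norm (b x))\<^sup>2) * (- wdiv \<rho> x))"
proof -
  obtain \<rho> where \<rho>: "rho_solution rot A b F \<rho>" using rho_exists by blast
  define ut where "ut x = - wdiv \<rho> x" for x
  define u where "u x = renorm A b x * ut x" for x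
  have ut: "renorm_very_weak_solution A b f ut"
    unfolding ut_def by (rule renorm_solution[OF \<rho>])
  have u: "very_weak_solution A b f u"
    unfolding u_def by (rule very_weak_solution_mult[OF ut])
  obtain l c where lc: "0 < l" "AE x in Q. l \<le> g x \<and> g x \<le> c" by (rule g_bounds)
  have "AE x in Q. u' x = u x" if "very_weak_solution A b f u'" for u'
    using renorm_unique[OF ut very_weak_solution_divide[OF that]] lc(2)
  proof eventually_elim
    case (elim x)
    then show ?case using lc(1) by (auto simp: u_def g_def field_simps)
  qed
  then have "unique_AE (very_weak_solution A b f) u"
    using u by (simp add: unique_AE_def)
  moreover have "unique_AE (renorm_very_weak_solution A b f) ut"
    using ut renorm_unique[OF ut] by (simp add: unique_AE_def)
  moreover have "unique_AE (rho_solution rot A b F) \<rho>"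
    using \<rho> rho_unique[OF \<rho>] by (simp add: unique_AE_def)
  moreover have "AE x in Q. u x = renorm A b x * ut x"
    by (simp add: u_def)
  moreover have "AE x in Q. u x = trace (A x) / ((norm (A x))\<^sup>2 + (norm (b x))\<^sup>2) * (- wdiv \<rho> x)"
    by (simp add: u_def ut_def renorm_def)
  ultimately show ?thesis by blast
qed

end

section \<open>Two and three dimensions\<close>

text \<open>The order of the indices follows \<open>wjac\<close>, whose entry (i, j) is the
  derivative of component \<open>i\<close> in direction \<open>j\<close>.\<close>

definition skew2 :: "real^2^2 \<Rightarrow> real" where
  "skew2 M = M $ 1 $ 2 - M $ 2 $ 1"

definition skew3 :: "real^3^3 \<Rightarrow> real^3" where
  "skew3 M = vector [M $ 3 $ 2 - M $ 2 $ 3, M $ 1 $ 3 - M $ 3 $ 1, M $ 2 $ 1 - M $ 1 $ 2]"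

interpretation rot2: rot_operator skew2
proof (rule rot_operator.intro)
  show "linear skew2" by (rule linearI) (simp_all add: skew2_def algebra_simps)
  show "skew2 M \<bullet> skew2 N = M \<bullet> N - M \<bullet> transpose N" for M N
    by (simp add: skew2_def matrix_inner sum_2 transpose_def algebra_simps)
qed simp

interpretation rot3: rot_operator skew3
proof (rule rot_operator.intro)
  show "linear skew3"
    by (rule linearI) (simp_all add: skew3_def vec_eq_iff forall_3 algebra_simps)
  show "skew3 M \<bullet> skew3 N = M \<bullet> N - M \<bullet> transpose N" for M N
    by (simp add: skew3_def matrix_inner inner_vec_def[of "vector _"] sum_3 transpose_def algebra_simps)
qed simp

lemma rot2_eq: "rot2.rot = rot2"
  by (intro ext) (simp add: rot2.rot_def skew2_def rot2_def wjac_nth)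

lemma rot3_eq: "rot3.rot = rot3"
  by (intro ext) (simp add: rot3.rot_def skew3_def rot3_def wjac_nth)

theorem theorem6p1:
  shows "(\<forall>(A :: real^2 \<Rightarrow> real^2^2) b f F \<delta>.
        A \<in> Linf \<and> (AE x in lebesgue_on cube. transpose (A x) = A x) \<and> uniformly_elliptic A \<and>
        b \<in> Linf \<and> f \<in> L2_cube \<and>
        F \<in> H1_vec \<and> (AE x in lebesgue_on cube. f x = - wdiv F x) \<and>
        delta0 b < \<delta> \<and> \<delta> \<le> 1 \<and>
        (AE x in lebesgue_on cube.
           ((norm (A x))\<^sup>2 + (norm (b x))\<^sup>2) / (trace (A x))\<^sup>2 \<le> 1 / (real CARD(2) - 1 + \<delta>))
        \<longrightarrow>
        (\<exists>u ut \<rho>.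
           unique_AE (very_weak_solution A b f) u \<and>
           unique_AE (renorm_very_weak_solution A b f) ut \<and>
           unique_AE (rho_solution rot2 A b F) \<rho> \<and>
           (AE x in lebesgue_on cube. u x = renorm A b x * ut x) \<and>
           (AE x in lebesgue_on cube.
              u x = trace (A x) / ((norm (A x))\<^sup>2 + (norm (b x))\<^sup>2) * (- wdiv \<rho> x))))
    \<and>
    (\<forall>(A :: real^3 \<Rightarrow> real^3^3) b f F \<delta>.
        A \<in> Linf \<and> (AE x in lebesgue_on cube. transpose (A x) = A x) \<and> uniformly_elliptic A \<and>
        b \<in> Linf \<and> f \<in> L2_cube \<and>
        F \<in> H1_vec \<and> (AE x in lebesgue_on cube. f x = - wdiv F x) \<and>
        delta0 b < \<delta> \<and> \<delta> \<le> 1 \<and>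
        (AE x in lebesgue_on cube.
           ((norm (A x))\<^sup>2 + (norm (b x))\<^sup>2) / (trace (A x))\<^sup>2 \<le> 1 / (real CARD(3) - 1 + \<delta>))
        \<longrightarrow>
        (\<exists>u ut \<rho>.
           unique_AE (very_weak_solution A b f) u \<and>
           unique_AE (renorm_very_weak_solution A b f) ut \<and>
           unique_AE (rho_solution rot3 A b F) \<rho> \<and>
           (AE x in lebesgue_on cube. u x = renorm A b x * ut x) \<and>
           (AE x in lebesgue_on cube.
              u x = trace (A x) / ((norm (A x))\<^sup>2 + (norm (b x))\<^sup>2) * (- wdiv \<rho> x))))"
proof (intro conjI allI impI; elim conjE)
  fix A :: "real^2 \<Rightarrow> real^2^2" and b :: "real^2 \<Rightarrow> real^2" and f :: "real^2 \<Rightarrow> real"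
    and F :: "real^2 \<Rightarrow> real^2" and \<delta> :: real
  assume "A \<in> Linf" "uniformly_elliptic A" "b \<in> Linf" "f \<in> L2_cube" "F \<in> H1_vec"
    "AE x in lebesgue_on cube. f x = - wdiv F x" "delta0 b < \<delta>" "\<delta> \<le> 1"
    "AE x in lebesgue_on cube.
      ((norm (A x))\<^sup>2 + (norm (b x))\<^sup>2) / (trace (A x))\<^sup>2 \<le> 1 / (real CARD(2) - 1 + \<delta>)"
  then interpret cordes skew2 A b f F \<delta> by unfold_locales
  show "\<exists>u ut \<rho>.
      unique_AE (very_weak_solution A b f) u \<and>
      unique_AE (renorm_very_weak_solution A b f) ut \<and>
      unique_AE (rho_solution rot2 A b F) \<rho> \<and>
      (AE x in lebesgue_on cube. u x = renorm A b x * ut x) \<and>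
      (AE x in lebesgue_on cube.
         u x = trace (A x) / ((norm (A x))\<^sup>2 + (norm (b x))\<^sup>2) * (- wdiv \<rho> x))"
    using unique_solutions unfolding rot2_eq .
next
  fix A :: "real^3 \<Rightarrow> real^3^3" and b :: "real^3 \<Rightarrow> real^3" and f :: "real^3 \<Rightarrow> real"
    and F :: "real^3 \<Rightarrow> real^3" and \<delta> :: real
  assume "A \<in> Linf" "uniformly_elliptic A" "b \<in> Linf" "f \<in> L2_cube" "F \<in> H1_vec"
    "AE x in lebesgue_on cube. f x = - wdiv F x" "delta0 b < \<delta>" "\<delta> \<le> 1"
    "AE x in lebesgue_on cube.
      ((norm (A x))\<^sup>2 + (norm (b x))\<^sup>2) / (trace (A x))\<^sup>2 \<le> 1 / (real CARD(3) - 1 + \<delta>)"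
  then interpret cordes skew3 A b f F \<delta> by unfold_locales
  show "\<exists>u ut \<rho>.
      unique_AE (very_weak_solution A b f) u \<and>
      unique_AE (renorm_very_weak_solution A b f) ut \<and>
      unique_AE (rho_solution rot3 A b F) \<rho> \<and>
      (AE x in lebesgue_on cube. u x = renorm A b x * ut x) \<and>
      (AE x in lebesgue_on cube.
         u x = trace (A x) / ((norm (A x))\<^sup>2 + (norm (b x))\<^sup>2) * (- wdiv \<rho> x))"
    using unique_solutions unfolding rot3_eq .
qed

end
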